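(* Let $Z$ be a nonempty finite set of points in $\mathbb{P}^2_{\mathbb{C}}$ and let $\alpha(D_0(\mathcal{A}_Z))$ denote the initial degree of $D_0(\mathcal{A}_Z)$. Define $$a=\min\left\{\alpha(D_0(\mathcal{A}_Z)),\ \left\lfloor\frac{|Z|-1}{2}\right\rfloor\right\}.$$ Then $D_0(\mathcal{A}_Z)$ has splitting type $(a,\,|Z|-a-1)$.
   Context: Let $S=\mathbb{C}[Y_0,Y_1,Y_2]$ be the coordinate ring of the dual projective plane. $\mathcal{A}_Z$ is the line arrangement in the dual plane consisting of the lines $\{c_0Y_0+c_1Y_1+c_2Y_2=0\}$ for $(c_0:c_1:c_2)\in Z$. For a line arrangement $\mathcal{A}$, $D(\mathcal{A})$ is the $S$-module of $\mathbb{C}$-linear derivations $\theta:S\to S$ with $\theta(I(H))\subseteq I(H)$ for all $H\in\mathcal{A}$, graded so that $\deg\theta=\deg\theta(\ell)$ for linear forms $\ell$. $\theta_e=\sum_iY_i\,\partial/\partial Y_i$ and $D_0(\mathcal{A})=D(\mathcal{A})/S\theta_e$. The initial degree of a graded module $M$ is $\alpha(M)=\inf\{d:[M]_d\neq0\}$. For nonempty $\mathcal{A}$, the splitting type of $D_0(\mathcal{A})$ is the unique pair of integers $0\le a_1\leq a_2$ such that, for a general line $L$ in the dual plane, the restriction of the sheaf $\widetilde{D_0(\mathcal{A})}$ to $L$ is isomorphic to $\mathcal{O}_L(-a_1)\oplus\mathcal{O}_L(-a_2)$. *)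

theory Defs
  imports
    "HOL-Analysis.Analysis"
    "HOL-Library.Poly_Mapping"
    "HOL-Algebra.Module"
    "HOL-Algebra.AbelCoset"
    "HOL-Algebra.Generated_Groups"
begin

section \<open>The polynomial ring in three variables\<close>

text \<open>The three variables are indexed by the three-element type \<open>3\<close>; a monomial is its
  exponent vector.\<close>

type_synonym poly3 = "(3 \<Rightarrow>\<^sub>0 nat) \<Rightarrow>\<^sub>0 complex"

definition Const :: "complex \<Rightarrow> poly3"
  where "Const c = Poly_Mapping.single 0 c"

definition Var :: "3 \<Rightarrow> poly3"
  where "Var i = Poly_Mapping.single (Poly_Mapping.single i 1) 1"

definition mdeg :: "(3 \<Rightarrow>\<^sub>0 nat) \<Rightarrow> nat"
  where "mdeg m = (\<Sum>i\<in>UNIV. Poly_Mapping.lookup m i)"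

definition eval_at :: "poly3 \<Rightarrow> complex ^ 3 \<Rightarrow> complex"
  where "eval_at f y = (\<Sum>m\<in>Poly_Mapping.keys f. Poly_Mapping.lookup f m * (\<Prod>i\<in>UNIV. (y $ i) ^ Poly_Mapping.lookup m i))"

definition pderivative :: "3 \<Rightarrow> poly3 \<Rightarrow> poly3"
  where "pderivative i f =
    (\<Sum>m\<in>Poly_Mapping.keys f. Poly_Mapping.single (m - Poly_Mapping.single i 1) (of_nat (Poly_Mapping.lookup m i) * Poly_Mapping.lookup f m))"

definition homog :: "int \<Rightarrow> poly3 set"
  where "homog d = {f. \<forall>m\<in>Poly_Mapping.keys f. int (mdeg m) = d}"

text \<open>The total degree, used only for nonzero homogeneous polynomials.\<close>

definition tdeg :: "poly3 \<Rightarrow> nat"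
  where "tdeg f = Max (mdeg ` Poly_Mapping.keys f)"


section \<open>The projective plane, its lines and its Zariski topology\<close>

text \<open>Points are the one-dimensional subspaces of \<open>\<complex>\<^sup>3\<close>. The same set models the plane that
  contains \<open>Z\<close> and the dual plane; \<open>S = \<complex>[Y\<^sub>0, Y\<^sub>1, Y\<^sub>2]\<close> is the coordinate ring of the latter.\<close>

definition proj_plane :: "(complex ^ 3) set set"
  where "proj_plane = {p. vec.subspace p \<and> vec.dim p = 1}"

text \<open>For a point \<open>p = (c\<^sub>0 : c\<^sub>1 : c\<^sub>2)\<close>, the line \<open>c\<^sub>0 Y\<^sub>0 + c\<^sub>1 Y\<^sub>1 + c\<^sub>2 Y\<^sub>2 = 0\<close> of the dual plane.\<close>

definition dual_line :: "(complex ^ 3) set \<Rightarrow> (complex ^ 3) set set"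
  where "dual_line p = {q \<in> proj_plane. \<forall>c\<in>p. \<forall>y\<in>q. (\<Sum>i\<in>UNIV. c $ i * y $ i) = 0}"

definition arrangement :: "(complex ^ 3) set set \<Rightarrow> (complex ^ 3) set set set"
  where "arrangement Z = dual_line ` Z"

definition vanishing_ideal :: "(complex ^ 3) set set \<Rightarrow> poly3 set"
  where "vanishing_ideal X = {f. \<forall>q\<in>X. \<forall>y\<in>q. eval_at f y = 0}"

text \<open>The open sets are the complements of the common zero loci of families of homogeneous
  polynomials. As \<open>f\<close> is homogeneous, it is nonzero at the point \<open>p\<close> iff it is nonzero at
  some vector of \<open>p\<close>.\<close>

definition zariski_open :: "(complex ^ 3) set set \<Rightarrow> bool"
  where "zariski_open U \<longleftrightarrow> (\<exists>T. (\<forall>f\<in>T. \<exists>d. f \<in> homog d) \<and>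
    U = {p \<in> proj_plane. \<exists>f\<in>T. \<exists>y\<in>p. eval_at f y \<noteq> 0})"


section \<open>Graded modules\<close>

text \<open>Module records extend ring records, so the fields \<open>mult\<close> and \<open>one\<close> exist but have no meaning.
  The component \<open>hcomp M d\<close> is the homogeneous part of degree \<open>d\<close>.\<close>

record ('a, 'b) graded_module = "('a, 'b) module" +
  hcomp :: "int \<Rightarrow> 'b set"

definition quotient_module :: "('a, 'b, 'x) module_scheme \<Rightarrow> 'b set \<Rightarrow> ('a, 'b set) module"
  where "quotient_module M N =
    \<lparr>carrier = a_rcosets\<^bsub>M\<^esub> N, mult = undefined, one = undefined,
     zero = N, add = set_add M,
     smult = (\<lambda>r X. \<Union>x\<in>X. N +>\<^bsub>M\<^esub> (r \<odot>\<^bsub>M\<^esub> x))\<rparr>"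

definition graded_quotient ::
    "('a, 'b) graded_module \<Rightarrow> 'b set \<Rightarrow> ('a, 'b set) graded_module"
  where "graded_quotient M N = module.extend (quotient_module M N)
    (graded_module.fields (\<lambda>d. (\<lambda>x. N +>\<^bsub>M\<^esub> x) ` hcomp M d))"

text \<open>Only meaningful if the set of degrees is nonempty and bounded below: \<open>Inf\<close> on \<open>int\<close> is
  unspecified otherwise.\<close>

definition initial_degree :: "('a, 'b) graded_module \<Rightarrow> int"
  where "initial_degree M = Inf {d. hcomp M d \<noteq> {\<zero>\<^bsub>M\<^esub>}}"

text \<open>The free module \<open>S(n)\<close>, with \<open>S(n)\<^sub>d = S\<^sub>n\<^sub>+\<^sub>d\<close>.\<close>

definition S_twist :: "int \<Rightarrow> (poly3, poly3) graded_module"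
  where "S_twist n =
    \<lparr>carrier = UNIV, mult = (*), one = 1, zero = 0, add = (+), smult = (*),
     hcomp = (\<lambda>d. homog (n + d))\<rparr>"


section \<open>Logarithmic derivations\<close>

definition derivation :: "(poly3 \<Rightarrow> poly3) \<Rightarrow> bool"
  where "derivation \<theta> \<longleftrightarrow>
    (\<forall>f g. \<theta> (f + g) = \<theta> f + \<theta> g) \<and>
    (\<forall>c f. \<theta> (Const c * f) = Const c * \<theta> f) \<and>
    (\<forall>f g. \<theta> (f * g) = f * \<theta> g + g * \<theta> f)"

definition euler :: "poly3 \<Rightarrow> poly3"
  where "euler f = (\<Sum>i\<in>UNIV. Var i * pderivative i f)"

definition log_derivations :: "(complex ^ 3) set set set \<Rightarrow> (poly3 \<Rightarrow> poly3) set"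
  where "log_derivations A =
    {\<theta>. derivation \<theta> \<and> (\<forall>H\<in>A. \<theta> ` vanishing_ideal H \<subseteq> vanishing_ideal H)}"

definition D_module ::
    "(complex ^ 3) set set set \<Rightarrow> (poly3, poly3 \<Rightarrow> poly3) graded_module"
  where "D_module A =
    \<lparr>carrier = log_derivations A, mult = undefined, one = undefined,
     zero = (\<lambda>f. 0), add = (\<lambda>\<theta> \<eta> f. \<theta> f + \<eta> f), smult = (\<lambda>g \<theta> f. g * \<theta> f),
     hcomp = (\<lambda>d. {\<theta> \<in> log_derivations A. \<forall>l\<in>homog 1. \<theta> l \<in> homog d})\<rparr>"

definition D0_module ::
    "(complex ^ 3) set set set \<Rightarrow> (poly3, (poly3 \<Rightarrow> poly3) set) graded_module"
  where "D0_module A = graded_quotient (D_module A) {(\<lambda>f. g * euler f) | g. True}"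


section \<open>Sheaves on the dual plane\<close>

text \<open>A sheaf of modules on \<open>Proj S\<close> is given by its sections over the basic open sets \<open>D\<^sub>+(f)\<close>,
  where \<open>f\<close> is nonzero and homogeneous of positive degree, with the restriction maps
  between them. The sections of the sheaf associated with a graded module \<open>M\<close> over \<open>D\<^sub>+(f)\<close> are
  the degree-zero part \<open>M\<^sub>(\<^sub>f\<^sub>)\<close> of the localization \<open>M\<^sub>f\<close>. The fraction \<open>m / f\<^sup>k\<close> is the class of
  the pair \<open>(m, k)\<close>, with \<open>m\<close> homogeneous of degree \<open>k deg f\<close>.\<close>

type_synonym 'b fractions = "('b \<times> nat) set"

definition base :: "poly3 set"
  where "base = {f. f \<noteq> 0 \<and> (\<exists>d>0. f \<in> homog d)}"

definition fraction :: "(poly3, 'b) graded_module \<Rightarrow> poly3 \<Rightarrow> 'b \<Rightarrow> nat \<Rightarrow> 'b fractions"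
  where "fraction M f m k =
    {(m', k'). m' \<in> hcomp M (int (k' * tdeg f)) \<and>
      (\<exists>n. f ^ (n + k') \<odot>\<^bsub>M\<^esub> m = f ^ (n + k) \<odot>\<^bsub>M\<^esub> m')}"

definition hom_localization ::
    "(poly3, 'b) graded_module \<Rightarrow> poly3 \<Rightarrow> (poly3 fractions, 'b fractions) module"
  where "hom_localization M f =
    \<lparr>carrier = {fraction M f m k | m k. m \<in> hcomp M (int (k * tdeg f))},
     mult = undefined, one = undefined,
     zero = fraction M f \<zero>\<^bsub>M\<^esub> 0,
     add = (\<lambda>X X'. \<Union>(m, k)\<in>X. \<Union>(m', k')\<in>X'.
              fraction M f ((f ^ k' \<odot>\<^bsub>M\<^esub> m) \<oplus>\<^bsub>M\<^esub> (f ^ k \<odot>\<^bsub>M\<^esub> m')) (k + k')),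
     smult = (\<lambda>R X. \<Union>(g, j)\<in>R. \<Union>(m, k)\<in>X. fraction M f (g \<odot>\<^bsub>M\<^esub> m) (j + k))\<rparr>"

record 'b base_sheaf =
  sections :: "poly3 \<Rightarrow> (poly3 fractions, 'b) module"
  restriction :: "poly3 \<Rightarrow> poly3 \<Rightarrow> 'b \<Rightarrow> 'b"

text \<open>\<open>D\<^sub>+(g) \<subseteq> D\<^sub>+(f)\<close> means that \<open>f\<close> divides a power of \<open>g\<close>. If \<open>g\<^sup>n = f h\<close>, then the restriction
  of \<open>m / f\<^sup>k\<close> to \<open>D\<^sub>+(g)\<close> is \<open>h\<^sup>k m / g\<^sup>n\<^sup>k\<close>, whatever the choice of \<open>n\<close> and \<open>h\<close>.\<close>

definition sheaf_of :: "(poly3, 'b) graded_module \<Rightarrow> 'b fractions base_sheaf"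
  where "sheaf_of M =
    \<lparr>sections = hom_localization M,
     restriction = (\<lambda>f g X. \<Union>(m, k)\<in>X. \<Union>(n, h)\<in>{(n, h). g ^ n = f * h}.
                      fraction M g (h ^ k \<odot>\<^bsub>M\<^esub> m) (n * k))\<rparr>"

definition structure_sheaf :: "poly3 fractions base_sheaf"
  where "structure_sheaf = sheaf_of (S_twist 0)"

definition sheaf_iso :: "'b base_sheaf \<Rightarrow> 'c base_sheaf \<Rightarrow> bool"
  where "sheaf_iso F G \<longleftrightarrow> (\<exists>\<phi>.
    (\<forall>f\<in>base.
       bij_betw (\<phi> f) (carrier (sections F f)) (carrier (sections G f)) \<and>
       (\<forall>x\<in>carrier (sections F f). \<forall>y\<in>carrier (sections F f).
          \<phi> f (x \<oplus>\<^bsub>sections F f\<^esub> y) = \<phi> f x \<oplus>\<^bsub>sections G f\<^esub> \<phi> f y) \<and>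
       (\<forall>r\<in>carrier (sections structure_sheaf f). \<forall>x\<in>carrier (sections F f).
          \<phi> f (r \<odot>\<^bsub>sections F f\<^esub> x) = r \<odot>\<^bsub>sections G f\<^esub> \<phi> f x)) \<and>
    (\<forall>f\<in>base. \<forall>g\<in>base. (\<exists>n. f dvd g ^ n) \<longrightarrow>
       (\<forall>x\<in>carrier (sections F f).
          \<phi> g (restriction F f g x) = restriction G f g (\<phi> f x))))"

definition direct_sum :: "'b base_sheaf \<Rightarrow> 'c base_sheaf \<Rightarrow> ('b \<times> 'c) base_sheaf"
  where "direct_sum F G =
    \<lparr>sections = (\<lambda>f.
       \<lparr>carrier = carrier (sections F f) \<times> carrier (sections G f),
        mult = undefined, one = undefined,
        zero = (\<zero>\<^bsub>sections F f\<^esub>, \<zero>\<^bsub>sections G f\<^esub>),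
        add = (\<lambda>(x, y) (x', y'). (x \<oplus>\<^bsub>sections F f\<^esub> x', y \<oplus>\<^bsub>sections G f\<^esub> y')),
        smult = (\<lambda>r (x, y). (r \<odot>\<^bsub>sections F f\<^esub> x, r \<odot>\<^bsub>sections G f\<^esub> y))\<rparr>),
     restriction = (\<lambda>f g (x, y). (restriction F f g x, restriction G f g y))\<rparr>"


section \<open>Restriction to a line and splitting type\<close>

text \<open>The restriction of a quasi-coherent sheaf \<open>F\<close> to a closed subvariety \<open>X\<close> with ideal sheaf \<open>I\<close>
  is \<open>F \<otimes> \<O>\<^sub>X = F / I F\<close>. It is regarded as a sheaf on the plane annihilated by \<open>I\<close>; over
  the affine open set \<open>D\<^sub>+(f)\<close> its sections are \<open>F(D\<^sub>+(f)) / I(D\<^sub>+(f)) F(D\<^sub>+(f))\<close>.\<close>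

definition ideal_sections :: "(complex ^ 3) set set \<Rightarrow> poly3 \<Rightarrow> poly3 fractions set"
  where "ideal_sections X f =
    {fraction (S_twist 0) f g k | g k. g \<in> vanishing_ideal X \<inter> homog (int (k * tdeg f))}"

definition ideal_mult :: "'a set \<Rightarrow> ('a, 'b, 'x) module_scheme \<Rightarrow> 'b set"
  where "ideal_mult I M =
    generate (add_monoid M) {r \<odot>\<^bsub>M\<^esub> x | r x. r \<in> I \<and> x \<in> carrier M}"

definition restrict_to :: "(complex ^ 3) set set \<Rightarrow> 'b base_sheaf \<Rightarrow> 'b set base_sheaf"
  where "restrict_to X F =
    \<lparr>sections = (\<lambda>f. quotient_module (sections F f)
                      (ideal_mult (ideal_sections X f) (sections F f))),
     restriction = (\<lambda>f g C. \<Union>x\<in>C.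
       ideal_mult (ideal_sections X g) (sections F g) +>\<^bsub>sections F g\<^esub> restriction F f g x)\<rparr>"

text \<open>\<open>\<O>\<^sub>X(n)\<close> as the restriction of \<open>\<O>(n)\<close>.\<close>

definition O_twist :: "(complex ^ 3) set set \<Rightarrow> int \<Rightarrow> poly3 fractions set base_sheaf"
  where "O_twist X n = restrict_to X (sheaf_of (S_twist n))"

text \<open>The lines \<open>L\<close> of the dual plane are the \<open>dual_line p\<close> with \<open>p\<close> in the projective plane;
  a property holds for a general line if it holds for all \<open>p\<close> in some nonempty open set.\<close>

definition has_splitting_type :: "(poly3, 'b) graded_module \<Rightarrow> int \<Rightarrow> int \<Rightarrow> bool"
  where "has_splitting_type M a\<^sub>1 a\<^sub>2 \<longleftrightarrow> 0 \<le> a\<^sub>1 \<and> a\<^sub>1 \<le> a\<^sub>2 \<and>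
    (\<exists>U. zariski_open U \<and> U \<noteq> {} \<and>
      (\<forall>p\<in>U. sheaf_iso
         (restrict_to (dual_line p) (sheaf_of M))
         (direct_sum (O_twist (dual_line p) (- a\<^sub>1)) (O_twist (dual_line p) (- a\<^sub>2)))))"

end

(* Along the line Y = u X + v W a vector field has a tangential component A and a normal component
   n. It is logarithmic iff n(x_i) = (xi_i - u) A(x_i) at the d = |Z| points x_i in which the line
   meets the lines Y = xi_i X + eta_i W of the arrangement. So the restriction of D_0 to a general
   line is the sheaf of the graded module of all pairs (A, n) that satisfy these conditions; it is
   free on two generators whose degrees a1 <= a2 add up to d - 1. A nonzero class of minimal degree
   alpha in D_0 restricts to a nonzero pair, so a1 <= alpha.

   Conversely, suppose that 2 e + 3 <= d and that the general line carries a nonzero pair of degree e.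
   Linear algebra over C(u, v) puts these pairs into a polynomial family. Compare, at a fixed
   point of the plane, the directions that belong to the lines through this point: their Wronskian with
   respect to u has degree at most 2 e + 2 along each line and vanishes at d points of it, hence it is
   zero. The direction therefore depends on the point only, and removing common factors
   gives a logarithmic derivation of degree e on the plane, so alpha <= e. This is an argument of
   Grauert-Muelich type. *)

theory Submission
  imports Defs "HOL-Computational_Algebra.Computational_Algebra"
    "HOL-Computational_Algebra.Field_as_Ring"
begin

section \<open>Interpolation at finitely many points\<close>

text \<open>The constant \<open>2 e + 3\<close> comes from taking \<open>e = a - 1\<close>: the
  condition becomes \<open>2 a + 1 \<le> d\<close>, which is what the floor in the definition of
  \<open>a\<close> guarantees. The degree count leaves no room: differentiating in \<open>u\<close>
  at a fixed point costs one degree along the line, and only a cancellation brings the Wronskian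
  down to \<open>2 e + 2\<close>. A graded piece of \<open>D_0\<close> need not restrict onto all
  pairs of its degree. Multiples of a pair by forms of degree at least \<open>d - 1\<close> do lift,
  because the Lagrange polynomials at the \<open>x_i\<close> are restrictions of products of
  \<open>d - 1\<close> line equations. Over \<open>D_+(f)\<close> powers of \<open>f\<close> supply
  such multiples, so the sheaf sees every pair. All lines of the arrangement are written as
  \<open>Y = \<xi> X + \<eta> W\<close> by choosing the centre \<open>X = W = 0\<close> off them.
  Sheaves on a line are compared inside \<open>K^2\<close>, where \<open>K\<close> is the function
  field of the line. Restriction maps become inclusions there, so one matrix over \<open>K\<close>,
  made of the two generators, is the isomorphism over all open sets at once.\<close>

lemma coeff_mult_degree_bounds:
  fixes p q :: "'a::comm_semiring_0 poly"
  assumes "degree p \<le> m" "degree q \<le> n"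
  shows "coeff (p * q) (m + n) = coeff p m * coeff q n"
proof -
  have "coeff (p * q) (m + n) = (\<Sum>i\<le>m + n. coeff p i * coeff q (m + n - i))"
    by (simp add: coeff_mult)
  also have "\<dots> = (\<Sum>i\<in>{m}. coeff p i * coeff q (m + n - i))"
  proof (rule sum.mono_neutral_right)
    show "\<forall>i\<in>{..m + n} - {m}. coeff p i * coeff q (m + n - i) = 0"
    proof
      fix i assume "i \<in> {..m + n} - {m}"
      then consider "i > m" | "m + n - i > n" by force
      then show "coeff p i * coeff q (m + n - i) = 0"
        by cases (use assms in \<open>auto simp: coeff_eq_0\<close>)
    qed
  qed auto
  finally show ?thesis by simp
qed

lemma degree_le_if_coeff_zero:
  assumes "degree p \<le> Suc m" "coeff p (Suc m) = 0"
  shows "degree p \<le> m"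
proof (rule degree_le, intro allI impI)
  fix i assume "m < i"
  then show "coeff p i = 0" using assms by (cases "i = Suc m") (auto intro: coeff_eq_0)
qed

lemma prod_roots_dvd:
  fixes p :: "'a::field poly"
  assumes "finite I" "inj_on x I" "\<And>i. i \<in> I \<Longrightarrow> poly p (x i) = 0"
  shows "(\<Prod>i\<in>I. [:- x i, 1:]) dvd p"
  using assms
proof (induction I arbitrary: p rule: finite_induct)
  case empty
  then show ?case by simp
next
  case (insert j I)
  then obtain r where r: "p = [:- x j, 1:] * r"
    by (meson dvd_def insertI1 poly_eq_0_iff_dvd)
  have "poly r (x i) = 0" if "i \<in> I" for i
  proof -
    have "x i \<noteq> x j" using insert that by (auto simp: inj_on_def)
    moreover have "poly p (x i) = 0" using insert that by auto
    ultimately show ?thesis unfolding r by simp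
  qed
  then have "(\<Prod>i\<in>I. [:- x i, 1:]) dvd r" using insert by (auto simp: inj_on_def)
  then have "[:- x j, 1:] * (\<Prod>i\<in>I. [:- x i, 1:]) dvd [:- x j, 1:] * r" by (intro mult_dvd_mono) auto
  then show ?case using insert(1,2) by (simp only: r prod.insert[OF insert(1,2)])
qed

text \<open>Left unnormalised: up to a nonzero constant it is the restriction to a general line of
  the product of the equations of all given lines but the \<open>i\<close>-th. This is how multiples
  of pairs are lifted to the plane.\<close>

definition lagrange_basis :: "'i set \<Rightarrow> ('i \<Rightarrow> 'a::field) \<Rightarrow> 'i \<Rightarrow> 'a poly"
  where "lagrange_basis I x i = (\<Prod>j\<in>I - {i}. [:- x j, 1:])"

lemma degree_lagrange_basis:
  "finite I \<Longrightarrow> i \<in> I \<Longrightarrow> degree (lagrange_basis I x i) = card I - 1"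
  unfolding lagrange_basis_def by (subst degree_prod_eq_sum_degree) auto

lemma poly_lagrange_basis_other:
  "finite I \<Longrightarrow> i \<in> I \<Longrightarrow> j \<in> I \<Longrightarrow> j \<noteq> i \<Longrightarrow> poly (lagrange_basis I x i) (x j) = 0"
  unfolding lagrange_basis_def poly_prod by (auto intro!: prod_zero)

lemma poly_lagrange_basis_self:
  "finite I \<Longrightarrow> inj_on x I \<Longrightarrow> i \<in> I \<Longrightarrow> poly (lagrange_basis I x i) (x i) \<noteq> 0"
  unfolding lagrange_basis_def poly_prod by (auto simp: inj_on_def)

lemma sum_lagrange_basis:
  assumes "finite I" "inj_on x I" "j \<in> I"
  shows "poly (\<Sum>i\<in>I. Polynomial.smult (c i) (lagrange_basis I x i)) (x j) = c j * poly (lagrange_basis I x j) (x j)"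
proof -
  have "poly (\<Sum>i\<in>I. Polynomial.smult (c i) (lagrange_basis I x i)) (x j)
      = (\<Sum>i\<in>I. if i = j then c j * poly (lagrange_basis I x j) (x j) else 0)"
    unfolding poly_sum
    by (rule sum.cong) (use assms poly_lagrange_basis_other[of I _ j x] in auto)
  then show ?thesis using assms by simp
qed

lemma interpolation:
  assumes "finite I" "inj_on x I"
  obtains p :: "'a::field poly" where "\<And>i. i \<in> I \<Longrightarrow> poly p (x i) = y i"
proof
  show "poly (\<Sum>i\<in>I. Polynomial.smult (y i / poly (lagrange_basis I x i) (x i)) (lagrange_basis I x i)) (x j) = y j"
    if "j \<in> I" for j
    unfolding sum_lagrange_basis[OF assms that] using poly_lagrange_basis_self[OF assms that] by simp
qed

text \<open>Modulo the product of all \<open>x - x i\<close> the polynomial \<open>q\<close> equals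
  its interpolant, whose cofactors are constants. The remaining multiple of the product is charged
  to a single index \<open>i0\<close>, where it contributes the cofactor
  \<open>(x - x i0) r\<close>. The bound \<open>card I \<le> N + 1\<close> keeps the interpolant
  within degree \<open>N\<close>.\<close>

lemma lagrange_basis_decomposition:
  fixes q :: "'a::field poly"
  assumes "finite I" "inj_on x I" "I \<noteq> {}" "degree q \<le> N" "card I \<le> N + 1"
  obtains c where "q = (\<Sum>i\<in>I. lagrange_basis I x i * c i)"
    "\<And>i. i \<in> I \<Longrightarrow> degree (c i) + (card I - 1) \<le> N"
proof -
  obtain i0 where i0: "i0 \<in> I" using assms by auto
  define e where "e i = poly q (x i) / poly (lagrange_basis I x i) (x i)" for i
  define s where "s = (\<Sum>i\<in>I. Polynomial.smult (e i) (lagrange_basis I x i))"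
  have "poly (q - s) (x i) = 0" if "i \<in> I" for i
    unfolding poly_diff s_def sum_lagrange_basis[OF assms(1,2) that]
    using poly_lagrange_basis_self[OF assms(1,2) that] by (simp add: e_def)
  then have "(\<Prod>i\<in>I. [:- x i, 1:]) dvd q - s" using prod_roots_dvd assms by blast
  then obtain r where r: "q - s = (\<Prod>i\<in>I. [:- x i, 1:]) * r" by (auto simp: dvd_def)
  have Q: "(\<Prod>i\<in>I. [:- x i, 1:]) = [:- x i0, 1:] * lagrange_basis I x i0"
    unfolding lagrange_basis_def using i0 assms(1) by (simp add: prod.remove)
  have ds: "degree s \<le> N"
    unfolding s_def
    by (rule degree_sum_le) (use assms degree_lagrange_basis[OF assms(1), of _ x] in auto)
  have dr: "degree ([:- x i0, 1:] * r) + (card I - 1) \<le> N"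
  proof (cases "r = 0")
    case False
    have "[:- x i0, 1:] * r \<noteq> 0" using False by (simp only: mult_eq_0_iff) simp
    moreover have "lagrange_basis I x i0 \<noteq> 0" using poly_lagrange_basis_self[OF assms(1,2) i0] by auto
    moreover have "q - s = ([:- x i0, 1:] * r) * lagrange_basis I x i0"
      unfolding r Q by (simp only: ac_simps)
    ultimately have "degree (q - s) = degree ([:- x i0, 1:] * r) + degree (lagrange_basis I x i0)"
      by (metis degree_mult_eq)
    then show ?thesis
      using degree_diff_le[OF assms(4) ds] degree_lagrange_basis[OF assms(1) i0, of x] by simp
  qed (use assms in auto)
  define c where "c i = [:e i:] + (if i = i0 then [:- x i0, 1:] * r else 0)" for i
  show thesis
  proof (rule that[of c])
    have "(\<Sum>i\<in>I. lagrange_basis I x i * c i) = (\<Sum>i\<in>I. Polynomial.smult (e i) (lagrange_basis I x i)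
        + (if i = i0 then lagrange_basis I x i0 * ([:- x i0, 1:] * r) else 0))"
      by (rule sum.cong) (auto simp: c_def distrib_left)
    also have "\<dots> = s + lagrange_basis I x i0 * ([:- x i0, 1:] * r)"
      unfolding sum.distrib s_def using i0 assms by simp
    also have "\<dots> = s + (q - s)" unfolding r Q by (simp only: ac_simps)
    finally show "q = (\<Sum>i\<in>I. lagrange_basis I x i * c i)" by simp
    fix i assume "i \<in> I"
    have "degree (c i) \<le> max 0 (degree ([:- x i0, 1:] * r))"
      unfolding c_def by (rule degree_add_le_max[THEN order_trans]) auto
    then show "degree (c i) + (card I - 1) \<le> N" using dr by simp
  qed
qed

section \<open>A reduced basis of vector fields along a line\<close>

text \<open>The \<open>x i\<close> stand for the points where a fixed line meets the arrangement.
  \<open>\<mu> i\<close> will be the difference of slopes \<open>\<xi> i - u\<close>.\<close>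

locale tangency =
  fixes I :: "'i set" and x :: "'i \<Rightarrow> 'a::field" and \<mu> :: "'i \<Rightarrow> 'a"
  assumes finite_I: "finite I" and inj_x: "inj_on x I" and I_nonempty: "I \<noteq> {}"
    and slope_nonzero: "i \<in> I \<Longrightarrow> \<mu> i \<noteq> 0"
begin

text \<open>A vector field of degree \<open>k\<close> modulo the Euler field is a section of
  \<open>T(k - 1)\<close> on the plane. Along a line its tangential part lies in
  \<open>O(k + 1)\<close> and its normal part in \<open>O(k)\<close>, hence the two different degree
  bounds.\<close>

definition fields :: "nat \<Rightarrow> ('a poly \<times> 'a poly) set"
  where "fields k = {(A, n). degree A \<le> k + 1 \<and> degree n \<le> k \<and>
    (\<forall>i\<in>I. poly n (x i) = \<mu> i * poly A (x i))}"

lemma fields_add: "(A, n) \<in> fields k \<Longrightarrow> (B, m) \<in> fields k \<Longrightarrow> (A + B, n + m) \<in> fields k"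
  by (auto simp: fields_def algebra_simps intro: degree_add_le)

lemma fields_diff: "(A, n) \<in> fields k \<Longrightarrow> (B, m) \<in> fields k \<Longrightarrow> (A - B, n - m) \<in> fields k"
  by (auto simp: fields_def algebra_simps intro: degree_diff_le)

lemma fields_mult:
  "(A, n) \<in> fields k \<Longrightarrow> degree p \<le> j \<Longrightarrow> (p * A, p * n) \<in> fields (k + j)"
  by (auto simp: fields_def algebra_simps intro!: order_trans[OF degree_mult_le])

lemma fields_mult_bound:
  "(A, n) \<in> fields a \<Longrightarrow> p = 0 \<or> degree p + a \<le> k \<Longrightarrow> (p * A, p * n) \<in> fields k"
  using fields_mult[of A n a p "k - a"] by (auto simp: fields_def)

lemma fields_zero: "(0, 0) \<in> fields k"
  by (auto simp: fields_def)

text \<open>The degree of a pair drops when both top coefficients vanish. In degree \<open>0\<close>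
  this leaves \<open>n = 0\<close> and a constant \<open>A\<close>, which one tangency condition
  with nonzero slope kills.\<close>

lemma fields_lead_zero:
  assumes "(A, n) \<in> fields k" "coeff A (k + 1) = 0" "coeff n k = 0"
  shows "(A = 0 \<and> n = 0) \<or> (k > 0 \<and> (A, n) \<in> fields (k - 1))"
proof (cases k)
  case 0
  then have "degree A = 0" "degree n = 0"
    using assms degree_le_if_coeff_zero[of A 0] by (auto simp: fields_def)
  then obtain a b where ab: "A = [:a:]" "n = [:b:]" by (meson degree_eq_zeroE)
  then have "b = 0" using assms 0 by simp
  obtain i where "i \<in> I" using I_nonempty by auto
  then have "\<mu> i * a = 0" using assms \<open>b = 0\<close> by (auto simp: fields_def ab)
  then show ?thesis using slope_nonzero \<open>i \<in> I\<close> ab \<open>b = 0\<close> by auto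
next
  case (Suc j)
  have "degree A \<le> j + 1" "degree n \<le> j"
    using assms Suc degree_le_if_coeff_zero[of A "j + 1"] degree_le_if_coeff_zero[of n j]
    by (auto simp: fields_def)
  then show ?thesis using assms Suc by (auto simp: fields_def)
qed

text \<open>The first generator has minimal degree, the second has minimal degree among the fields that are not
  multiples of the first. Minimality makes their vectors of leading coefficients independent. Hence all
  fields are combinations without cancellation in top degree, and the determinant has degree
  \<open>a\<^sub>1 + a\<^sub>2 + 1\<close>. It equals \<open>\<Prod>(x - x\<^sub>i)\<close> up to a constant.\<close>

lemma reduced_basis:
  obtains A\<^sub>1 n\<^sub>1 A\<^sub>2 n\<^sub>2 a\<^sub>1 a\<^sub>2 where
    "a\<^sub>1 \<le> a\<^sub>2" "a\<^sub>1 + a\<^sub>2 + 1 = card I" "A\<^sub>1 * n\<^sub>2 - A\<^sub>2 * n\<^sub>1 \<noteq> 0"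
    "(A\<^sub>1, n\<^sub>1) \<in> fields a\<^sub>1" "(A\<^sub>2, n\<^sub>2) \<in> fields a\<^sub>2"
    "\<And>k A n. (A, n) \<in> fields k \<Longrightarrow> \<exists>p q. A = p * A\<^sub>1 + q * A\<^sub>2 \<and> n = p * n\<^sub>1 + q * n\<^sub>2 \<and>
      (p = 0 \<or> degree p + a\<^sub>1 \<le> k) \<and> (q = 0 \<or> degree q + a\<^sub>2 \<le> k)"
    "(A\<^sub>1, n\<^sub>1) \<noteq> (0, 0)" "\<And>k A n. (A, n) \<in> fields k \<Longrightarrow> (A, n) \<noteq> (0, 0) \<Longrightarrow> a\<^sub>1 \<le> k"
proof -
  define Q where "Q = (\<Prod>i\<in>I. [:- x i, 1:])"
  have Q0: "Q \<noteq> 0" unfolding Q_def using finite_I by simp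
  have Qx: "poly Q (x i) = 0" if "i \<in> I" for i
    unfolding Q_def poly_prod using that finite_I by (auto intro!: prod_zero)
  have dQ: "degree Q = card I"
    unfolding Q_def by (subst degree_prod_eq_sum_degree) auto
  \<comment> \<open>\<open>(0, Q)\<close> and the \<open>(1, P)\<close> below are independent, with
    determinant \<open>Q\<close> up to sign. They witness that both generators exist, and later
    bound the determinant of the basis from above.\<close>
  have QE: "(0, Q) \<in> fields (card I)" using Qx dQ by (auto simp: fields_def)
  obtain P where P: "\<And>i. i \<in> I \<Longrightarrow> poly P (x i) = \<mu> i"
    using interpolation[OF finite_I inj_x, of \<mu>] by blast
  have PE: "(1, P) \<in> fields (degree P)" using P by (auto simp: fields_def)
  define a\<^sub>1 where "a\<^sub>1 = (LEAST k. \<exists>s\<in>fields k. s \<noteq> (0, 0))"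
  have "\<exists>s\<in>fields (card I). s \<noteq> (0, 0)" using QE Q0 by auto
  then have "\<exists>s\<in>fields a\<^sub>1. s \<noteq> (0, 0)" unfolding a\<^sub>1_def by (rule LeastI)
  then obtain A\<^sub>1 n\<^sub>1 where s1: "(A\<^sub>1, n\<^sub>1) \<in> fields a\<^sub>1" "(A\<^sub>1, n\<^sub>1) \<noteq> (0, 0)" by auto
  have min1: "a\<^sub>1 \<le> k" if "(A, n) \<in> fields k" "(A, n) \<noteq> (0, 0)" for A n k
    unfolding a\<^sub>1_def by (rule Least_le) (use that in blast)
  have lead1: "coeff A\<^sub>1 (a\<^sub>1 + 1) \<noteq> 0 \<or> coeff n\<^sub>1 a\<^sub>1 \<noteq> 0"
  proof (rule ccontr)
    assume "\<not> ?thesis"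
    with fields_lead_zero[OF s1(1)] s1(2) have "a\<^sub>1 > 0" "(A\<^sub>1, n\<^sub>1) \<in> fields (a\<^sub>1 - 1)" by auto
    with min1[of A\<^sub>1 n\<^sub>1 "a\<^sub>1 - 1"] s1 show False by auto
  qed
  define S where "S = {(p * A\<^sub>1, p * n\<^sub>1) | p. True}"
  define a\<^sub>2 where "a\<^sub>2 = (LEAST k. \<exists>s\<in>fields k. s \<notin> S)"
  have "\<exists>k. \<exists>s\<in>fields k. s \<notin> S"
  proof (rule ccontr)
    assume "\<not> ?thesis"
    then have "(0, Q) \<in> S" "(1, P) \<in> S" using QE PE by blast+
    then obtain p q where pq: "0 = p * A\<^sub>1" "Q = p * n\<^sub>1" "1 = q * A\<^sub>1" "P = q * n\<^sub>1" by (auto simp: S_def)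
    then have "A\<^sub>1 \<noteq> 0" "p \<noteq> 0" using Q0 by auto
    then show False using pq by simp
  qed
  then have "\<exists>s\<in>fields a\<^sub>2. s \<notin> S" unfolding a\<^sub>2_def by (rule LeastI_ex)
  then obtain A\<^sub>2 n\<^sub>2 where s2: "(A\<^sub>2, n\<^sub>2) \<in> fields a\<^sub>2" "(A\<^sub>2, n\<^sub>2) \<notin> S" by auto
  have min2: "a\<^sub>2 \<le> k" if "(A, n) \<in> fields k" "(A, n) \<notin> S" for A n k
    unfolding a\<^sub>2_def by (rule Least_le) (use that in blast)
  have S0: "(0, 0) \<in> S" unfolding S_def by (auto intro!: exI[of _ 0])
  have "a\<^sub>1 \<le> a\<^sub>2" using min1 s2 S0 by blast
  define c where "c = coeff A\<^sub>1 (a\<^sub>1 + 1) * coeff n\<^sub>2 a\<^sub>2 - coeff A\<^sub>2 (a\<^sub>2 + 1) * coeff n\<^sub>1 a\<^sub>1"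
  have c0: "c \<noteq> 0"
  proof
    assume "c = 0"
    obtain t where t: "coeff A\<^sub>2 (a\<^sub>2 + 1) = t * coeff A\<^sub>1 (a\<^sub>1 + 1)" "coeff n\<^sub>2 a\<^sub>2 = t * coeff n\<^sub>1 a\<^sub>1"
    proof (cases "coeff A\<^sub>1 (a\<^sub>1 + 1) = 0")
      case True
      then show ?thesis using \<open>c = 0\<close> lead1 that[of "coeff n\<^sub>2 a\<^sub>2 / coeff n\<^sub>1 a\<^sub>1"] by (auto simp: c_def)
    next
      case False
      then show ?thesis using \<open>c = 0\<close> that[of "coeff A\<^sub>2 (a\<^sub>2 + 1) / coeff A\<^sub>1 (a\<^sub>1 + 1)"]
        by (auto simp: c_def field_simps)
    qed
    \<comment> \<open>Subtracting this multiple of the first generator cancels both top coefficients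
      of the second, without making it a multiple of the first.\<close>
    define m where "m = monom t (a\<^sub>2 - a\<^sub>1)"
    have dm: "degree m \<le> a\<^sub>2 - a\<^sub>1" unfolding m_def by (rule degree_monom_le)
    have inE: "(A\<^sub>2 - m * A\<^sub>1, n\<^sub>2 - m * n\<^sub>1) \<in> fields a\<^sub>2"
      using fields_diff[OF s2(1)] fields_mult[OF s1(1) dm] \<open>a\<^sub>1 \<le> a\<^sub>2\<close> by simp
    have "coeff (m * A\<^sub>1) (a\<^sub>2 - a\<^sub>1 + (a\<^sub>1 + 1)) = t * coeff A\<^sub>1 (a\<^sub>1 + 1)"
      "coeff (m * n\<^sub>1) (a\<^sub>2 - a\<^sub>1 + a\<^sub>1) = t * coeff n\<^sub>1 a\<^sub>1"
      using s1 dm by (subst coeff_mult_degree_bounds; auto simp: fields_def m_def)+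
    then have lz: "coeff (A\<^sub>2 - m * A\<^sub>1) (a\<^sub>2 + 1) = 0" "coeff (n\<^sub>2 - m * n\<^sub>1) a\<^sub>2 = 0"
      using t \<open>a\<^sub>1 \<le> a\<^sub>2\<close> by auto
    have notS: "(A\<^sub>2 - m * A\<^sub>1, n\<^sub>2 - m * n\<^sub>1) \<notin> S"
    proof
      assume "(A\<^sub>2 - m * A\<^sub>1, n\<^sub>2 - m * n\<^sub>1) \<in> S"
      then obtain p where "A\<^sub>2 - m * A\<^sub>1 = p * A\<^sub>1" "n\<^sub>2 - m * n\<^sub>1 = p * n\<^sub>1" by (auto simp: S_def)
      then have "A\<^sub>2 = (p + m) * A\<^sub>1" "n\<^sub>2 = (p + m) * n\<^sub>1" by (simp_all add: algebra_simps)
      then show False using s2 by (auto simp: S_def)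
    qed
    from fields_lead_zero[OF inE lz] notS S0
    have "a\<^sub>2 > 0" "(A\<^sub>2 - m * A\<^sub>1, n\<^sub>2 - m * n\<^sub>1) \<in> fields (a\<^sub>2 - 1)" by auto
    then show False using min2[OF _ notS] by fastforce
  qed
  have gen: "\<exists>p q. A = p * A\<^sub>1 + q * A\<^sub>2 \<and> n = p * n\<^sub>1 + q * n\<^sub>2 \<and>
      (p = 0 \<or> degree p + a\<^sub>1 \<le> k) \<and> (q = 0 \<or> degree q + a\<^sub>2 \<le> k)" if "(A, n) \<in> fields k" for A n k
    using that
  proof (induction k arbitrary: A n rule: less_induct)
    case (less k)
    have reduced: ?case if r: "(A - p\<^sub>0 * A\<^sub>1 - q\<^sub>0 * A\<^sub>2, n - p\<^sub>0 * n\<^sub>1 - q\<^sub>0 * n\<^sub>2) \<in> fields k"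
      "coeff (A - p\<^sub>0 * A\<^sub>1 - q\<^sub>0 * A\<^sub>2) (k + 1) = 0" "coeff (n - p\<^sub>0 * n\<^sub>1 - q\<^sub>0 * n\<^sub>2) k = 0"
      "p\<^sub>0 = 0 \<or> degree p\<^sub>0 + a\<^sub>1 \<le> k" "q\<^sub>0 = 0 \<or> degree q\<^sub>0 + a\<^sub>2 \<le> k" for p\<^sub>0 q\<^sub>0
    proof -
      have "\<exists>p q. A - p\<^sub>0 * A\<^sub>1 - q\<^sub>0 * A\<^sub>2 = p * A\<^sub>1 + q * A\<^sub>2 \<and> n - p\<^sub>0 * n\<^sub>1 - q\<^sub>0 * n\<^sub>2 = p * n\<^sub>1 + q * n\<^sub>2 \<and>
        (p = 0 \<or> degree p + a\<^sub>1 \<le> k) \<and> (q = 0 \<or> degree q + a\<^sub>2 \<le> k)"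
        using fields_lead_zero[OF r(1-3)]
      proof
        assume "A - p\<^sub>0 * A\<^sub>1 - q\<^sub>0 * A\<^sub>2 = 0 \<and> n - p\<^sub>0 * n\<^sub>1 - q\<^sub>0 * n\<^sub>2 = 0"
        then show ?thesis by (intro exI[of _ 0]) auto
      next
        assume *: "k > 0 \<and> (A - p\<^sub>0 * A\<^sub>1 - q\<^sub>0 * A\<^sub>2, n - p\<^sub>0 * n\<^sub>1 - q\<^sub>0 * n\<^sub>2) \<in> fields (k - 1)"
        then have "k - 1 < k" by auto
        from less.IH[OF this] * obtain p q where "A - p\<^sub>0 * A\<^sub>1 - q\<^sub>0 * A\<^sub>2 = p * A\<^sub>1 + q * A\<^sub>2"
          "n - p\<^sub>0 * n\<^sub>1 - q\<^sub>0 * n\<^sub>2 = p * n\<^sub>1 + q * n\<^sub>2"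
          "p = 0 \<or> degree p + a\<^sub>1 \<le> k - 1" "q = 0 \<or> degree q + a\<^sub>2 \<le> k - 1" by blast
        then show ?thesis by (intro exI[of _ p] exI[of _ q]) linarith
      qed
      then obtain p q where pq: "A - p\<^sub>0 * A\<^sub>1 - q\<^sub>0 * A\<^sub>2 = p * A\<^sub>1 + q * A\<^sub>2"
        "n - p\<^sub>0 * n\<^sub>1 - q\<^sub>0 * n\<^sub>2 = p * n\<^sub>1 + q * n\<^sub>2"
        "p = 0 \<or> degree p + a\<^sub>1 \<le> k" "q = 0 \<or> degree q + a\<^sub>2 \<le> k" by blast
      have "A = (p\<^sub>0 + p) * A\<^sub>1 + (q\<^sub>0 + q) * A\<^sub>2" "n = (p\<^sub>0 + p) * n\<^sub>1 + (q\<^sub>0 + q) * n\<^sub>2"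
        using pq(1,2) by (simp_all add: algebra_simps)
      moreover have "p\<^sub>0 + p = 0 \<or> degree (p\<^sub>0 + p) + a\<^sub>1 \<le> k" "q\<^sub>0 + q = 0 \<or> degree (q\<^sub>0 + q) + a\<^sub>2 \<le> k"
        using pq(3,4) r(4,5) degree_add_le_max[of p\<^sub>0 p] degree_add_le_max[of q\<^sub>0 q] by (auto simp: max_def split: if_splits)
      ultimately show ?thesis by blast
    qed
    show ?case
    proof (cases "(A, n) = (0, 0)")
      case True
      then show ?thesis by (intro exI[of _ 0]) auto
    next
      case False
      then have "a\<^sub>1 \<le> k" using min1 less.prems by blast
      show ?thesis
      proof (cases "a\<^sub>2 \<le> k")
        case False
        \<comment> \<open>Below degree \<open>a\<^sub>2\<close> only multiples of the first
          generator exist. The degree bound on the factor comes from whichever top coefficient of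
          that generator is nonzero.\<close>
        then have "(A, n) \<in> S" using min2 less.prems by blast
        then obtain p where p: "A = p * A\<^sub>1" "n = p * n\<^sub>1" by (auto simp: S_def)
        have "p = 0 \<or> degree p + a\<^sub>1 \<le> k"
        proof (cases "p = 0")
          case False
          show ?thesis
          proof (cases "coeff n\<^sub>1 a\<^sub>1 = 0")
            case True
            then have "degree A\<^sub>1 \<ge> a\<^sub>1 + 1" "A\<^sub>1 \<noteq> 0" using lead1 le_degree by auto
            then have "degree A \<ge> degree p + (a\<^sub>1 + 1)" unfolding p using False by (simp add: degree_mult_eq)
            then show ?thesis using less.prems by (auto simp: fields_def)
          next
            case nz: False
            then have "degree n\<^sub>1 \<ge> a\<^sub>1" "n\<^sub>1 \<noteq> 0" using le_degree by auto
            then have "degree n \<ge> degree p + a\<^sub>1" unfolding p using False by (simp add: degree_mult_eq)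
            then show ?thesis using less.prems by (auto simp: fields_def)
          qed
        qed simp
        then show ?thesis using p by (intro exI[of _ p] exI[of _ 0]) auto
      next
        case True
        define e where "e = coeff A (k + 1)"
        define f where "f = coeff n k"
        \<comment> \<open>Cramer's rule for matching the two top coefficients of
          \<open>(A, n)\<close>.\<close>
        define c\<^sub>1 where "c\<^sub>1 = (e * coeff n\<^sub>2 a\<^sub>2 - f * coeff A\<^sub>2 (a\<^sub>2 + 1)) / c"
        define c\<^sub>2 where "c\<^sub>2 = (f * coeff A\<^sub>1 (a\<^sub>1 + 1) - e * coeff n\<^sub>1 a\<^sub>1) / c"
        have e: "e = c\<^sub>1 * coeff A\<^sub>1 (a\<^sub>1 + 1) + c\<^sub>2 * coeff A\<^sub>2 (a\<^sub>2 + 1)"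
        proof -
          have "(c\<^sub>1 * coeff A\<^sub>1 (a\<^sub>1 + 1) + c\<^sub>2 * coeff A\<^sub>2 (a\<^sub>2 + 1)) * c = e * c"
            using c0 by (simp add: c\<^sub>1_def c\<^sub>2_def distrib_right) (simp add: c_def algebra_simps)
          then show ?thesis using c0 by simp
        qed
        have f: "f = c\<^sub>1 * coeff n\<^sub>1 a\<^sub>1 + c\<^sub>2 * coeff n\<^sub>2 a\<^sub>2"
        proof -
          have "(c\<^sub>1 * coeff n\<^sub>1 a\<^sub>1 + c\<^sub>2 * coeff n\<^sub>2 a\<^sub>2) * c = f * c"
            using c0 by (simp add: c\<^sub>1_def c\<^sub>2_def distrib_right) (simp add: c_def algebra_simps)
          then show ?thesis using c0 by simp
        qed
        define p\<^sub>0 where "p\<^sub>0 = monom c\<^sub>1 (k - a\<^sub>1)"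
        define q\<^sub>0 where "q\<^sub>0 = monom c\<^sub>2 (k - a\<^sub>2)"
        have dp: "degree p\<^sub>0 \<le> k - a\<^sub>1" and dq: "degree q\<^sub>0 \<le> k - a\<^sub>2"
          unfolding p\<^sub>0_def q\<^sub>0_def by (rule degree_monom_le)+
        have "coeff (p\<^sub>0 * A\<^sub>1) (k - a\<^sub>1 + (a\<^sub>1 + 1)) = c\<^sub>1 * coeff A\<^sub>1 (a\<^sub>1 + 1)"
          "coeff (p\<^sub>0 * n\<^sub>1) (k - a\<^sub>1 + a\<^sub>1) = c\<^sub>1 * coeff n\<^sub>1 a\<^sub>1"
          "coeff (q\<^sub>0 * A\<^sub>2) (k - a\<^sub>2 + (a\<^sub>2 + 1)) = c\<^sub>2 * coeff A\<^sub>2 (a\<^sub>2 + 1)"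
          "coeff (q\<^sub>0 * n\<^sub>2) (k - a\<^sub>2 + a\<^sub>2) = c\<^sub>2 * coeff n\<^sub>2 a\<^sub>2"
          using s1 s2 dp dq by (subst coeff_mult_degree_bounds; auto simp: fields_def p\<^sub>0_def q\<^sub>0_def)+
        then have "coeff (A - p\<^sub>0 * A\<^sub>1 - q\<^sub>0 * A\<^sub>2) (k + 1) = 0" "coeff (n - p\<^sub>0 * n\<^sub>1 - q\<^sub>0 * n\<^sub>2) k = 0"
          using e f True \<open>a\<^sub>1 \<le> k\<close> by (auto simp: e_def f_def)
        moreover have "(A - p\<^sub>0 * A\<^sub>1 - q\<^sub>0 * A\<^sub>2, n - p\<^sub>0 * n\<^sub>1 - q\<^sub>0 * n\<^sub>2) \<in> fields k"
          using fields_diff[OF fields_diff[OF less.prems]] fields_mult[OF s1(1) dp] fields_mult[OF s2(1) dq]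
            True \<open>a\<^sub>1 \<le> k\<close> by simp
        ultimately show ?thesis
          using reduced dp dq True \<open>a\<^sub>1 \<le> k\<close> by (auto simp: le_diff_conv2)
      qed
    qed
  qed
  define \<Delta> where "\<Delta> = A\<^sub>1 * n\<^sub>2 - A\<^sub>2 * n\<^sub>1"
  have "coeff (A\<^sub>1 * n\<^sub>2) (a\<^sub>1 + 1 + a\<^sub>2) = coeff A\<^sub>1 (a\<^sub>1 + 1) * coeff n\<^sub>2 a\<^sub>2"
    "coeff (A\<^sub>2 * n\<^sub>1) (a\<^sub>2 + 1 + a\<^sub>1) = coeff A\<^sub>2 (a\<^sub>2 + 1) * coeff n\<^sub>1 a\<^sub>1"
    using s1 s2 by (subst coeff_mult_degree_bounds; auto simp: fields_def)+
  then have "coeff \<Delta> (a\<^sub>1 + a\<^sub>2 + 1) = c" by (simp add: \<Delta>_def c_def ac_simps)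
  then have \<Delta>0: "\<Delta> \<noteq> 0" and d1: "a\<^sub>1 + a\<^sub>2 + 1 \<le> degree \<Delta>" using c0 le_degree by fastforce+
  have d2: "degree \<Delta> \<le> a\<^sub>1 + a\<^sub>2 + 1"
    unfolding \<Delta>_def using s1 s2
    by (intro degree_diff_le order_trans[OF degree_mult_le]) (auto simp: fields_def)
  have "poly \<Delta> (x i) = 0" if "i \<in> I" for i
    using s1 s2 that by (auto simp: fields_def \<Delta>_def)
  then have "Q dvd \<Delta>" unfolding Q_def by (rule prod_roots_dvd[OF finite_I inj_x])
  then have d3: "card I \<le> degree \<Delta>" using dvd_imp_degree_le[OF _ \<Delta>0, of Q] dQ by simp
  obtain p q where pq: "0 = p * A\<^sub>1 + q * A\<^sub>2" "Q = p * n\<^sub>1 + q * n\<^sub>2"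
    using gen[OF QE] by (elim exE conjE)
  obtain p' q' where pq': "1 = p' * A\<^sub>1 + q' * A\<^sub>2" "P = p' * n\<^sub>1 + q' * n\<^sub>2"
    using gen[OF PE] by (elim exE conjE)
  \<comment> \<open>By multiplicativity of determinants the one of \<open>(1, P)\<close> and
    \<open>(0, Q)\<close>, which is \<open>Q\<close>, is a multiple of \<open>\<Delta>\<close>.
    Together with \<open>Q dvd \<Delta>\<close> this pins down the degree of
    \<open>\<Delta>\<close>.\<close>
  have "Q = 1 * Q - 0 * P" by simp
  also have "\<dots> = (p' * A\<^sub>1 + q' * A\<^sub>2) * (p * n\<^sub>1 + q * n\<^sub>2) - (p * A\<^sub>1 + q * A\<^sub>2) * (p' * n\<^sub>1 + q' * n\<^sub>2)"
    by (simp only: pq[symmetric] pq'[symmetric])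
  also have "\<dots> = (p' * q - p * q') * \<Delta>" unfolding \<Delta>_def by (simp add: algebra_simps)
  finally have "\<Delta> dvd Q" by simp
  then have d4: "degree \<Delta> \<le> card I" using dvd_imp_degree_le[OF _ Q0, of \<Delta>] dQ by simp
  show thesis
  proof (rule that)
    show "a\<^sub>1 + a\<^sub>2 + 1 = card I" using d1 d2 d3 d4 by linarith
    show "A\<^sub>1 * n\<^sub>2 - A\<^sub>2 * n\<^sub>1 \<noteq> 0" using \<Delta>0 by (simp add: \<Delta>_def)
  qed (fact \<open>a\<^sub>1 \<le> a\<^sub>2\<close> s1 s2(1) gen min1)+
qed

end

section \<open>Specialising linear systems\<close>

text \<open>Fraction-free Gaussian elimination: a system over a domain has either a nonzero solution, or
  only the zero solution after every specialisation at which one fixed element is nonzero.\<close>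

lemma linear_system_dichotomy:
  fixes M :: "'i \<Rightarrow> 'k \<Rightarrow> 'r::idom"
  assumes "finite K"
  shows "(\<exists>x. (\<exists>k\<in>K. x k \<noteq> 0) \<and> (\<forall>i\<in>I. (\<Sum>k\<in>K. M i k * x k) = 0)) \<or>
    (\<exists>q. q \<noteq> 0 \<and> (\<forall>h::'r \<Rightarrow> 'f::field. (\<forall>a b. h (a - b) = h a - h b) \<longrightarrow> (\<forall>a b. h (a * b) = h a * h b) \<longrightarrow>
      h q \<noteq> 0 \<longrightarrow> (\<forall>y. (\<forall>i\<in>I. (\<Sum>k\<in>K. h (M i k) * y k) = 0) \<longrightarrow> (\<forall>k\<in>K. y k = 0))))"
  using assms
proof (induction K arbitrary: M rule: finite_induct)
  case empty
  show ?case by (rule disjI2, rule exI[of _ 1]) auto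
next
  case (insert k0 K)
  show ?case
  proof (cases "\<forall>i\<in>I. M i k0 = 0")
    case True
    have "(\<Sum>k\<in>insert k0 K. M i k * (if k = k0 then 1 else 0)) = 0" if "i \<in> I" for i
      using insert.hyps True that by (auto intro!: sum.neutral)
    then show ?thesis by (intro disjI1 exI[of _ "\<lambda>k. if k = k0 then 1 else 0"]) auto
  next
    case False
    then obtain i0 where i0: "i0 \<in> I" and p0: "M i0 k0 \<noteq> 0" by auto
    define p where "p = M i0 k0"
    \<comment> \<open>Row operation with pivot \<open>p\<close> that eliminates the unknown
      \<open>k0\<close> without division.\<close>
    define M' where "M' i k = p * M i k - M i k0 * M i0 k" for i k
    from insert.IH[of M'] show ?thesis
    proof (elim disjE exE conjE)
      fix x assume x: "\<exists>k\<in>K. x k \<noteq> 0" "\<forall>i\<in>I. (\<Sum>k\<in>K. M' i k * x k) = 0"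
      \<comment> \<open>Back substitution. Scaling the solution of the reduced system by the pivot
        takes the place of dividing by it.\<close>
      define z where "z k = (if k = k0 then - (\<Sum>k\<in>K. M i0 k * x k) else p * x k)" for k
      have zK: "z k = p * x k" if "k \<in> K" for k using that insert.hyps by (auto simp: z_def)
      have "(\<Sum>k\<in>insert k0 K. M i k * z k) = 0" if "i \<in> I" for i
      proof -
        have "(\<Sum>k\<in>insert k0 K. M i k * z k) = - M i k0 * (\<Sum>k\<in>K. M i0 k * x k) + (\<Sum>k\<in>K. M i k * (p * x k))"
          using insert.hyps zK by (simp add: z_def)
        also have "\<dots> = (\<Sum>k\<in>K. M' i k * x k)"
          by (simp add: M'_def sum_distrib_left algebra_simps sum.distrib[symmetric] sum_subtractf)
        finally show ?thesis using x that by auto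
      qed
      moreover have "\<exists>k\<in>insert k0 K. z k \<noteq> 0"
        using x(1) zK p0 by (auto simp: p_def)
      ultimately show ?thesis by blast
    next
      fix q assume q: "q \<noteq> 0" and *: "\<forall>h::'r \<Rightarrow> 'f. (\<forall>a b. h (a - b) = h a - h b) \<longrightarrow> (\<forall>a b. h (a * b) = h a * h b) \<longrightarrow>
        h q \<noteq> 0 \<longrightarrow> (\<forall>y. (\<forall>i\<in>I. (\<Sum>k\<in>K. h (M' i k) * y k) = 0) \<longrightarrow> (\<forall>k\<in>K. y k = 0))"
      have "\<forall>k\<in>insert k0 K. y k = 0"
        if h: "\<forall>a b. h (a - b) = h a - h b" "\<forall>a b. h (a * b) = h a * h b" "h (p * q) \<noteq> 0"
          and y: "\<forall>i\<in>I. (\<Sum>k\<in>insert k0 K. h (M i k) * y k) = 0" for h :: "'r \<Rightarrow> 'f" and y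
      proof -
        have y': "(\<Sum>k\<in>K. h (M i k) * y k) = - h (M i k0) * y k0" if "i \<in> I" for i
          using y that insert.hyps by (auto simp: eq_neg_iff_add_eq_0 add.commute)
        have "(\<Sum>k\<in>K. h (M' i k) * y k) = 0" if "i \<in> I" for i
        proof -
          have "(\<Sum>k\<in>K. h (M' i k) * y k) = h p * (\<Sum>k\<in>K. h (M i k) * y k) - h (M i k0) * (\<Sum>k\<in>K. h (M i0 k) * y k)"
          proof -
            have "h (M' i k) = h p * h (M i k) - h (M i k0) * h (M i0 k)" for k
              by (simp only: M'_def h)
            then show ?thesis by (simp only: left_diff_distrib sum_subtractf sum_distrib_left mult.assoc)
          qed
          also have "\<dots> = 0" unfolding y'[OF that] y'[OF i0] by (simp add: p_def)
          finally show ?thesis .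
        qed
        moreover have "h q \<noteq> 0" "h p \<noteq> 0" using h by auto
        ultimately have K0: "\<forall>k\<in>K. y k = 0" using *[rule_format, of h y] h by blast
        then have "h p * y k0 = 0" using y'[OF i0] by (simp add: p_def)
        then show ?thesis using K0 \<open>h p \<noteq> 0\<close> by auto
      qed
      \<comment> \<open>If the product survives the specialisation, then so do this pivot and the
        element found for the reduced system.\<close>
      then show ?thesis using q p0 by (intro disjI2 exI[of _ "p * q"]) (auto simp: p_def)
    qed
  qed
qed

section \<open>Evaluation of iterated polynomials\<close>

definition eval2 :: "complex poly poly \<Rightarrow> complex \<Rightarrow> complex \<Rightarrow> complex"
  where "eval2 p s t = poly (poly p [:t:]) s"

text \<open>The outermost variable is the slope \<open>u\<close>, and the coefficients are
  polynomials in the point \<open>(x, y)\<close> with \<open>y\<close> outside. Hence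
  \<open>pderiv\<close> differentiates in the slope at a fixed point of the plane.\<close>

definition eval3 :: "complex poly poly poly \<Rightarrow> complex \<Rightarrow> complex \<Rightarrow> complex \<Rightarrow> complex"
  where "eval3 p x y u = eval2 (poly p [:[:u:]:]) x y"

lemma eval2_simps [simp]:
  "eval2 0 s t = 0" "eval2 1 s t = 1"
  "eval2 (p + q) s t = eval2 p s t + eval2 q s t" "eval2 (p - q) s t = eval2 p s t - eval2 q s t"
  "eval2 (- p) s t = - eval2 p s t"
  "eval2 (p * q) s t = eval2 p s t * eval2 q s t" "eval2 (p ^ k) s t = eval2 p s t ^ k"
  "eval2 (Polynomial.smult c p) s t = poly c s * eval2 p s t"
  "eval2 (pCons c p) s t = poly c s + t * eval2 p s t"
  "eval2 (prod f I) s t = (\<Prod>i\<in>I. eval2 (f i) s t)"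
  by (simp_all add: eval2_def poly_prod)

lemma eval3_simps [simp]:
  "eval3 0 x y u = 0" "eval3 1 x y u = 1"
  "eval3 (p + q) x y u = eval3 p x y u + eval3 q x y u" "eval3 (p - q) x y u = eval3 p x y u - eval3 q x y u"
  "eval3 (p * q) x y u = eval3 p x y u * eval3 q x y u"
  "eval3 (Polynomial.smult c p) x y u = eval2 c x y * eval3 p x y u"
  "eval3 (pCons c p) x y u = eval2 c x y + u * eval3 p x y u"
  "eval3 (\<Sum>i\<in>I. f i) x y u = (\<Sum>i\<in>I. eval3 (f i) x y u)"
  by (simp_all add: eval3_def poly_sum) (induction I rule: infinite_finite_induct; simp)

lemma poly_eq_0_if_infinite_roots:
  fixes p :: "'a::idom poly" and f :: "complex \<Rightarrow> 'a"
  assumes "inj f" "\<And>c. poly p (f c) = 0"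
  shows "p = 0"
proof (rule ccontr)
  assume "p \<noteq> 0"
  then have "finite {x. poly p x = 0}" by (rule poly_roots_finite)
  then have "finite (f ` UNIV)" by (rule finite_subset[rotated]) (use assms in auto)
  then show False using assms(1) finite_imageD infinite_UNIV_char_0 by blast
qed

lemma eval2_eq_0: "(\<And>s t. eval2 p s t = 0) \<Longrightarrow> p = 0"
proof (rule poly_eq_0_if_infinite_roots[of "\<lambda>c. [:c:]"])
  fix t assume "\<And>s t. eval2 p s t = 0"
  then show "poly p [:t:] = 0" using poly_all_0_iff_0[of "poly p [:t:]"] by (simp add: eval2_def)
qed (auto simp: inj_def)

lemma eval3_eq_0: "(\<And>x y u. eval3 p x y u = 0) \<Longrightarrow> p = 0"
  by (rule poly_eq_0_if_infinite_roots[of "\<lambda>c. [:[:c:]:]"]) (auto simp: inj_def eval3_def intro: eval2_eq_0)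

lemma poly_poly_line: "poly (poly p [:v, u:]) x = eval2 p x (u * x + v)"
  by (induction p) (auto simp: algebra_simps)

text \<open>Lines of slope \<open>u\<close> through \<open>(x, y)\<close> have
  \<open>v = y - u x\<close>. By the chain rule the \<open>u\<close>-derivative of
  \<open>a(u, y - u x)\<close> is \<open>a_u - x a_v\<close>; \<open>b\<close> and \<open>c\<close>
  are these partial derivatives. The explicit factor \<open>x\<close> is what the later degree count
  along lines relies on.\<close>

lemma pencil_substitution:
  "\<exists>q b c. (\<forall>x y u. eval3 q x y u = eval2 a u (y - u * x)) \<and>
    (\<forall>x y u. eval3 (pderiv q) x y u = eval2 b u (y - u * x) - x * eval2 c u (y - u * x))"
proof (induction a)
  case 0
  show ?case by (rule exI[of _ 0], rule exI[of _ 0], rule exI[of _ 0]) simp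
next
  case (pCons a p)
  have coeff: "\<exists>q b. (\<forall>x y u. eval3 q x y u = poly a u) \<and> (\<forall>x y u. eval3 (pderiv q) x y u = eval2 b u (y - u * x))"
  proof (induction a)
    case 0
    show ?case by (rule exI[of _ 0], rule exI[of _ 0]) simp
  next
    case (pCons c a)
    then obtain q b where "\<forall>x y u. eval3 q x y u = poly a u" "\<forall>x y u. eval3 (pderiv q) x y u = eval2 b u (y - u * x)"
      by blast
    then show ?case
      by (intro exI[of _ "pCons [:[:c:]:] q"] exI[of _ "[:a:] + Polynomial.smult [:0, 1:] b"]) (simp add: pderiv_pCons)
  qed
  then obtain q0 b0 where q0: "\<And>x y u. eval3 q0 x y u = poly a u"
    "\<And>x y u. eval3 (pderiv q0) x y u = eval2 b0 u (y - u * x)" by blast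
  obtain q b c where q: "\<And>x y u. eval3 q x y u = eval2 p u (y - u * x)"
    "\<And>x y u. eval3 (pderiv q) x y u = eval2 b u (y - u * x) - x * eval2 c u (y - u * x)"
    using pCons.IH by blast
  define l :: "complex poly poly poly" where "l = [: [:0, 1:], [:[:0, - 1:]:] :]"
  have l: "eval3 l x y u = y - u * x" "eval3 (pderiv l) x y u = - x" for x y u
    by (simp_all add: l_def pderiv_pCons algebra_simps)
  show ?case
    by (rule exI[of _ "q0 + l * q"], rule exI[of _ "b0 + pCons 0 b"], rule exI[of _ "p + pCons 0 c"])
      (auto simp: q0 q l pderiv_add pderiv_mult algebra_simps)
qed

section \<open>Pairs of polynomials with constant ratio\<close>

text \<open>After multiplying the identity by the variable, the coefficients in degree
  \<open>degree p + degree q\<close> are the product of the leading coefficients times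
  \<open>degree p\<close> on one side and \<open>degree q\<close> on the other. Characteristic zero
  does the rest.\<close>

lemma wronskian_zero_same_degree:
  fixes p q :: "'a::{idom, semiring_char_0} poly"
  assumes "p \<noteq> 0" "q \<noteq> 0" "pderiv p * q = p * pderiv q"
  shows "degree p = degree q"
proof -
  let ?m = "degree p" and ?n = "degree q"
  have dp: "degree (pCons 0 (pderiv r)) \<le> degree r" for r :: "'a poly"
    by (cases "degree r = 0") (auto simp: degree_pderiv pderiv_eq_0_iff degree_pCons_le intro: order_trans[OF degree_pCons_le])
  have cp: "coeff (pCons 0 (pderiv r)) (degree r) = of_nat (degree r) * lead_coeff r" for r :: "'a poly"
    by (cases "degree r") (auto simp: coeff_pderiv)
  have "pCons 0 (pderiv p) * q = p * pCons 0 (pderiv q)" using assms(3) by simp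
  then have "coeff (pCons 0 (pderiv p) * q) (?m + ?n) = coeff (p * pCons 0 (pderiv q)) (?m + ?n)" by simp
  then have "of_nat ?m * lead_coeff p * lead_coeff q = lead_coeff p * (of_nat ?n * lead_coeff q)"
    using coeff_mult_degree_bounds[OF dp[of p] order_refl, of q] coeff_mult_degree_bounds[OF order_refl dp[of q], of p]
    by (simp only: cp)
  then have "(of_nat ?m - of_nat ?n :: 'a) * (lead_coeff p * lead_coeff q) = 0" by (simp add: algebra_simps)
  then show ?thesis using assms by simp
qed

text \<open>The ratio of \<open>p\<close> and \<open>q\<close> does not involve the outer variable.
  The combination \<open>r\<close> of both whose coefficient at \<open>degree p\<close> vanishes
  again has zero Wronskian with \<open>p\<close>, so by comparison of degrees it is
  \<open>0\<close>. Over a factorial ring the resulting proportion, reduced to lowest terms, leaves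
  a common factor \<open>g\<close>.\<close>

lemma wronskian_zero_factorization:
  fixes p q :: "'a::{factorial_ring_gcd, semiring_char_0, idom, semiring_gcd_mult_normalize} poly"
  assumes "p \<noteq> 0 \<or> q \<noteq> 0" "pderiv p * q = p * pderiv q"
  obtains a b g where "p = Polynomial.smult a g" "q = Polynomial.smult b g" "g \<noteq> 0"
proof (cases "p = 0")
  case True
  then show ?thesis using assms that[of 0 q 1] by auto
next
  case False
  define a where "a = lead_coeff p"
  define b where "b = coeff q (degree p)"
  define r where "r = Polynomial.smult a q - Polynomial.smult b p"
  have "pderiv p * r = p * pderiv r"
    using assms(2) by (simp add: r_def pderiv_diff pderiv_smult algebra_simps)
  then have "r = 0"
  proof (rule contrapos_pp)
    assume "r \<noteq> 0"
    show "pderiv p * r \<noteq> p * pderiv r"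
    proof
      assume "pderiv p * r = p * pderiv r"
      then have "degree p = degree r" using wronskian_zero_same_degree False \<open>r \<noteq> 0\<close> by blast
      then have "lead_coeff r = coeff r (degree p)" by simp
      also have "\<dots> = 0" by (simp add: r_def a_def b_def)
      finally show False using \<open>r \<noteq> 0\<close> by simp
    qed
  qed
  have a0: "a \<noteq> 0" using False by (simp add: a_def)
  define d where "d = gcd a b"
  have d0: "d \<noteq> 0" using a0 by (simp add: d_def)
  obtain a' b' where ab: "a = d * a'" "b = d * b'" by (metis d_def dvdE gcd_dvd1 gcd_dvd2)
  have "coprime a' b'"
  proof -
    have "d = gcd (d * a') (d * b')" by (simp only: ab[symmetric]) (simp add: d_def)
    then have "d = normalize (d * gcd a' b')" by (simp only: gcd_mult_left)
    then have "d * gcd a' b' dvd d * 1" by (metis dvd_refl mult.right_neutral dvd_normalize_iff)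
    then have "is_unit (gcd a' b')" using d0 by (subst (asm) dvd_mult_cancel_left) auto
    then show ?thesis by (metis coprime_iff_gcd_eq_1 is_unit_gcd_iff)
  qed
  have a'0: "a' \<noteq> 0" using a0 ab by auto
  have "Polynomial.smult d (Polynomial.smult a' q) = Polynomial.smult d (Polynomial.smult b' p)"
    using \<open>r = 0\<close> by (simp add: r_def ab)
  then have rel: "Polynomial.smult a' q = Polynomial.smult b' p"
  proof -
    assume "Polynomial.smult d (Polynomial.smult a' q) = Polynomial.smult d (Polynomial.smult b' p)"
    then have "[:d:] * Polynomial.smult a' q = [:d:] * Polynomial.smult b' p"
      by (simp only: mult_pCons_left mult_zero_left pCons_0_0 add_0_right)
    then show ?thesis using d0 by (subst (asm) mult_left_cancel) auto
  qed
  have "a' dvd coeff p k" for k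
  proof -
    have "a' * coeff q k = b' * coeff p k" using rel by (metis coeff_smult)
    then have "a' dvd b' * coeff p k" by (metis dvd_triv_left)
    then show ?thesis using \<open>coprime a' b'\<close> by (simp add: coprime_dvd_mult_right_iff)
  qed
  then have "[:a':] dvd p" by (simp add: const_poly_dvd_iff)
  then obtain g where g: "p = Polynomial.smult a' g" by (auto simp: dvd_def)
  have "Polynomial.smult a' q = Polynomial.smult a' (Polynomial.smult b' g)"
    unfolding rel by (simp only: g smult_smult mult.commute[of a' b'])
  then have "[:a':] * q = [:a':] * Polynomial.smult b' g"
    by (simp only: mult_pCons_left mult_zero_left pCons_0_0 add_0_right)
  then have "q = Polynomial.smult b' g" using a'0 by (subst (asm) mult_left_cancel) auto
  then show ?thesis using g False that[of a' g b'] by auto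
qed

section \<open>Vector fields tangent to an arrangement along all lines\<close>

lemma poly_eq_sum_le:
  fixes p :: "'a::comm_ring_1 poly"
  shows "degree p \<le> n \<Longrightarrow> poly p x = (\<Sum>k\<le>n. coeff p k * x ^ k)"
  unfolding poly_altdef by (rule sum.mono_neutral_left) (auto simp: coeff_eq_0)

lemma poly_zero_if_many_roots:
  fixes p :: "'a::field poly"
  assumes "finite I" "inj_on x I" "\<And>i. i \<in> I \<Longrightarrow> poly p (x i) = 0" "degree p < card I"
  shows "p = 0"
proof (rule ccontr)
  assume "p \<noteq> 0"
  have "degree (\<Prod>i\<in>I. [:- x i, 1:]) = card I" by (subst degree_prod_eq_sum_degree) auto
  then show False using dvd_imp_degree_le[OF prod_roots_dvd[OF assms(1-3)] \<open>p \<noteq> 0\<close>] assms(4) by simp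
qed

lemma DERIV_eval3: "((\<lambda>u. eval3 p x y u) has_field_derivative eval3 (pderiv p) x y u) (at u)"
proof (induction p)
  case (pCons a p)
  show ?case by (auto intro!: derivative_eq_intros pCons.IH simp: pderiv_pCons)
qed simp

text \<open>The value \<open>c\<close> is excluded because tangency to a given line is only known
  for slopes different from its own. The factor \<open>u - c\<close> removes the exception.\<close>

lemma eval3_coeffs_zero:
  assumes "\<And>u. u \<noteq> c \<Longrightarrow> eval3 p x y u = 0"
  shows "eval2 (coeff p k) x y = 0"
proof -
  define q where "q = map_poly (\<lambda>r. eval2 r x y) p"
  have q: "poly q u = eval3 p x y u" for u
    unfolding q_def by (induction p) (auto simp: map_poly_pCons)
  have "poly ([:- c, 1:] * q) u = 0" for u using assms[of u] by (cases "u = c") (auto simp: q)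
  then have "[:- c, 1:] * q = 0" using poly_all_0_iff_0 by blast
  then have "q = 0" by (simp only: mult_eq_0_iff) simp
  then show ?thesis using coeff_map_poly[of "\<lambda>r. eval2 r x y" p k] by (simp add: q_def)
qed

text \<open>\<open>q\<close> is the product of the conditions for two kinds of bad lines: those with
  the slope of a given line, and those through a common point of two given lines.\<close>

lemma generic_intersections:
  fixes \<xi> \<eta> :: "'i \<Rightarrow> complex"
  assumes "finite I" "inj_on (\<lambda>i. (\<xi> i, \<eta> i)) I"
  obtains q where "q \<noteq> 0" "\<And>u v i. eval2 q u v \<noteq> 0 \<Longrightarrow> i \<in> I \<Longrightarrow> u \<noteq> \<xi> i"
    "\<And>u v. eval2 q u v \<noteq> 0 \<Longrightarrow> inj_on (\<lambda>i. (v - \<eta> i) / (\<xi> i - u)) I"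
proof
  define d where "d i = [: [:\<xi> i, - 1:] :]" for i
  \<comment> \<open>The concurrency determinant of the lines \<open>i\<close>, \<open>j\<close> and
    \<open>(u, v)\<close>. It is linear in \<open>u\<close> and \<open>v\<close>, and nonzero as a
    polynomial when the lines \<open>i\<close> and \<open>j\<close> differ.\<close>
  define w where "w = (\<lambda>(i, j). [: [:\<eta> j * \<xi> i - \<eta> i * \<xi> j, \<eta> i - \<eta> j:], [:\<xi> j - \<xi> i:] :])"
  define P where "P = {(i, j). i \<in> I \<and> j \<in> I \<and> i \<noteq> j}"
  have fP: "finite P" by (rule finite_subset[of _ "I \<times> I"]) (auto simp: P_def assms(1))
  define q where "q = (\<Prod>i\<in>I. d i) * (\<Prod>p\<in>P. w p)"
  have "w p \<noteq> 0" if "p \<in> P" for p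
    using that inj_onD[OF assms(2)] by (auto simp: P_def w_def)
  then show "q \<noteq> 0" using assms(1) fP by (simp add: q_def d_def)
  fix u v assume q: "eval2 q u v \<noteq> 0"
  show *: "u \<noteq> \<xi> i" if "i \<in> I" for i
    using q that assms(1) by (auto simp: q_def d_def)
  show "inj_on (\<lambda>i. (v - \<eta> i) / (\<xi> i - u)) I"
  proof (rule inj_onI, rule ccontr)
    fix i j assume ij: "i \<in> I" "j \<in> I" "(v - \<eta> i) / (\<xi> i - u) = (v - \<eta> j) / (\<xi> j - u)" "i \<noteq> j"
    then have "(v - \<eta> i) * (\<xi> j - u) = (v - \<eta> j) * (\<xi> i - u)"
      using *[of i] *[of j] by (simp add: frac_eq_eq)
    then have "eval2 (w (i, j)) u v = 0" by (simp add: w_def algebra_simps)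
    moreover have "(i, j) \<in> P" using ij by (simp add: P_def)
    ultimately have "(\<Prod>p\<in>P. eval2 (w p) u v) = 0" using fP by (intro prod_zero) auto
    then show False using q by (simp add: q_def)
  qed
qed

section \<open>Polynomial families of tangent fields\<close>

lemma cleared_tangency:
  fixes D :: "'a::field"
  assumes "D \<noteq> 0"
  shows "(\<Sum>k\<le>e + 1. - (D * N ^ k * D ^ (e + 1 - k)) * a k) + (\<Sum>k\<le>e. N ^ k * D ^ (e + 1 - k) * b k)
    = D ^ (e + 1) * ((\<Sum>k\<le>e. b k * (N / D) ^ k) - D * (\<Sum>k\<le>e + 1. a k * (N / D) ^ k))"
proof -
  have *: "N ^ k * D ^ (e + 1 - k) = D ^ (e + 1) * (N / D) ^ k" if "k \<le> e + 1" for k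
    using assms that by (simp add: power_divide power_diff)
  have "(\<Sum>k\<le>e + 1. - (D * N ^ k * D ^ (e + 1 - k)) * a k) = (\<Sum>k\<le>e + 1. - (D ^ (e + 1) * D * (a k * (N / D) ^ k)))"
    by (rule sum.cong) (use * in \<open>simp_all only: mult.assoc atMost_iff\<close>, simp add: ac_simps)
  moreover have "(\<Sum>k\<le>e. N ^ k * D ^ (e + 1 - k) * b k) = (\<Sum>k\<le>e. D ^ (e + 1) * (b k * (N / D) ^ k))"
    by (rule sum.cong) (use * in \<open>simp_all only: atMost_iff\<close>, simp add: ac_simps)
  ultimately show ?thesis
    by (simp only: sum_negf sum_distrib_left[symmetric]) (simp add: algebra_simps)
qed

text \<open>The unknowns are the \<open>2 e + 3\<close> coefficients of \<open>A\<close> and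
  \<open>n\<close>. The equations are the tangency conditions at the intersections, multiplied by
  \<open>(\<xi> i - u)^(e + 1)\<close> to make them polynomial in \<open>u\<close> and
  \<open>v\<close>. A nonzero solution over the polynomial ring is the family; otherwise a general
  line carries only the zero pair.\<close>

lemma tangent_family_or_generic_zero:
  fixes \<xi> \<eta> :: "'i \<Rightarrow> complex"
  assumes I: "finite I"
  shows "(\<exists>a b. ((\<exists>k\<le>e + 1. a k \<noteq> 0) \<or> (\<exists>k\<le>e. b k \<noteq> 0)) \<and> (\<forall>u v. \<forall>i\<in>I. u \<noteq> \<xi> i \<longrightarrow>
      (\<Sum>k\<le>e. eval2 (b k) u v * ((v - \<eta> i) / (\<xi> i - u)) ^ k)
        = (\<xi> i - u) * (\<Sum>k\<le>e + 1. eval2 (a k) u v * ((v - \<eta> i) / (\<xi> i - u)) ^ k))) \<or>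
    (\<exists>q. q \<noteq> 0 \<and> (\<forall>u v. eval2 q u v \<noteq> 0 \<longrightarrow> (\<forall>i\<in>I. u \<noteq> \<xi> i) \<longrightarrow> (\<forall>A n. degree A \<le> e + 1 \<longrightarrow> degree n \<le> e \<longrightarrow>
      (\<forall>i\<in>I. poly n ((v - \<eta> i) / (\<xi> i - u)) = (\<xi> i - u) * poly A ((v - \<eta> i) / (\<xi> i - u))) \<longrightarrow> A = 0 \<and> n = 0)))"
proof -
  define d where "d i = [: [:\<xi> i, - 1:] :]" for i
  define w where "w i = [: [:- \<eta> i:], 1 :]" for i
  have dw: "eval2 (d i) u v = \<xi> i - u" "eval2 (w i) u v = v - \<eta> i" for i u v
    by (simp_all add: d_def w_def)
  \<comment> \<open>\<open>Inl\<close> indexes the coefficients of the tangential part,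
    \<open>Inr\<close> those of the normal part.\<close>
  define M where "M i k = (case k of Inl k \<Rightarrow> - (d i * w i ^ k * d i ^ (e + 1 - k)) | Inr k \<Rightarrow> w i ^ k * d i ^ (e + 1 - k))"
    for i and k :: "nat + nat"
  define K where "K = {..e + 1} <+> {..e}"
  have sumK: "(\<Sum>k\<in>K. eval2 (M i k) u v * y k) = (\<xi> i - u) ^ (e + 1) *
      ((\<Sum>k\<le>e. y (Inr k) * ((v - \<eta> i) / (\<xi> i - u)) ^ k)
        - (\<xi> i - u) * (\<Sum>k\<le>e + 1. y (Inl k) * ((v - \<eta> i) / (\<xi> i - u)) ^ k))"
    if "u \<noteq> \<xi> i" for i u v y
    unfolding K_def
    by (subst sum.Plus) (use cleared_tangency[where D = "\<xi> i - u" and e = e and N = "v - \<eta> i"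
        and a = "\<lambda>k. y (Inl k)" and b = "\<lambda>k. y (Inr k)"] that
      in \<open>simp_all add: M_def dw del: sum.atMost_Suc\<close>)
  have "finite K" by (simp add: K_def)
  from linear_system_dichotomy[OF this, of I M] show ?thesis
  proof (elim disjE exE conjE)
    fix x assume x: "\<exists>k\<in>K. x k \<noteq> 0" "\<forall>i\<in>I. (\<Sum>k\<in>K. M i k * x k) = 0"
    show ?thesis
    proof (rule disjI1, rule exI[of _ "\<lambda>k. x (Inl k)"], rule exI[of _ "\<lambda>k. x (Inr k)"], intro conjI allI ballI impI)
      show "(\<exists>k\<le>e + 1. x (Inl k) \<noteq> 0) \<or> (\<exists>k\<le>e. x (Inr k) \<noteq> 0)"
        using x(1) by (auto simp: K_def)
      fix u v i assume i: "i \<in> I" "u \<noteq> \<xi> i"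
      have "(\<Sum>k\<in>K. eval2 (M i k) u v * eval2 (x k) u v) = eval2 (\<Sum>k\<in>K. M i k * x k) u v"
        by (induction K rule: infinite_finite_induct) auto
      also have "\<dots> = 0" using x i by simp
      finally show "(\<Sum>k\<le>e. eval2 (x (Inr k)) u v * ((v - \<eta> i) / (\<xi> i - u)) ^ k)
        = (\<xi> i - u) * (\<Sum>k\<le>e + 1. eval2 (x (Inl k)) u v * ((v - \<eta> i) / (\<xi> i - u)) ^ k)"
        unfolding sumK[OF i(2)] using i(2) by (simp del: sum.atMost_Suc)
    qed
  next
    fix q :: "complex poly poly"
    assume q: "q \<noteq> 0" and *: "\<forall>h :: complex poly poly \<Rightarrow> complex. (\<forall>a b. h (a - b) = h a - h b) \<longrightarrow>
      (\<forall>a b. h (a * b) = h a * h b) \<longrightarrow> h q \<noteq> 0 \<longrightarrow>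
      (\<forall>y. (\<forall>i\<in>I. (\<Sum>k\<in>K. h (M i k) * y k) = 0) \<longrightarrow> (\<forall>k\<in>K. y k = 0))"
    show ?thesis
    proof (intro disjI2 exI[of _ q] conjI allI impI q)
      fix u v A n assume uv: "eval2 q u v \<noteq> 0" "\<forall>i\<in>I. u \<noteq> \<xi> i" and deg: "degree A \<le> e + 1" "degree n \<le> e"
        and t: "\<forall>i\<in>I. poly n ((v - \<eta> i) / (\<xi> i - u)) = (\<xi> i - u) * poly A ((v - \<eta> i) / (\<xi> i - u))"
      define y where "y k = (case k of Inl k \<Rightarrow> coeff A k | Inr k \<Rightarrow> coeff n k)" for k
      have "(\<Sum>k\<in>K. eval2 (M i k) u v * y k) = 0" if "i \<in> I" for i
      proof -
        have "u \<noteq> \<xi> i" using uv that by auto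
        then show ?thesis
          unfolding sumK[OF \<open>u \<noteq> \<xi> i\<close>] using t that poly_eq_sum_le[OF deg(1)] poly_eq_sum_le[OF deg(2)]
          by (simp add: y_def del: sum.atMost_Suc)
      qed
      then have y0: "\<forall>k\<in>K. y k = 0" using *[rule_format, of "\<lambda>p. eval2 p u v" y] uv by simp
      have "coeff A k = 0" for k
        using bspec[OF y0, of "Inl k"] deg by (cases "k \<le> e + 1") (auto simp: y_def K_def coeff_eq_0)
      moreover have "coeff n k = 0" for k
        using bspec[OF y0, of "Inr k"] deg by (cases "k \<le> e") (auto simp: y_def K_def coeff_eq_0)
      ultimately show "A = 0" "n = 0" by (auto intro: poly_eqI)
    qed
  qed
qed

text \<open>Among all factorisations, take one in which the leading coefficient of \<open>g\<close> has least degree: an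
  equation of a line that divides \<open>g\<close> could be moved to \<open>a\<close> and \<open>b\<close>.\<close>

lemma lines_not_dividing_factor:
  fixes A B :: "complex poly poly poly"
  assumes "A \<noteq> 0 \<or> B \<noteq> 0" "pderiv A * B = A * pderiv B"
  obtains a b g where "A = Polynomial.smult a g" "B = Polynomial.smult b g" "g \<noteq> 0"
    "\<And>\<xi> \<eta>. \<exists>x u. u \<noteq> \<xi> \<and> eval3 g x (\<xi> * x + \<eta>) u \<noteq> 0"
proof -
  define fac where "fac = (\<lambda>(a, b, g). A = Polynomial.smult a g \<and> B = Polynomial.smult b g \<and> g \<noteq> 0)"
  obtain a0 b0 g0 where "A = Polynomial.smult a0 g0" "B = Polynomial.smult b0 g0" "g0 \<noteq> 0"
    by (rule wronskian_zero_factorization[OF assms])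
  then have "fac (a0, b0, g0)" by (simp add: fac_def)
  from ex_has_least_nat[of fac, OF this, of "\<lambda>(a, b, g). degree (lead_coeff g)"]
  obtain a b g where abg: "fac (a, b, g)"
    and least: "\<And>a' b' g'. fac (a', b', g') \<Longrightarrow> degree (lead_coeff g) \<le> degree (lead_coeff g')"
    by (auto split: prod.splits)
  have "\<exists>x u. u \<noteq> \<xi> \<and> eval3 g x (\<xi> * x + \<eta>) u \<noteq> 0" for \<xi> \<eta>
  proof (rule ccontr)
    assume "\<not> ?thesis"
    then have c: "eval2 (coeff g k) x (\<xi> * x + \<eta>) = 0" for x k
      by (intro eval3_coeffs_zero[of \<xi>]) auto
    \<comment> \<open>The equation \<open>y - \<xi> x - \<eta>\<close>. It has degree 1 in
      \<open>y\<close>, so dividing by it lowers the minimised degree.\<close>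
    define l where "l = [: - [:\<eta>, \<xi>:], 1 :]"
    have "poly (coeff g k) [:\<eta>, \<xi>:] = 0" for k
      using c[of k] poly_all_0_iff_0[of "poly (coeff g k) [:\<eta>, \<xi>:]"] by (simp add: poly_poly_line)
    then have "l dvd coeff g k" for k by (simp add: l_def poly_eq_0_iff_dvd)
    then have "[:l:] dvd g" by (simp add: const_poly_dvd_iff)
    then obtain g' where g': "g = Polynomial.smult l g'" by (auto simp: dvd_def)
    have l0: "l \<noteq> 0" "degree l = 1" by (simp_all add: l_def)
    have g'0: "g' \<noteq> 0" using abg g' by (auto simp: fac_def)
    have "fac (l * a, l * b, g')" using abg g'0 by (simp add: fac_def g' ac_simps)
    then have "degree (lead_coeff g) \<le> degree (lead_coeff g')" by (rule least)
    moreover have "degree (lead_coeff g) = 1 + degree (lead_coeff g')"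
      using g'0 l0 by (simp add: g' degree_mult_eq del: mult_pCons_left)
    ultimately show False by simp
  qed
  then show thesis using that[of a g b] abg by (auto simp: fac_def)
qed


lemma degree_sum_monom_le: "degree (\<Sum>k\<le>n. monom (c k) k) \<le> n"
  by (rule degree_sum_le) (auto intro: order_trans[OF degree_monom_le])

lemma coeff_sum_monom: "coeff (\<Sum>k\<le>n. monom (c k) k) j = (if j \<le> n then c j else 0)"
  by (simp add: coeff_sum)

lemma degree_diff_pCons_le:
  fixes p q :: "'a::comm_ring_1 poly"
  shows "degree p \<le> n \<Longrightarrow> degree q \<le> n \<Longrightarrow> degree (p - pCons 0 q) \<le> Suc n"
  by (intro degree_diff_le order_trans[OF degree_pCons_le]) auto

lemma poly_sum_monom:
  fixes x :: "'a::comm_ring_1"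
  shows "poly (\<Sum>k\<le>n. monom (c k) k) x = (\<Sum>k\<le>n. c k * x ^ k)"
  by (simp add: poly_sum poly_monom)

text \<open>A family of vector fields along all lines, tangent to the given lines, has constant direction
  at every point: the Wronskian of its two components with respect to the slope \<open>u\<close> has degree at
  most \<open>2e + 2\<close> along the line \<open>y = u x + v\<close> and vanishes at its intersections with the given lines.\<close>

lemma tangent_family_constant_direction:
  fixes \<xi> \<eta> :: "'i \<Rightarrow> complex" and a b :: "nat \<Rightarrow> complex poly poly"
  assumes I: "finite I" "inj_on (\<lambda>i. (\<xi> i, \<eta> i)) I" "2 * e + 3 \<le> card I"
    and nz: "(\<exists>k\<le>e + 1. a k \<noteq> 0) \<or> (\<exists>k\<le>e. b k \<noteq> 0)"
    and tangent: "\<And>u v i. i \<in> I \<Longrightarrow> u \<noteq> \<xi> i \<Longrightarrow>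
      (\<Sum>k\<le>e. eval2 (b k) u v * ((v - \<eta> i) / (\<xi> i - u)) ^ k)
        = (\<xi> i - u) * (\<Sum>k\<le>e + 1. eval2 (a k) u v * ((v - \<eta> i) / (\<xi> i - u)) ^ k)"
  shows "\<exists>A B. (A \<noteq> 0 \<or> B \<noteq> 0) \<and> (\<forall>i\<in>I. poly (B - Polynomial.smult [:\<xi> i:] A) [:\<eta> i, \<xi> i:] = 0) \<and>
    finite {u. \<not> (\<exists>v. degree (poly A [:v, u:]) \<le> e + 1 \<and>
      degree (poly B [:v, u:] - Polynomial.smult u (poly A [:v, u:])) \<le> e)}"
proof -
  obtain S S\<^sub>1 S\<^sub>2 where S: "\<And>c x y u. eval3 (S c) x y u = eval2 c u (y - u * x)"
    "\<And>c x y u. eval3 (pderiv (S c)) x y u = eval2 (S\<^sub>1 c) u (y - u * x) - x * eval2 (S\<^sub>2 c) u (y - u * x)"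
    using pencil_substitution by metis
  define x :: "complex poly poly" where "x = [: [:0, 1:] :]"
  have x: "eval2 x s t = s" for s t by (simp add: x_def)
  define A where "A = (\<Sum>k\<le>e + 1. Polynomial.smult (x ^ k) (S (a k)))"
  define N where "N = (\<Sum>k\<le>e. Polynomial.smult (x ^ k) (S (b k)))"
  \<comment> \<open>\<open>N\<close> is the normal component and \<open>B = N + u A\<close> the
    \<open>y\<close>-component: \<open>(A, B)\<close> at a point is the vector assigned to it by the
    line of slope \<open>u\<close> through it.\<close>
  define B where "B = N + [:0, 1:] * A"
  define PA where "PA u v = (\<Sum>k\<le>e + 1. monom (eval2 (a k) u v) k)" for u v
  define PN where "PN u v = (\<Sum>k\<le>e. monom (eval2 (b k) u v) k)" for u v
  \<comment> \<open>These are the derivatives in the slope at a fixed point, read along the line.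
    The part multiplied by \<open>x\<close> stems from \<open>v = y - u x\<close> and costs one
    degree.\<close>
  define PA' where "PA' u v = (\<Sum>k\<le>e + 1. monom (eval2 (S\<^sub>1 (a k)) u v) k)
    - pCons 0 (\<Sum>k\<le>e + 1. monom (eval2 (S\<^sub>2 (a k)) u v) k)" for u v
  define PN' where "PN' u v = (\<Sum>k\<le>e. monom (eval2 (S\<^sub>1 (b k)) u v) k)
    - pCons 0 (\<Sum>k\<le>e. monom (eval2 (S\<^sub>2 (b k)) u v) k)" for u v
  have dA: "degree (PA u v) \<le> e + 1" and dN: "degree (PN u v) \<le> e" for u v
    unfolding PA_def PN_def by (rule degree_sum_monom_le)+
  have dA': "degree (PA' u v) \<le> e + 2" and dN': "degree (PN' u v) \<le> e + 1" for u v
    unfolding PA'_def PN'_def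
    using degree_diff_pCons_le[OF degree_sum_monom_le degree_sum_monom_le,
        of "\<lambda>k. eval2 (S\<^sub>1 (a k)) u v" "e + 1" "\<lambda>k. eval2 (S\<^sub>2 (a k)) u v"]
      degree_diff_pCons_le[OF degree_sum_monom_le degree_sum_monom_le,
        of "\<lambda>k. eval2 (S\<^sub>1 (b k)) u v" e "\<lambda>k. eval2 (S\<^sub>2 (b k)) u v"]
    by (simp_all del: sum.atMost_Suc)
  have EA: "eval3 A s (u * s + v) u = poly (PA u v) s" for s u v
    by (simp add: A_def PA_def x S poly_sum_monom mult.commute del: sum.atMost_Suc)
  have EN: "eval3 N s (u * s + v) u = poly (PN u v) s" for s u v
    by (simp add: N_def PN_def x S poly_sum_monom mult.commute)
  have pd: "pderiv (\<Sum>k\<le>n. Polynomial.smult (x ^ k) (S (c k))) = (\<Sum>k\<le>n. Polynomial.smult (x ^ k) (pderiv (S (c k))))" for n c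
    using higher_pderiv_sum[of 1 "\<lambda>k. Polynomial.smult (x ^ k) (S (c k))" "{..n}"] by (simp add: pderiv_smult)
  have EA': "eval3 (pderiv A) s (u * s + v) u = poly (PA' u v) s" for s u v
    unfolding A_def PA'_def pd
    by (simp add: x S poly_sum_monom sum_subtractf[symmetric] sum_distrib_left algebra_simps del: sum.atMost_Suc)
  have EN': "eval3 (pderiv N) s (u * s + v) u = poly (PN' u v) s" for s u v
    unfolding N_def PN'_def pd
    by (simp add: x S poly_sum_monom sum_subtractf[symmetric] sum_distrib_left algebra_simps)
  have EB: "eval3 B s t u = eval3 N s t u + u * eval3 A s t u" for s t u by (simp add: B_def)
  have EB': "eval3 (pderiv B) s t u = eval3 (pderiv N) s t u + eval3 A s t u + u * eval3 (pderiv A) s t u" for s t u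
    by (simp add: B_def pderiv_add pderiv_mult pderiv_pCons)
  have AB0: "A \<noteq> 0 \<or> B \<noteq> 0"
  proof (rule ccontr)
    assume "\<not> ?thesis"
    then have "A = 0" "B = 0" by auto
    then have "N = 0" by (simp add: B_def)
    have "PA u v = 0" "PN u v = 0" for u v
      using EA[of _ u v] EN[of _ u v] poly_all_0_iff_0 \<open>A = 0\<close> \<open>N = 0\<close> by auto
    then have c: "coeff (PA u v) k = 0" "coeff (PN u v) k = 0" for u v k by auto
    have "eval2 (a k) u v = 0" if "k \<le> e + 1" for k u v
      using that c(1)[where u = u and v = v and k = k]
      unfolding PA_def coeff_sum_monom by simp
    moreover have "eval2 (b k) u v = 0" if "k \<le> e" for k u v
      using that c(2)[where u = u and v = v and k = k]
      unfolding PN_def coeff_sum_monom by simp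
    ultimately have "a k = 0" if "k \<le> e + 1" for k using that by (intro eval2_eq_0)
    moreover have "b k = 0" if "k \<le> e" for k
      using that \<open>\<And>k u v. k \<le> e \<Longrightarrow> eval2 (b k) u v = 0\<close> by (intro eval2_eq_0)
    ultimately show False using nz by blast
  qed
  \<comment> \<open>At a point of the \<open>i\<close>-th line the vector \<open>(A, B)\<close> is
    tangent to that line for every slope \<open>u \<noteq> \<xi> i\<close>. Being valid on an open
    set of slopes at a fixed point, the relation may be differentiated in \<open>u\<close>.\<close>
  have on_line: "eval3 B s (\<xi> i * s + \<eta> i) u = \<xi> i * eval3 A s (\<xi> i * s + \<eta> i) u" if "i \<in> I" "u \<noteq> \<xi> i" for i s u
  proof -
    define v where "v = \<xi> i * s + \<eta> i - u * s"
    have "(v - \<eta> i) / (\<xi> i - u) = s" using that by (simp add: v_def field_simps)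
    then have "poly (PN u v) s = (\<xi> i - u) * poly (PA u v) s"
      using tangent[OF that, of v] by (simp add: PA_def PN_def poly_sum_monom del: sum.atMost_Suc)
    then have "eval3 N s (u * s + v) u = (\<xi> i - u) * eval3 A s (u * s + v) u" by (simp add: EA EN)
    then show ?thesis unfolding EB by (simp add: v_def algebra_simps)
  qed
  have on_line': "eval3 (pderiv B) s (\<xi> i * s + \<eta> i) u = \<xi> i * eval3 (pderiv A) s (\<xi> i * s + \<eta> i) u"
    if "i \<in> I" "u \<noteq> \<xi> i" for i s u
  proof -
    define y where "y = \<xi> i * s + \<eta> i"
    have "((\<lambda>w. eval3 B s y w - \<xi> i * eval3 A s y w) has_field_derivative
        eval3 (pderiv B) s y u - \<xi> i * eval3 (pderiv A) s y u) (at u)"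
      by (intro derivative_intros DERIV_eval3 DERIV_cmult)
    moreover have "((\<lambda>w. eval3 B s y w - \<xi> i * eval3 A s y w) has_field_derivative 0) (at u)"
    proof (rule has_field_derivative_transform_within_open[of "\<lambda>_. 0" 0 u "- {\<xi> i}"])
      show "0 = eval3 B s y w - \<xi> i * eval3 A s y w" if "w \<in> - {\<xi> i}" for w
        using on_line[OF \<open>i \<in> I\<close>, of w s] that by (simp add: y_def)
    qed (use that in \<open>auto intro: open_Compl\<close>)
    ultimately show ?thesis using DERIV_unique unfolding y_def by fastforce
  qed
  obtain g where g: "g \<noteq> 0" "\<And>u v i. eval2 g u v \<noteq> 0 \<Longrightarrow> i \<in> I \<Longrightarrow> u \<noteq> \<xi> i"
    "\<And>u v. eval2 g u v \<noteq> 0 \<Longrightarrow> inj_on (\<lambda>i. (v - \<eta> i) / (\<xi> i - u)) I"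
    using generic_intersections[OF I(1,2)] by blast
  define W where "W = pderiv A * B - A * pderiv B"
  have W_generic: "eval3 W s (u * s + v) u = 0" if uv: "eval2 g u v \<noteq> 0" for s u v
  proof -
    \<comment> \<open>The Wronskian \<open>W\<close> along a line. After substituting
      \<open>B = N + u A\<close> the terms \<open>u A A'\<close>, of degree up to
      \<open>2 e + 3\<close>, cancel. What remains has degree at most
      \<open>2 e + 2\<close>.\<close>
    define w where "w = PA' u v * PN u v - PA u v * PN' u v - PA u v * PA u v"
    have w: "poly w s = eval3 W s (u * s + v) u" for s
      unfolding w_def W_def eval3_simps EB EB' EA EN EA' EN' by (simp add: algebra_simps)
    have "w = 0"
    proof (rule poly_zero_if_many_roots[OF I(1) g(3)[OF uv]])
      fix i assume i: "i \<in> I"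
      define s where "s = (v - \<eta> i) / (\<xi> i - u)"
      have neq: "u \<noteq> \<xi> i" using g(2)[OF uv i] .
      then have y: "u * s + v = \<xi> i * s + \<eta> i" by (simp add: s_def field_simps)
      show "poly w ((v - \<eta> i) / (\<xi> i - u)) = 0"
        unfolding w s_def[symmetric] y W_def by (simp add: on_line[OF i neq] on_line'[OF i neq])
    next
      have "degree (PA' u v * PN u v) \<le> e + 2 + e" "degree (PA u v * PN' u v) \<le> e + 1 + (e + 1)"
        "degree (PA u v * PA u v) \<le> e + 1 + (e + 1)"
        by (intro order_trans[OF degree_mult_le] add_mono dA dN dA' dN')+
      then have "degree w \<le> 2 * e + 2" unfolding w_def by (intro degree_diff_le) auto
      then show "degree w < card I" using I(3) by simp
    qed
    then show ?thesis using w[of s] by simp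
  qed
  \<comment> \<open>\<open>W\<close> is known to vanish along general lines only. The factor
    \<open>S g\<close> covers the exceptional ones and can be cancelled afterwards as a nonzero
    polynomial.\<close>
  have "S g * W = 0"
  proof (rule eval3_eq_0)
    fix s y u
    show "eval3 (S g * W) s y u = 0"
      using W_generic[of u "y - u * s" s] by (cases "eval2 g u (y - u * s) = 0") (auto simp: S)
  qed
  moreover have "S g \<noteq> 0"
  proof
    assume "S g = 0"
    then have "eval2 g u v = 0" for u v using S(1)[of g 0 v u] by simp
    then have "g = 0" by (rule eval2_eq_0)
    then show False using g(1) by simp
  qed
  ultimately have wr: "pderiv A * B = A * pderiv B" by (simp add: W_def)
  obtain a\<^sub>1 b\<^sub>1 h where fac: "A = Polynomial.smult a\<^sub>1 h" "B = Polynomial.smult b\<^sub>1 h" "h \<noteq> 0"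
    and hline: "\<And>\<xi> \<eta>. \<exists>x u. u \<noteq> \<xi> \<and> eval3 h x (\<xi> * x + \<eta>) u \<noteq> 0"
    by (rule lines_not_dividing_factor[OF AB0 wr]) (rule that)
  \<comment> \<open>On the \<open>i\<close>-th line the tangency of \<open>(A, B)\<close> is that of
    \<open>(a\<^sub>1, b\<^sub>1)\<close> times \<open>h\<close>. At a slope for which
    \<open>h\<close> is not identically zero on this line, \<open>h\<close> cancels.\<close>
  have "poly (b\<^sub>1 - Polynomial.smult [:\<xi> i:] a\<^sub>1) [:\<eta> i, \<xi> i:] = 0" if "i \<in> I" for i
  proof -
    obtain s\<^sub>0 u where u: "u \<noteq> \<xi> i" "eval3 h s\<^sub>0 (\<xi> i * s\<^sub>0 + \<eta> i) u \<noteq> 0" using hline by blast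
    define r where "r = poly (poly h [:[:u:]:]) [:\<eta> i, \<xi> i:]"
    have "poly r s\<^sub>0 \<noteq> 0" using u(2) by (simp add: r_def poly_poly_line eval3_def)
    then have "r \<noteq> 0" by auto
    have "poly (poly (b\<^sub>1 - Polynomial.smult [:\<xi> i:] a\<^sub>1) [:\<eta> i, \<xi> i:] * r) s = 0" for s
      using on_line[OF that u(1), of s] unfolding fac
      by (simp only: poly_mult r_def poly_poly_line eval3_def[symmetric]) (simp add: algebra_simps)
    then have "poly (b\<^sub>1 - Polynomial.smult [:\<xi> i:] a\<^sub>1) [:\<eta> i, \<xi> i:] * r = 0"
      using poly_all_0_iff_0 by blast
    then show ?thesis using \<open>r \<noteq> 0\<close> by (simp only: mult_eq_0_iff) simp
  qed
  \<comment> \<open>Only the finitely many slopes at which \<open>h\<close> vanishes identically can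
    be bad. For any other slope, \<open>h\<close> is nonzero along some line of that slope, and
    there removing the factor \<open>h\<close> cannot increase degrees.\<close>
  moreover have "finite {u. \<not> (\<exists>v. degree (poly a\<^sub>1 [:v, u:]) \<le> e + 1 \<and>
      degree (poly b\<^sub>1 [:v, u:] - Polynomial.smult u (poly a\<^sub>1 [:v, u:])) \<le> e)}"
  proof (rule finite_subset)
    have "finite ((\<lambda>u. [:[:u:]:]) -` {z. poly h z = 0})"
      by (rule finite_vimageI[OF poly_roots_finite[OF fac(3)]]) (auto simp: inj_def)
    then show "finite {u. poly h [:[:u:]:] = 0}" by (simp add: vimage_def)
    have "\<exists>v. degree (poly a\<^sub>1 [:v, u:]) \<le> e + 1 \<and>
        degree (poly b\<^sub>1 [:v, u:] - Polynomial.smult u (poly a\<^sub>1 [:v, u:])) \<le> e" if "poly h [:[:u:]:] \<noteq> 0" for u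
    proof -
      have "\<exists>s t. eval2 (poly h [:[:u:]:]) s t \<noteq> 0"
      proof (rule ccontr)
        assume "\<not> ?thesis"
        then have "poly h [:[:u:]:] = 0" by (intro eval2_eq_0) simp
        then show False using that by simp
      qed
      then obtain s t where st: "eval2 (poly h [:[:u:]:]) s t \<noteq> 0" by blast
      define v where "v = t - u * s"
      define r where "r = poly (poly h [:[:u:]:]) [:v, u:]"
      have "poly r s \<noteq> 0" using st by (simp add: r_def poly_poly_line v_def)
      then have "r \<noteq> 0" by auto
      have "poly (PA u v) z = poly (poly a\<^sub>1 [:v, u:] * r) z" for z
        unfolding EA[symmetric] fac by (simp add: r_def poly_poly_line eval3_def)
      then have p: "PA u v = poly a\<^sub>1 [:v, u:] * r" by (simp add: poly_eq_poly_eq_iff[symmetric] fun_eq_iff)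
      have "poly (PN u v) z = poly ((poly b\<^sub>1 [:v, u:] - Polynomial.smult u (poly a\<^sub>1 [:v, u:])) * r) z" for z
      proof -
        have "poly (PN u v) z = eval3 B z (u * z + v) u - u * eval3 A z (u * z + v) u" by (simp add: EB EN)
        also have "\<dots> = poly ((poly b\<^sub>1 [:v, u:] - Polynomial.smult u (poly a\<^sub>1 [:v, u:])) * r) z"
          unfolding fac by (simp add: r_def poly_poly_line eval3_def algebra_simps)
        finally show ?thesis .
      qed
      then have q: "PN u v = (poly b\<^sub>1 [:v, u:] - Polynomial.smult u (poly a\<^sub>1 [:v, u:])) * r"
        by (simp add: poly_eq_poly_eq_iff[symmetric] fun_eq_iff)
      have deg: "degree p \<le> degree (p * r)" for p
        using \<open>r \<noteq> 0\<close> by (cases "p = 0") (simp_all add: degree_mult_eq)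
      show ?thesis
        using order_trans[OF deg dA[of u v, unfolded p]] order_trans[OF deg dN[of u v, unfolded q]] by blast
    qed
    then show "{u. \<not> (\<exists>v. degree (poly a\<^sub>1 [:v, u:]) \<le> e + 1 \<and>
      degree (poly b\<^sub>1 [:v, u:] - Polynomial.smult u (poly a\<^sub>1 [:v, u:])) \<le> e)} \<subseteq> {u. poly h [:[:u:]:] = 0}" by blast
  qed
  moreover have "a\<^sub>1 \<noteq> 0 \<or> b\<^sub>1 \<noteq> 0" using AB0 fac by auto
  ultimately show ?thesis by blast
qed

section \<open>Polynomials in three variables\<close>

lemma poly_mapping_sum_single:
  fixes f :: "'a \<Rightarrow>\<^sub>0 'b::comm_monoid_add"
  shows "f = (\<Sum>m\<in>Poly_Mapping.keys f. Poly_Mapping.single m (Poly_Mapping.lookup f m))"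
  by (rule poly_mapping_eqI) (auto simp: lookup_sum lookup_single when_def in_keys_iff)

lemma poly_mapping_single_induct [case_names zero single add]:
  fixes f :: "'a \<Rightarrow>\<^sub>0 'b::comm_monoid_add"
  assumes "P 0" "\<And>m c. P (Poly_Mapping.single m c)" "\<And>f g. P f \<Longrightarrow> P g \<Longrightarrow> P (f + g)"
  shows "P f"
proof -
  have "P (\<Sum>m\<in>K. Poly_Mapping.single m (Poly_Mapping.lookup f m))" if "finite K" for K
    using that by induction (auto intro: assms)
  from this[of "Poly_Mapping.keys f"] show ?thesis using poly_mapping_sum_single[of f] by simp
qed

lemma mdeg_add [simp]: "mdeg (m + n) = mdeg m + mdeg n"
  by (simp add: mdeg_def lookup_add sum.distrib)

lemma mdeg_zero [simp]: "mdeg 0 = 0"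
  by (simp add: mdeg_def)

lemma mdeg_single [simp]: "mdeg (Poly_Mapping.single i k) = k"
  by (simp add: mdeg_def lookup_single when_def)

lemma single_eq_Var_mult:
  assumes "Poly_Mapping.lookup m i > 0"
  shows "Poly_Mapping.single m c = Var i * Poly_Mapping.single (m - Poly_Mapping.single i 1) c"
    "mdeg m = Suc (mdeg (m - Poly_Mapping.single i 1))"
proof -
  have m: "m = Poly_Mapping.single i 1 + (m - Poly_Mapping.single i 1)"
    by (rule poly_mapping_eqI) (use assms in \<open>auto simp: lookup_add lookup_minus lookup_single when_def\<close>)
  show "Poly_Mapping.single m c = Var i * Poly_Mapping.single (m - Poly_Mapping.single i 1) c"
    unfolding Var_def mult_single using m by simp
  show "mdeg m = Suc (mdeg (m - Poly_Mapping.single i 1))"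
    by (subst m) simp
qed

lemma Const_simps:
  "Const 0 = 0" "Const 1 = 1" "Const (a + b) = Const a + Const b" "Const (a - b) = Const a - Const b"
  "Const (- a) = - Const a" "Const (a * b) = Const a * Const b"
  by (simp_all add: Const_def single_add single_diff single_uminus mult_single)

lemma monomial_induct:
  assumes "\<And>c. P 0 (Const c)" "\<And>d i f. P d f \<Longrightarrow> P (Suc d) (Var i * f)"
  shows "P (mdeg m) (Poly_Mapping.single m c)"
proof (induction "mdeg m" arbitrary: m)
  case 0
  then have "m = 0" by (intro poly_mapping_eqI) (simp add: mdeg_def)
  then show ?case using assms(1)[of c] by (simp add: Const_def)
next
  case (Suc d)
  have "\<exists>i. Poly_Mapping.lookup m i > 0"
  proof (rule ccontr)
    assume "\<not> ?thesis"
    then have "mdeg m = 0" by (simp add: mdeg_def)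
    then show False using Suc by simp
  qed
  then obtain i where "Poly_Mapping.lookup m i > 0" by blast
  from single_eq_Var_mult[OF this] Suc show ?case by (metis assms(2) nat.inject)
qed

lemma poly3_induct [case_names const add var]:
  assumes "\<And>c. P (Const c)" "\<And>f g. P f \<Longrightarrow> P g \<Longrightarrow> P (f + g)" "\<And>i f. P f \<Longrightarrow> P (Var i * f)"
  shows "P f"
proof (induction f rule: poly_mapping_single_induct)
  case zero
  show ?case using assms(1)[of 0] by (simp add: Const_simps)
next
  case (single m c)
  show ?case by (rule monomial_induct[of "\<lambda>_. P"]) (auto intro: assms)
qed (rule assms)

lemma homog_induct [consumes 1, case_names const zero add var]:
  assumes "f \<in> homog (int d)"
    and "\<And>c. P 0 (Const c)" "\<And>d. P d 0" "\<And>d f g. P d f \<Longrightarrow> P d g \<Longrightarrow> P d (f + g)"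
    "\<And>d i f. P d f \<Longrightarrow> P (Suc d) (Var i * f)"
  shows "P d f"
proof -
  have "P d (\<Sum>m\<in>K. Poly_Mapping.single m (Poly_Mapping.lookup f m))" if "finite K" "K \<subseteq> Poly_Mapping.keys f" for K
    using that
  proof induction
    case (insert m K)
    then have "mdeg m = d" using assms(1) by (auto simp: homog_def)
    then show ?case using insert monomial_induct[of P m "Poly_Mapping.lookup f m"] assms(2,4,5) by auto
  qed (simp add: assms)
  from this[of "Poly_Mapping.keys f"] show ?thesis using poly_mapping_sum_single[of f] by simp
qed

subsection \<open>Evaluation\<close>

lemma eval_at_superset:
  assumes "finite K" "Poly_Mapping.keys f \<subseteq> K"
  shows "eval_at f y = (\<Sum>m\<in>K. Poly_Mapping.lookup f m * (\<Prod>i\<in>UNIV. (y $ i) ^ Poly_Mapping.lookup m i))"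
  unfolding eval_at_def by (rule sum.mono_neutral_left) (use assms in \<open>auto simp: in_keys_iff\<close>)

lemma eval_at_0 [simp]: "eval_at 0 y = 0"
  by (simp add: eval_at_def)

lemma eval_at_add [simp]: "eval_at (f + g) y = eval_at f y + eval_at g y"
proof -
  let ?K = "Poly_Mapping.keys f \<union> Poly_Mapping.keys g"
  have "Poly_Mapping.keys (f + g) \<subseteq> ?K" by (rule keys_add)
  then show ?thesis
    by (simp add: eval_at_superset[of ?K] lookup_add distrib_right sum.distrib)
qed

lemma eval_at_single: "eval_at (Poly_Mapping.single m c) y = c * (\<Prod>i\<in>UNIV. (y $ i) ^ Poly_Mapping.lookup m i)"
  by (subst eval_at_superset[of "{m}"]) auto

lemma eval_at_mult [simp]: "eval_at (f * g) y = eval_at f y * eval_at g y"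
proof (induction f rule: poly_mapping_single_induct)
  case (single m c)
  show ?case
  proof (induction g rule: poly_mapping_single_induct)
    case (single n d)
    show ?case by (simp add: mult_single eval_at_single lookup_add power_add prod.distrib)
  qed (simp_all add: distrib_left)
qed (simp_all add: distrib_right)

lemma eval_at_Const [simp]: "eval_at (Const c) y = c"
  by (simp add: Const_def eval_at_single)

lemma eval_at_Var [simp]: "eval_at (Var i) y = y $ i"
proof -
  have "(\<Prod>j\<in>UNIV. y $ j ^ Poly_Mapping.lookup (Poly_Mapping.single i (1::nat)) j) = (\<Prod>j\<in>UNIV. if j = i then y $ i else 1)"
    by (rule prod.cong) (auto simp: lookup_single when_def)
  then show ?thesis by (simp add: Var_def eval_at_single)
qed

lemma eval_at_1 [simp]: "eval_at 1 y = 1"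
  using eval_at_Const[of 1 y] by (simp add: Const_simps)

lemma eval_at_uminus [simp]: "eval_at (- f) y = - eval_at f y"
  using eval_at_add[of f "- f" y] by (simp add: eq_neg_iff_add_eq_0 add.commute del: eval_at_add)

lemma eval_at_diff [simp]: "eval_at (f - g) y = eval_at f y - eval_at g y"
  using eval_at_add[of f "- g" y] by simp

lemma eval_at_power [simp]: "eval_at (f ^ n) y = eval_at f y ^ n"
  by (induction n) auto

lemma eval_at_sum: "eval_at (\<Sum>i\<in>I. f i) y = (\<Sum>i\<in>I. eval_at (f i) y)"
  by (induction I rule: infinite_finite_induct) auto

lemma eval_at_prod: "eval_at (\<Prod>i\<in>I. f i) y = (\<Prod>i\<in>I. eval_at (f i) y)"
  by (induction I rule: infinite_finite_induct) auto

subsection \<open>Homogeneous polynomials\<close>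

lemma homog_0 [simp]: "0 \<in> homog d"
  by (simp add: homog_def)

lemma homog_add: "f \<in> homog d \<Longrightarrow> g \<in> homog d \<Longrightarrow> f + g \<in> homog d"
  using keys_add[of f g] by (auto simp: homog_def)

lemma homog_uminus: "f \<in> homog d \<Longrightarrow> - f \<in> homog d"
  by (auto simp: homog_def in_keys_iff)

lemma homog_diff: "f \<in> homog d \<Longrightarrow> g \<in> homog d \<Longrightarrow> f - g \<in> homog d"
  using homog_add[of f d "- g"] homog_uminus by simp

lemma homog_mult: "f \<in> homog d \<Longrightarrow> g \<in> homog e \<Longrightarrow> f * g \<in> homog (d + e)"
  using keys_mult[of f g] by (fastforce simp: homog_def)

lemma homog_mult': "f \<in> homog d \<Longrightarrow> g \<in> homog e \<Longrightarrow> k = d + e \<Longrightarrow> f * g \<in> homog k"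
  using homog_mult by blast

lemma homog_Const [simp]: "Const c \<in> homog 0"
  by (auto simp: homog_def Const_def split: if_splits)

lemma homog_1 [simp]: "1 \<in> homog 0"
  using homog_Const[of 1] by (simp add: Const_simps)

lemma homog_Const_mult: "f \<in> homog d \<Longrightarrow> Const c * f \<in> homog d"
  using homog_mult[OF homog_Const] by fastforce

lemma homog_Var [simp]: "Var i \<in> homog 1"
  by (auto simp: homog_def Var_def)

lemma homog_sum: "(\<And>i. i \<in> I \<Longrightarrow> f i \<in> homog d) \<Longrightarrow> (\<Sum>i\<in>I. f i) \<in> homog d"
  by (induction I rule: infinite_finite_induct) (auto intro: homog_add)

lemma homog_power: "f \<in> homog d \<Longrightarrow> f ^ n \<in> homog (int n * d)"
  by (induction n) (auto intro!: homog_mult' simp: algebra_simps)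

lemma homog_prod: "(\<And>i. i \<in> I \<Longrightarrow> f i \<in> homog 1) \<Longrightarrow> finite I \<Longrightarrow> (\<Prod>i\<in>I. f i) \<in> homog (int (card I))"
  by (induction I rule: infinite_finite_induct) (auto intro!: homog_mult')

lemma homog_neg: "f \<in> homog d \<Longrightarrow> d < 0 \<Longrightarrow> f = 0"
  using keys_eq_empty by (fastforce simp: homog_def)

lemma tdeg_homog: "f \<in> homog d \<Longrightarrow> f \<noteq> 0 \<Longrightarrow> int (tdeg f) = d"
proof -
  assume f: "f \<in> homog d" "f \<noteq> 0"
  then have "Poly_Mapping.keys f \<noteq> {}" using keys_eq_empty by blast
  then have "tdeg f \<in> mdeg ` Poly_Mapping.keys f" unfolding tdeg_def by (intro Max_in) auto
  then show ?thesis using f by (auto simp: homog_def)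
qed

definition hcomponent :: "nat \<Rightarrow> poly3 \<Rightarrow> poly3"
  where "hcomponent d f =
    (\<Sum>m\<in>{m \<in> Poly_Mapping.keys f. mdeg m = d}. Poly_Mapping.single m (Poly_Mapping.lookup f m))"

lemma lookup_hcomponent:
  "Poly_Mapping.lookup (hcomponent d f) m = (if mdeg m = d then Poly_Mapping.lookup f m else 0)"
  by (auto simp: hcomponent_def lookup_sum lookup_single when_def in_keys_iff)

lemma hcomponent_add: "hcomponent d (f + g) = hcomponent d f + hcomponent d g"
  by (rule poly_mapping_eqI) (simp add: lookup_hcomponent lookup_add)

lemma homog_hcomponent: "hcomponent d f \<in> homog (int d)"
  by (auto simp: homog_def in_keys_iff lookup_hcomponent split: if_splits)

lemma hcomponent_0 [simp]: "hcomponent d 0 = 0"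
  by (rule poly_mapping_eqI) (simp add: lookup_hcomponent)

lemma hcomponent_homog: "f \<in> homog (int e) \<Longrightarrow> hcomponent d f = (if d = e then f else 0)"
  by (intro poly_mapping_eqI) (auto simp: lookup_hcomponent homog_def in_keys_iff)

lemma sum_hcomponent: "\<exists>N. f = (\<Sum>d\<le>N. hcomponent d f)"
proof
  show "f = (\<Sum>d\<le>Max (mdeg ` Poly_Mapping.keys f). hcomponent d f)"
  proof (rule poly_mapping_eqI)
    fix m
    have "mdeg m \<le> Max (mdeg ` Poly_Mapping.keys f)" if "Poly_Mapping.lookup f m \<noteq> 0"
      using that by (auto intro!: Max_ge simp: in_keys_iff)
    then show "Poly_Mapping.lookup f m = Poly_Mapping.lookup (\<Sum>d\<le>Max (mdeg ` Poly_Mapping.keys f). hcomponent d f) m"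
      by (auto simp: lookup_sum lookup_hcomponent)
  qed
qed

lemma hcomponent_mult:
  assumes "f \<in> homog (int d)"
  shows "hcomponent (d + k) (f * g) = f * hcomponent k g"
proof (induction g rule: poly_mapping_single_induct)
  case zero
  show ?case by simp
next
  case (single m c)
  have s: "Poly_Mapping.single m c \<in> homog (int (mdeg m))"
    by (auto simp: homog_def split: if_splits)
  then have "f * Poly_Mapping.single m c \<in> homog (int (d + mdeg m))"
    using homog_mult[OF assms] by simp
  from hcomponent_homog[OF this] show ?case using hcomponent_homog[OF s] by auto
qed (simp add: hcomponent_add distrib_left)

text \<open>A nonzero component of \<open>g\<close> in another degree would give a nonzero component
  of \<open>f * g\<close> in a wrong degree. This applies to the \<open>h\<close> in
  \<open>g ^ n = f * h\<close>, which defines the restriction maps.\<close>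

lemma homog_cofactor:
  assumes "f \<in> homog d" "f \<noteq> 0" "f * g \<in> homog e"
  shows "g \<in> homog (e - d)"
proof -
  have f: "f \<in> homog (int (tdeg f))" using tdeg_homog[OF assms(1,2)] assms(1) by simp
  have "hcomponent k g = 0" if "int k \<noteq> e - d" for k
  proof (rule ccontr)
    assume "hcomponent k g \<noteq> 0"
    moreover have "f * hcomponent k g = hcomponent (tdeg f + k) (f * g)" using hcomponent_mult[OF f] by simp
    moreover have "hcomponent (tdeg f + k) (f * g) = 0"
    proof (cases "f * g = 0")
      case False
      then have "f * g \<in> homog (int (tdeg (f * g)))" "int (tdeg (f * g)) = e" using tdeg_homog[OF assms(3)] assms(3) by auto
      then show ?thesis using hcomponent_homog[of "f * g" "tdeg (f * g)"] tdeg_homog[OF assms(1,2)] that by auto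
    qed (simp only: hcomponent_0)
    ultimately show False using assms(2) by simp
  qed
  moreover obtain N where N: "g = (\<Sum>k\<le>N. hcomponent k g)" using sum_hcomponent by blast
  ultimately show ?thesis
    by (subst N) (metis (no_types, lifting) homog_sum homog_hcomponent homog_0)
qed

lemma eval_at_scale:
  assumes "f \<in> homog (int d)"
  shows "eval_at f (t *s y) = t ^ d * eval_at f y"
  using assms by (induction rule: homog_induct) (auto simp: algebra_simps)

subsection \<open>Derivations\<close>

lemma pderivative_superset:
  assumes "finite K" "Poly_Mapping.keys f \<subseteq> K"
  shows "pderivative i f = (\<Sum>m\<in>K. Poly_Mapping.single (m - Poly_Mapping.single i 1)
    (of_nat (Poly_Mapping.lookup m i) * Poly_Mapping.lookup f m))"
  unfolding pderivative_def by (rule sum.mono_neutral_left) (use assms in \<open>auto simp: in_keys_iff\<close>)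

lemma pderivative_add: "pderivative i (f + g) = pderivative i f + pderivative i g"
proof -
  let ?K = "Poly_Mapping.keys f \<union> Poly_Mapping.keys g"
  have "Poly_Mapping.keys (f + g) \<subseteq> ?K" by (rule keys_add)
  then show ?thesis
    by (simp add: pderivative_superset[of ?K] lookup_add distrib_left sum.distrib single_add)
qed

lemma pderivative_single: "pderivative i (Poly_Mapping.single m c)
    = Poly_Mapping.single (m - Poly_Mapping.single i 1) (of_nat (Poly_Mapping.lookup m i) * c)"
  by (subst pderivative_superset[of "{m}"]) auto

lemma pderivative_mult: "pderivative i (f * g) = f * pderivative i g + g * pderivative i f"
proof (induction f rule: poly_mapping_single_induct)
  case (single m c)
  show ?case
  proof (induction g rule: poly_mapping_single_induct)
    case (single n d)
    have shift: "p + (q - Poly_Mapping.single i 1) = p + q - Poly_Mapping.single i 1"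
      if "Poly_Mapping.lookup q i > 0" for p q :: "3 \<Rightarrow>\<^sub>0 nat"
      by (rule poly_mapping_eqI) (use that in \<open>auto simp: lookup_add lookup_minus lookup_single when_def\<close>)
    have *: "Poly_Mapping.single p a * Poly_Mapping.single (q - Poly_Mapping.single i 1) (of_nat (Poly_Mapping.lookup q i) * b)
      = Poly_Mapping.single (p + q - Poly_Mapping.single i 1) (of_nat (Poly_Mapping.lookup q i) * (a * b))"
      for p q :: "3 \<Rightarrow>\<^sub>0 nat" and a b :: complex
      using shift[of q p] by (cases "Poly_Mapping.lookup q i = 0") (auto simp: mult_single ac_simps)
    show ?case
      unfolding mult_single[of m c n d] pderivative_single unfolding *
      by (simp only: add.commute[of n m] single_add[symmetric] lookup_add of_nat_add)
        (simp add: algebra_simps)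
  qed (simp_all add: pderivative_add distrib_left distrib_right pderivative_def[of _ 0])
qed (simp_all add: pderivative_add distrib_left distrib_right pderivative_def[of _ 0])

lemma pderivative_Const [simp]: "pderivative i (Const c) = 0"
  by (simp add: Const_def pderivative_single)

lemma pderivative_Var: "pderivative i (Var j) = (if i = j then 1 else 0)"
  by (simp add: Var_def pderivative_single lookup_single when_def)

lemma pderivative_Var_mult: "pderivative i (Var j * f) = Var j * pderivative i f + (if i = j then f else 0)"
  by (simp add: pderivative_mult pderivative_Var)

lemma derivation_combination: "derivation (\<lambda>f. \<Sum>i\<in>UNIV. F i * pderivative i f)"
  unfolding derivation_def
  by (simp add: pderivative_add pderivative_mult distrib_left sum.distrib sum_distrib_left algebra_simps)

lemma derivation_eq:
  assumes "derivation \<theta>"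
  shows "\<theta> f = (\<Sum>i\<in>UNIV. \<theta> (Var i) * pderivative i f)"
proof -
  have add: "\<theta> (f + g) = \<theta> f + \<theta> g" and const: "\<theta> (Const c * f) = Const c * \<theta> f"
    and mult: "\<theta> (f * g) = f * \<theta> g + g * \<theta> f" for f g c
    using assms by (auto simp: derivation_def)
  have "\<theta> 1 = 0" using mult[of 1 1] by simp
  then have "\<theta> (Const c) = 0" for c using const[of c 1] by simp
  then show ?thesis
  proof (induction f rule: poly3_induct)
    case (var j f)
    have "(\<Sum>i\<in>UNIV. \<theta> (Var i) * pderivative i (Var j * f))
      = Var j * (\<Sum>i\<in>UNIV. \<theta> (Var i) * pderivative i f) + (\<Sum>i\<in>UNIV. if i = j then f * \<theta> (Var j) else 0)"
      unfolding sum_distrib_left sum.distrib[symmetric]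
      by (rule sum.cong[OF refl], subst pderivative_Var_mult) (simp add: algebra_simps)
    then show ?case using var by (simp add: mult add.commute)
  qed (simp_all add: add pderivative_add distrib_left sum.distrib)
qed

lemma pderivative_homog:
  assumes "f \<in> homog (int d)"
  shows "pderivative i f \<in> homog (int d - 1)"
proof -
  have "f \<in> homog (int d) \<and> pderivative i f \<in> homog (int d - 1)"
    using assms
  proof (induction rule: homog_induct)
    case (var d j f)
    then show ?case
      by (auto simp: pderivative_Var_mult intro!: homog_add homog_mult'[OF homog_Var])
  qed (auto simp: pderivative_add pderivative_def[of _ 0] intro: homog_add)
  then show ?thesis by blast
qed

lemma derivation_euler: "derivation euler"
  using derivation_combination[of Var] by (simp add: euler_def[abs_def])

lemma euler_Var [simp]: "euler (Var i) = Var i"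
  by (simp add: euler_def pderivative_Var if_distrib cong: if_cong)

lemma euler_homog:
  assumes "f \<in> homog (int d)"
  shows "euler f = of_nat d * f"
  using assms
  by (induction rule: homog_induct)
    (use derivation_euler in \<open>auto simp: derivation_def euler_def[of "Const _"] euler_def[of 0] pderivative_def[of _ 0] algebra_simps\<close>)

subsection \<open>Restriction to a parametrised line\<close>

text \<open>The restriction to the line through \<open>a\<close> and \<open>b\<close>,
  dehomogenised: \<open>b\<close> is the point \<open>x = 0\<close> and \<open>a\<close> the point
  \<open>x = \<infinity>\<close>.\<close>

definition rho :: "complex ^ 3 \<Rightarrow> complex ^ 3 \<Rightarrow> poly3 \<Rightarrow> complex poly"
  where "rho a b f = (\<Sum>m\<in>Poly_Mapping.keys f. Polynomial.smult (Poly_Mapping.lookup f m)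
    (\<Prod>i\<in>UNIV. [:b $ i, a $ i:] ^ Poly_Mapping.lookup m i))"

lemma poly_rho: "poly (rho a b f) x = eval_at f (x *s a + b)"
  by (simp add: rho_def eval_at_def poly_sum poly_prod add.commute)

lemma rho_eqI: "(\<And>x. poly (rho a b f) x = poly p x) \<Longrightarrow> rho a b f = p"
  by (simp add: poly_eq_poly_eq_iff[symmetric] fun_eq_iff)

lemma rho_simps [simp]:
  "rho a b 0 = 0" "rho a b 1 = 1" "rho a b (Const c) = [:c:]"
  "rho a b (f + g) = rho a b f + rho a b g" "rho a b (f - g) = rho a b f - rho a b g"
  "rho a b (- f) = - rho a b f" "rho a b (f * g) = rho a b f * rho a b g" "rho a b (f ^ n) = rho a b f ^ n"
  "rho a b (Var i) = [:b $ i, a $ i:]"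
  by (rule rho_eqI; simp add: poly_rho)+

lemma rho_sum: "rho a b (\<Sum>i\<in>I. f i) = (\<Sum>i\<in>I. rho a b (f i))"
  by (rule rho_eqI) (simp add: poly_rho eval_at_sum poly_sum)

lemma rho_prod: "rho a b (\<Prod>i\<in>I. f i) = (\<Prod>i\<in>I. rho a b (f i))"
  by (rule rho_eqI) (simp add: poly_rho eval_at_prod poly_prod)

lemma degree_rho:
  assumes "f \<in> homog (int d)"
  shows "degree (rho a b f) \<le> d"
  using assms
proof (induction rule: homog_induct)
  case (var d i f)
  then show ?case using degree_mult_le[of "[:b $ i, a $ i:]" "rho a b f"] by (simp split: if_splits del: mult_pCons_left)
qed (auto intro: degree_add_le)

text \<open>Linear coordinates adapted to the line \<open>l = 0\<close>, with \<open>X / W\<close>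
  as affine coordinate on it. Besides the lines \<open>Y = u X + v W\<close> the frame also serves
  \<open>W = 0\<close>, where \<open>Y\<close> and \<open>X\<close> play the roles of
  \<open>X\<close> and \<open>W\<close>.\<close>

locale line_frame =
  fixes a b :: "complex ^ 3" and l X W :: poly3
  assumes l_homog: "l \<in> homog 1" and X_homog: "X \<in> homog 1" and W_homog: "W \<in> homog 1"
    and rho_l [simp]: "rho a b l = 0" and rho_X [simp]: "rho a b X = [:0, 1:]" and rho_W [simp]: "rho a b W = 1"
    and Var_span: "\<exists>c e g. Var i = Const c * X + Const e * W + Const g * l"
begin

text \<open>Homogenisation by \<open>W\<close>, a right inverse of the restriction for polynomials
  of degree at most \<open>d\<close>.\<close>

definition lift :: "nat \<Rightarrow> complex poly \<Rightarrow> poly3"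
  where "lift d p = (\<Sum>k\<le>d. Const (coeff p k) * (X ^ k * W ^ (d - k)))"

lemma lift_homog: "lift d p \<in> homog (int d)"
  unfolding lift_def
proof (intro homog_sum homog_Const_mult)
  fix k assume "k \<in> {..d}"
  then show "X ^ k * W ^ (d - k) \<in> homog (int d)"
    using homog_mult[OF homog_power[OF X_homog, of k] homog_power[OF W_homog, of "d - k"]] by simp
qed

lemma lift_0 [simp]: "lift d 0 = 0"
  by (simp add: lift_def Const_simps)

lemma lift_add: "lift d (p + q) = lift d p + lift d q"
  by (simp add: lift_def Const_simps distrib_right sum.distrib)

lemma lift_smult: "lift d (Polynomial.smult c p) = Const c * lift d p"
  by (simp add: lift_def Const_simps sum_distrib_left ac_simps)

lemma lift_pCons: "lift (Suc d) (pCons 0 p) = X * lift d p"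
  unfolding lift_def by (subst sum.atMost_Suc_shift) (simp add: sum_distrib_left ac_simps Const_simps)

lemma lift_W: "degree p \<le> d \<Longrightarrow> lift (Suc d) p = W * lift d p"
  unfolding lift_def sum_distrib_left
  by (simp add: coeff_eq_0 Const_simps) (rule sum.cong, auto simp: Suc_diff_le ac_simps)

lemma rho_lift:
  assumes "degree p \<le> d"
  shows "rho a b (lift d p) = p"
proof (rule rho_eqI)
  fix x
  have "poly (rho a b (lift d p)) x = (\<Sum>k\<le>d. coeff p k * x ^ k)"
    by (simp add: lift_def rho_sum poly_sum)
  then show "poly (rho a b (lift d p)) x = poly p x" using poly_eq_sum_le[OF assms] by simp
qed

text \<open>Modulo \<open>l\<close> every form is a form in \<open>X\<close> and \<open>W\<close>
  alone, since each variable is a combination of \<open>X\<close>, \<open>W\<close> and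
  \<open>l\<close>.\<close>

lemma lift_rho:
  assumes "f \<in> homog (int d)"
  shows "\<exists>g\<in>homog (int d - 1). f = lift d (rho a b f) + l * g"
proof -
  have "degree (rho a b f) \<le> d \<and> (\<exists>g\<in>homog (int d - 1). f = lift d (rho a b f) + l * g)"
    using assms
  proof (induction rule: homog_induct)
    case (const c)
    show ?case by (intro conjI bexI[of _ 0]) (auto simp: lift_def)
  next
    case (zero d)
    show ?case by (intro conjI bexI[of _ 0]) auto
  next
    case (add d f g)
    then obtain f' g' where "f' \<in> homog (int d - 1)" "g' \<in> homog (int d - 1)"
      "f = lift d (rho a b f) + l * f'" "g = lift d (rho a b g) + l * g'" by blast
    then have "f + g = (lift d (rho a b f) + l * f') + (lift d (rho a b g) + l * g')" "f' + g' \<in> homog (int d - 1)"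
      by (auto intro: homog_add)
    moreover have "lift d (rho a b (f + g)) + l * (f' + g') = (lift d (rho a b f) + l * f') + (lift d (rho a b g) + l * g')"
      by (simp add: lift_add distrib_left)
    ultimately have "f + g = lift d (rho a b (f + g)) + l * (f' + g')" "f' + g' \<in> homog (int d - 1)"
      by (simp_all only:)
    moreover have "degree (rho a b (f + g)) \<le> d" using add by (auto intro: degree_add_le)
    ultimately show ?case by blast
  next
    case (var d i f)
    then obtain g where g: "g \<in> homog (int d - 1)" "f = lift d (rho a b f) + l * g"
      and deg: "degree (rho a b f) \<le> d" by blast
    obtain c e h where v: "Var i = Const c * X + Const e * W + Const h * l" using Var_span by blast
    define p where "p = rho a b f"
    have "Var i * f = Const c * (X * lift d p) + Const e * (W * lift d p)
        + l * ((Const c * X + Const e * W + Const h * l) * g + Const h * lift d p)"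
      unfolding v by (subst g(2)) (simp add: p_def algebra_simps)
    also have "Const c * (X * lift d p) + Const e * (W * lift d p) = lift (Suc d) (rho a b (Var i * f))"
      unfolding v using deg by (simp add: p_def lift_pCons lift_W lift_add lift_smult)
    finally have "Var i * f = lift (Suc d) (rho a b (Var i * f)) + l * (Var i * g + Const h * lift d p)"
      by (simp only: v[symmetric])
    moreover have "Var i * g + Const h * lift d p \<in> homog (int (Suc d) - 1)"
      using g(1) by (auto intro!: homog_add homog_Const_mult lift_homog homog_mult')
    moreover have "degree (rho a b (Var i * f)) \<le> Suc d"
      using deg degree_mult_le[of "[:b $ i, a $ i:]" "rho a b f"] by (simp split: if_splits del: mult_pCons_left)
    ultimately show ?case by blast
  qed
  then show ?thesis by blast
qed

lemma rho_eq_0_imp_multiple: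
  assumes "f \<in> homog d" "rho a b f = 0"
  obtains g where "g \<in> homog (d - 1)" "f = l * g"
proof (cases "d < 0")
  case True
  then show ?thesis using assms(1) homog_neg that[of 0] by auto
next
  case False
  then have "f \<in> homog (int (nat d))" using assms by simp
  from lift_rho[OF this] show ?thesis using that assms(2) False by auto
qed

end

section \<open>Restricting logarithmic vector fields to lines\<close>

text \<open>For a fixed \<open>s\<close> the linear forms \<open>X = form_x s\<close>, \<open>W = form_w s\<close> and \<open>Y = Var 1\<close> are coordinates on
  the dual plane, and \<open>x \<mapsto> x *s pencil_dir s u + pencil_base s v\<close> parametrises the line \<open>Y = u X + v W\<close> by \<open>x = X / W\<close>.
  Every line that avoids the point \<open>X = W = 0\<close> is of this form. A vector field is given by its components
  with respect to \<open>X\<close>, \<open>W\<close> and \<open>Y\<close>, in this order.\<close>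

definition form_x :: "complex \<Rightarrow> poly3" where "form_x s = Var 2 - Const s * Var 1"

text \<open>The centre \<open>X = W = 0\<close> is \<open>(1 : s : s^2)\<close>. It runs through a
  conic as \<open>s\<close> varies, so \<open>s\<close> can be chosen such that finitely many given
  lines avoid it.\<close>

definition form_w :: "complex \<Rightarrow> poly3" where "form_w s = Var 3 - Const (s\<^sup>2) * Var 1"

definition line_form :: "complex \<Rightarrow> complex \<Rightarrow> complex \<Rightarrow> poly3"
  where "line_form s u v = Var 1 - Const u * form_x s - Const v * form_w s"

definition pencil_dir :: "complex \<Rightarrow> complex \<Rightarrow> complex ^ 3"
  where "pencil_dir s u = vector [u, 1 + s * u, s\<^sup>2 * u]"

definition pencil_base :: "complex \<Rightarrow> complex \<Rightarrow> complex ^ 3"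
  where "pencil_base s v = vector [v, s * v, 1 + s\<^sup>2 * v]"

lemma pencil_components [simp]:
  "pencil_dir s u $ 1 = u" "pencil_dir s u $ 2 = 1 + s * u" "pencil_dir s u $ 3 = s\<^sup>2 * u"
  "pencil_base s v $ 1 = v" "pencil_base s v $ 2 = s * v" "pencil_base s v $ 3 = 1 + s\<^sup>2 * v"
  by (simp_all add: pencil_dir_def pencil_base_def vector_3)

abbreviation restr :: "complex \<Rightarrow> complex \<Rightarrow> complex \<Rightarrow> poly3 \<Rightarrow> complex poly"
  where "restr s u v \<equiv> rho (pencil_dir s u) (pencil_base s v)"

lemma forms_homog: "form_x s \<in> homog 1" "form_w s \<in> homog 1" "line_form s u v \<in> homog 1"
  unfolding form_x_def form_w_def line_form_def
  by (intro homog_diff homog_Const_mult homog_Var)+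

lemma restr_forms [simp]:
  "restr s u v (Var 1) = [:v, u:]" "restr s u v (form_x s) = [:0, 1:]" "restr s u v (form_w s) = 1"
  "restr s u v (line_form s \<xi> \<eta>) = [:v - \<eta>, u - \<xi>:]"
  by (simp_all add: form_x_def form_w_def line_form_def pencil_dir_def pencil_base_def vector_3 one_pCons)

lemma Var_eq_forms:
  "Var 2 = form_x s + Const s * Var 1" "Var 3 = form_w s + Const (s\<^sup>2) * Var 1"
  "Var 1 = line_form s u v + Const u * form_x s + Const v * form_w s"
  by (simp_all add: form_x_def form_w_def line_form_def)

lemma form_frame_span:
  assumes "Var 1 = Const c * X + Const e * W + Const g * l"
    "form_x s = Const c' * X + Const e' * W + Const g' * l" "form_w s = Const c'' * X + Const e'' * W + Const g'' * l"
  shows "\<exists>c e g. Var i = Const c * X + Const e * W + Const g * l"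
proof -
  have "Var 2 = Const (c' + s * c) * X + Const (e' + s * e) * W + Const (g' + s * g) * l"
    unfolding Var_eq_forms(1)[of s] assms(1,2) by (simp add: Const_simps algebra_simps)
  moreover have "Var 3 = Const (c'' + s\<^sup>2 * c) * X + Const (e'' + s\<^sup>2 * e) * W + Const (g'' + s\<^sup>2 * g) * l"
    unfolding Var_eq_forms(2)[of s] assms(1,3) by (simp add: Const_simps algebra_simps)
  ultimately show ?thesis using exhaust_3[of i] assms(1) by blast
qed

lemma line_frame_pencil: "line_frame (pencil_dir s u) (pencil_base s v) (line_form s u v) (form_x s) (form_w s)"
proof
  show "\<exists>c e g. Var i = Const c * form_x s + Const e * form_w s + Const g * line_form s u v" for i
    by (rule form_frame_span[of u _ v _ 1 _ s 1 0 0 0 1 0]) (simp_all add: Const_simps line_form_def)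
qed (simp_all add: forms_homog)

text \<open>Together with \<open>infinity_base\<close> this parametrises the line
  \<open>W = 0\<close> by \<open>Y / X\<close>. The vector itself represents the centre
  \<open>X = W = 0\<close>.\<close>

definition infinity_dir :: "complex \<Rightarrow> complex ^ 3" where "infinity_dir s = vector [1, s, s\<^sup>2]"

definition infinity_base :: "complex ^ 3" where "infinity_base = vector [0, 1, 0]"

lemma infinity_components [simp]:
  "infinity_dir s $ 1 = 1" "infinity_dir s $ 2 = s" "infinity_dir s $ 3 = s\<^sup>2"
  "infinity_base $ 1 = 0" "infinity_base $ 2 = 1" "infinity_base $ 3 = 0"
  by (simp_all add: infinity_dir_def infinity_base_def vector_3)

abbreviation restr_infinity :: "complex \<Rightarrow> poly3 \<Rightarrow> complex poly"
  where "restr_infinity s \<equiv> rho (infinity_dir s) infinity_base"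

lemma restr_infinity_forms [simp]:
  "restr_infinity s (Var 1) = [:0, 1:]" "restr_infinity s (form_x s) = 1" "restr_infinity s (form_w s) = 0"
  by (simp_all add: form_x_def form_w_def infinity_dir_def infinity_base_def vector_3 one_pCons)

lemma line_frame_infinity: "line_frame (infinity_dir s) infinity_base (form_w s) (Var 1) (form_x s)"
proof
  show "\<exists>c e g. Var i = Const c * Var 1 + Const e * form_x s + Const g * form_w s" for i
    by (rule form_frame_span[of 1 _ 0 _ 0 _ s 0 1 0 0 0 1]) (simp_all add: Const_simps)
qed (simp_all add: forms_homog)

text \<open>The line \<open>Y = u X + v W\<close> meets \<open>W = 0\<close> where
  \<open>Y / X = u\<close>, and the coefficient of \<open>x ^ d\<close> is the value of the form
  there. In particular it does not depend on \<open>v\<close>.\<close>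

lemma coeff_restr_top:
  assumes "f \<in> homog (int d)"
  shows "coeff (restr s u v f) d = poly (restr_infinity s f) u"
proof -
  have "degree (restr s u v f) \<le> d \<and> coeff (restr s u v f) d = poly (restr_infinity s f) u"
    using assms
  proof (induction rule: homog_induct)
    case (var d i f)
    have dir: "pencil_dir s u $ i = infinity_base $ i + u * infinity_dir s $ i"
      using exhaust_3[of i]
      by (auto simp: pencil_dir_def infinity_dir_def infinity_base_def vector_3 mult.commute)
    have "coeff ([:pencil_base s v $ i, pencil_dir s u $ i:] * restr s u v f) (1 + d)
      = coeff [:pencil_base s v $ i, pencil_dir s u $ i:] 1 * coeff (restr s u v f) d"
      by (rule coeff_mult_degree_bounds) (use var in auto)
    then have "coeff (restr s u v (Var i * f)) (Suc d) = poly (restr_infinity s (Var i * f)) u"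
      using var dir by (simp del: mult_pCons_left)
    moreover have "degree (restr s u v (Var i * f)) \<le> Suc d"
      using var degree_mult_le[of "[:pencil_base s v $ i, pencil_dir s u $ i:]" "restr s u v f"]
      by (simp split: if_splits del: mult_pCons_left)
    ultimately show ?case by blast
  qed (auto intro: degree_add_le)
  then show ?thesis by blast
qed

locale lines =
  fixes s :: complex and I :: "'i set" and \<xi> \<eta> :: "'i \<Rightarrow> complex"
  assumes finite_lines: "finite I" and lines_nonempty: "I \<noteq> {}"
    and distinct_lines: "inj_on (\<lambda>i. (\<xi> i, \<eta> i)) I"
begin

abbreviation "X \<equiv> form_x s"
abbreviation "W \<equiv> form_w s"
abbreviation "on i \<equiv> restr s (\<xi> i) (\<eta> i)"

text \<open>The field maps the equation \<open>Y - \<xi> i X - \<eta> i W\<close> to the displayed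
  combination, so its vanishing on the line is the logarithmic condition.\<close>

definition log_fields :: "int \<Rightarrow> (poly3 \<times> poly3 \<times> poly3) set"
  where "log_fields k = {(FX, FW, FY). FX \<in> homog k \<and> FW \<in> homog k \<and> FY \<in> homog k \<and>
    (\<forall>i\<in>I. on i (FY - Const (\<xi> i) * FX - Const (\<eta> i) * FW) = 0)}"

definition meet :: "complex \<Rightarrow> complex \<Rightarrow> 'i \<Rightarrow> complex"
  where "meet u v i = (v - \<eta> i) / (\<xi> i - u)"

definition general :: "complex \<Rightarrow> complex \<Rightarrow> bool"
  where "general u v \<longleftrightarrow> (\<forall>i\<in>I. u \<noteq> \<xi> i) \<and> inj_on (meet u v) I"

text \<open>The components of a vector field along a line: tangential, and normal in the direction of \<open>Y\<close>.
  Both vanish for multiples of the Euler field.\<close>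

definition along :: "complex \<Rightarrow> complex \<Rightarrow> poly3 \<times> poly3 \<times> poly3 \<Rightarrow> complex poly \<times> complex poly"
  where "along u v = (\<lambda>(FX, FW, FY). (restr s u v FX - [:0, 1:] * restr s u v FW,
    restr s u v FY - [:u:] * restr s u v FX - [:v:] * restr s u v FW))"

lemma meet_eq: "u \<noteq> \<xi> i \<Longrightarrow> (\<xi> i - u) * meet u v i = v - \<eta> i"
  by (simp add: meet_def)

lemma poly_restr_meet:
  assumes "u \<noteq> \<xi> i"
  shows "poly (restr s u v f) (meet u v i) = poly (on i f) (meet u v i)"
proof -
  have "u * meet u v i + v = \<xi> i * meet u v i + \<eta> i"
    using meet_eq[OF assms, of v] by (simp add: algebra_simps)
  then have e: "\<xi> i * meet u v i + \<eta> i = u * meet u v i + v" by simp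
  have "meet u v i *s pencil_dir s u + pencil_base s v = meet u v i *s pencil_dir s (\<xi> i) + pencil_base s (\<eta> i)"
  proof (rule vec_eq_iff[THEN iffD2], rule allI)
    fix j :: 3
    have "s * (\<xi> i * meet u v i + \<eta> i) = s * (u * meet u v i + v)"
      "s\<^sup>2 * (\<xi> i * meet u v i + \<eta> i) = s\<^sup>2 * (u * meet u v i + v)" by (simp_all only: e)
    then show "(meet u v i *s pencil_dir s u + pencil_base s v) $ j
        = (meet u v i *s pencil_dir s (\<xi> i) + pencil_base s (\<eta> i)) $ j"
      using exhaust_3[of j] e by (auto simp: pencil_dir_def pencil_base_def vector_3 algebra_simps)
  qed
  then show ?thesis by (simp add: poly_rho)
qed

lemma tangency_general: "general u v \<Longrightarrow> tangency I (meet u v) (\<lambda>i. \<xi> i - u)"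
  by standard (auto simp: general_def finite_lines lines_nonempty)

text \<open>At the intersection with the \<open>i\<close>-th line \<open>FY\<close> equals
  \<open>\<xi> i FX + \<eta> i FW\<close>. Since \<open>v - \<eta> i = (\<xi> i - u) x\<close>
  there, the normal component becomes \<open>\<xi> i - u\<close> times the tangential one.\<close>

lemma along_fields:
  assumes "general u v" "F \<in> log_fields (int k)"
  shows "along u v F \<in> tangency.fields I (meet u v) (\<lambda>i. \<xi> i - u) k"
proof -
  interpret tangency I "meet u v" "\<lambda>i. \<xi> i - u" using assms(1) by (rule tangency_general)
  obtain FX FW FY where F: "F = (FX, FW, FY)" by (cases F)
  have h: "FX \<in> homog (int k)" "FW \<in> homog (int k)" "FY \<in> homog (int k)"
    and t: "\<And>i. i \<in> I \<Longrightarrow> on i (FY - Const (\<xi> i) * FX - Const (\<eta> i) * FW) = 0"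
    using assms(2) by (auto simp: F log_fields_def)
  have d: "degree (restr s u v FX) \<le> k" "degree (restr s u v FW) \<le> k" "degree (restr s u v FY) \<le> k"
    using degree_rho h by blast+
  have "degree (restr s u v FX - [:0, 1:] * restr s u v FW) \<le> k + 1"
    using d degree_mult_le[of "[:0, 1:]" "restr s u v FW"] by (intro degree_diff_le) (auto simp del: mult_pCons_left)
  moreover have "degree (restr s u v FY - [:u:] * restr s u v FX - [:v:] * restr s u v FW) \<le> k"
    using d by (intro degree_diff_le) (auto intro: order_trans[OF degree_smult_le])
  moreover have "poly (restr s u v FY - [:u:] * restr s u v FX - [:v:] * restr s u v FW) (meet u v i)
      = (\<xi> i - u) * poly (restr s u v FX - [:0, 1:] * restr s u v FW) (meet u v i)" if "i \<in> I" for i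
  proof -
    have u: "u \<noteq> \<xi> i" using assms(1) that by (auto simp: general_def)
    have "poly (restr s u v (FY - Const (\<xi> i) * FX - Const (\<eta> i) * FW)) (meet u v i) = 0"
      unfolding poly_restr_meet[OF u] t[OF that] by simp
    then have "poly (restr s u v FY) (meet u v i) = \<xi> i * poly (restr s u v FX) (meet u v i)
        + \<eta> i * poly (restr s u v FW) (meet u v i)" by (simp add: algebra_simps)
    moreover have "v * poly (restr s u v FW) (meet u v i)
        = (\<eta> i + (\<xi> i - u) * meet u v i) * poly (restr s u v FW) (meet u v i)"
      using meet_eq[OF u, of v] by simp
    ultimately show ?thesis
      by (simp only: poly_diff poly_mult) (simp add: algebra_simps)
  qed
  ultimately show ?thesis by (simp add: F along_def fields_def)
qed

text \<open>Both components vanish iff the field is proportional to the Euler field along the line.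
  Subtracting \<open>h\<close> times the Euler field makes it divisible by the equation of the line.
  The quotient stays logarithmic, as this equation is not identically zero on any line of the
  arrangement.\<close>

lemma along_kernel:
  assumes "general u v" "(FX, FW, FY) \<in> log_fields k" "along u v (FX, FW, FY) = (0, 0)"
  obtains h GX GW GY where "h \<in> homog (k - 1)" "(GX, GW, GY) \<in> log_fields (k - 1)"
    "FX = X * h + line_form s u v * GX" "FW = W * h + line_form s u v * GW" "FY = Var 1 * h + line_form s u v * GY"
proof -
  interpret line_frame "pencil_dir s u" "pencil_base s v" "line_form s u v" X W by (rule line_frame_pencil)
  have hF: "FX \<in> homog k" "FW \<in> homog k" "FY \<in> homog k"
    and t: "\<And>i. i \<in> I \<Longrightarrow> on i (FY - Const (\<xi> i) * FX - Const (\<eta> i) * FW) = 0"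
    using assms(2) by (auto simp: log_fields_def)
  define p where "p = restr s u v FW"
  have rX: "restr s u v FX = [:0, 1:] * p" using assms(3) by (simp add: along_def p_def)
  have rY: "restr s u v FY = [:v, u:] * p"
    using assms(3) rX by (simp add: along_def p_def[symmetric] algebra_simps)
  \<comment> \<open>Because \<open>x p\<close> is the restriction of \<open>FX\<close>,
    \<open>p\<close> has degree at most \<open>k - 1\<close>, one less than \<open>FW\<close> alone
    would give.\<close>
  have "\<exists>h\<in>homog (k - 1). restr s u v h = p"
  proof (cases "p = 0")
    case True
    then show ?thesis by (intro bexI[of _ 0]) auto
  next
    case False
    then have "FW \<noteq> 0" by (auto simp: p_def)
    then have k: "k = int (nat k)" using hF homog_neg by fastforce
    have "degree (restr s u v FX) = degree p + 1" unfolding rX using False by simp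
    moreover have "degree (restr s u v FX) \<le> nat k" using degree_rho hF k by metis
    ultimately have "degree p \<le> nat k - 1" "k - 1 = int (nat k - 1)" by auto
    then show ?thesis using rho_lift[of p "nat k - 1"] lift_homog[of "nat k - 1" p] by metis
  qed
  then obtain h where h: "h \<in> homog (k - 1)" "restr s u v h = p" by blast
  have "X * h \<in> homog k" "W * h \<in> homog k" "Var 1 * h \<in> homog k"
    using h(1) forms_homog by (auto intro: homog_mult'[OF _ h(1), of _ 1])
  then have "FX - X * h \<in> homog k" "FW - W * h \<in> homog k" "FY - Var 1 * h \<in> homog k"
    using hF by (auto intro: homog_diff)
  moreover have "restr s u v (FX - X * h) = 0" "restr s u v (FW - W * h) = 0" "restr s u v (FY - Var 1 * h) = 0"
    using h rX rY by (simp_all add: p_def del: mult_pCons_left)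
  ultimately obtain GX GW GY where G: "GX \<in> homog (k - 1)" "FX - X * h = line_form s u v * GX"
    "GW \<in> homog (k - 1)" "FW - W * h = line_form s u v * GW"
    "GY \<in> homog (k - 1)" "FY - Var 1 * h = line_form s u v * GY"
    by (metis rho_eq_0_imp_multiple)
  have "on i (GY - Const (\<xi> i) * GX - Const (\<eta> i) * GW) = 0" if "i \<in> I" for i
  proof -
    have "line_form s u v * (GY - Const (\<xi> i) * GX - Const (\<eta> i) * GW)
      = (FY - Var 1 * h) - Const (\<xi> i) * (FX - X * h) - Const (\<eta> i) * (FW - W * h)"
      unfolding G by (simp add: algebra_simps)
    also have "\<dots> = (FY - Const (\<xi> i) * FX - Const (\<eta> i) * FW) - line_form s (\<xi> i) (\<eta> i) * h"
      by (simp add: line_form_def algebra_simps)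
    finally have "on i (line_form s u v) * on i (GY - Const (\<xi> i) * GX - Const (\<eta> i) * GW)
      = on i (FY - Const (\<xi> i) * FX - Const (\<eta> i) * FW) - on i (line_form s (\<xi> i) (\<eta> i)) * on i h"
      by (metis rho_simps(5,7))
    also have "\<dots> = 0" unfolding t[OF that] by simp
    finally have "on i (line_form s u v) * on i (GY - Const (\<xi> i) * GX - Const (\<eta> i) * GW) = 0" .
    moreover have "on i (line_form s u v) \<noteq> 0"
      using assms(1) that by (auto simp: general_def)
    ultimately show ?thesis by (metis mult_eq_0_iff)
  qed
  then have "(GX, GW, GY) \<in> log_fields (k - 1)" using G by (simp add: log_fields_def)
  moreover have "FX = X * h + line_form s u v * GX" "FW = W * h + line_form s u v * GW"
    "FY = Var 1 * h + line_form s u v * GY"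
    by (simp_all only: G(2,4,6)[symmetric]) simp_all
  ultimately show thesis using that h(1) by blast
qed

text \<open>\<open>FX\<close> and \<open>FW\<close> are chosen to give the tangential part.
  \<open>FY\<close> is then prescribed on two lines, the given one by \<open>n\<close> and the
  \<open>i\<close>-th one by tangency. The tangency condition at their common point makes the two
  prescriptions compatible.\<close>

lemma lift_field_one_line:
  assumes "general u v" "i \<in> I" "(A, n) \<in> tangency.fields I (meet u v) (\<lambda>i. \<xi> i - u) k"
  shows "\<exists>FX FW FY. FX \<in> homog (int k) \<and> FW \<in> homog (int k) \<and> FY \<in> homog (int k) \<and>
    on i (FY - Const (\<xi> i) * FX - Const (\<eta> i) * FW) = 0 \<and> along u v (FX, FW, FY) = (A, n)"
proof -
  interpret tangency I "meet u v" "\<lambda>i. \<xi> i - u" using assms(1) by (rule tangency_general)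
  interpret line_frame "pencil_dir s u" "pencil_base s v" "line_form s u v" X W by (rule line_frame_pencil)
  have d: "degree A \<le> k + 1" "degree n \<le> k" and t: "poly n (meet u v i) = (\<xi> i - u) * poly A (meet u v i)"
    using assms(2,3) by (auto simp: fields_def)
  have u: "u \<noteq> \<xi> i" using assms(1,2) by (auto simp: general_def)
  \<comment> \<open>\<open>A\<close> may have degree \<open>k + 1\<close>, but restrictions of forms
    of degree \<open>k\<close> do not. \<open>FW = w\<close> absorbs the top coefficient.\<close>
  define w where "w = - monom (coeff A (k + 1)) k"
  define A' where "A' = A + [:0, 1:] * w"
  have dw: "degree w \<le> k" by (simp add: w_def degree_monom_le)
  have dA': "degree A' \<le> k"
  proof (rule degree_le_if_coeff_zero)
    show "degree A' \<le> Suc k"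
      unfolding A'_def using d dw by (auto intro!: degree_add_le order_trans[OF degree_pCons_le])
    show "coeff A' (Suc k) = 0" by (simp add: A'_def w_def)
  qed
  \<comment> \<open>What \<open>FY\<close> must add, along the given line, to the part forced by the
    \<open>i\<close>-th line. It vanishes at the common point and is therefore the restriction of a
    multiple of the equation of the \<open>i\<close>-th line.\<close>
  define r where "r = n - Polynomial.smult (\<xi> i - u) A' - Polynomial.smult (\<eta> i - v) w"
  have dr: "degree r \<le> k"
    unfolding r_def using d dw dA' by (intro degree_diff_le order_trans[OF degree_smult_le])
  have "poly r (meet u v i) = - poly w (meet u v i) * ((\<xi> i - u) * meet u v i - (v - \<eta> i))"
    unfolding r_def A'_def using t by (simp add: algebra_simps)
  also have "\<dots> = 0" using meet_eq[OF u] by simp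
  finally obtain h where h: "r = [:- meet u v i, 1:] * h" by (auto simp: poly_eq_0_iff_dvd)
  have dh: "\<exists>H. H \<in> homog (int k - 1) \<and> restr s u v H = h"
  proof (cases "h = 0")
    case True
    then show ?thesis by (intro exI[of _ 0]) auto
  next
    case False
    then have "degree r = 1 + degree h" unfolding h by (subst degree_mult_eq) auto
    then have "degree h \<le> k - 1" "int k - 1 = int (k - 1)" using dr by auto
    then show ?thesis using rho_lift[of h "k - 1"] lift_homog[of "k - 1" h] by metis
  qed
  then obtain H where H: "H \<in> homog (int k - 1)" "restr s u v H = h" by blast
  define FX where "FX = lift k A'"
  define FW where "FW = lift k w"
  define FY where "FY = Const (\<xi> i) * FX + Const (\<eta> i) * FW + Const (1 / (u - \<xi> i)) * (line_form s (\<xi> i) (\<eta> i) * H)"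
  have FXW: "FX \<in> homog (int k)" "FW \<in> homog (int k)" by (simp_all add: FX_def FW_def lift_homog)
  have "line_form s (\<xi> i) (\<eta> i) * H \<in> homog (int k)" using homog_mult[OF forms_homog(3) H(1)] by simp
  then have "FY \<in> homog (int k)" unfolding FY_def using FXW by (intro homog_add homog_Const_mult)
  moreover have "on i (FY - Const (\<xi> i) * FX - Const (\<eta> i) * FW) = 0" by (simp add: FY_def)
  moreover have "along u v (FX, FW, FY) = (A, n)"
  proof -
    have rX: "restr s u v FX = A'" "restr s u v FW = w" using rho_lift dA' dw by (simp_all add: FX_def FW_def)
    have lf: "restr s u v (line_form s (\<xi> i) (\<eta> i)) = Polynomial.smult (u - \<xi> i) [:- meet u v i, 1:]"
      using meet_eq[OF u, of v] by (simp add: algebra_simps)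
    have "restr s u v FY = Polynomial.smult (\<xi> i) A' + Polynomial.smult (\<eta> i) w + r"
      unfolding FY_def rho_simps lf rX H(2) h using u by (simp add: smult_diff_right)
    then show ?thesis unfolding along_def by (simp add: rX) (simp add: r_def A'_def smult_diff_left)
  qed
  ultimately show ?thesis using FXW by blast
qed

lemma along_combination:
  "along u v (\<Sum>i\<in>J. f i * FX i, \<Sum>i\<in>J. f i * FW i, \<Sum>i\<in>J. f i * FY i)
    = (\<Sum>i\<in>J. restr s u v (f i) * fst (along u v (FX i, FW i, FY i)),
       \<Sum>i\<in>J. restr s u v (f i) * snd (along u v (FX i, FW i, FY i)))"
  by (simp add: along_def rho_sum sum_distrib_left sum_subtractf right_diff_distrib ac_simps
      del: mult_pCons_left mult_pCons_right)

text \<open>The \<open>i\<close>-th Lagrange polynomial is the restriction of the product of the equations of the other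
  lines, so a multiple of it lifts as soon as one lifts a field tangent to the \<open>i\<close>-th line only.\<close>

lemma multiple_in_image:
  assumes "general u v" "(A, n) \<in> tangency.fields I (meet u v) (\<lambda>i. \<xi> i - u) k"
    "degree q \<le> N" "card I \<le> N + 1"
  shows "\<exists>F\<in>log_fields (int (k + N)). along u v F = (q * A, q * n)"
proof -
  interpret tangency I "meet u v" "\<lambda>i. \<xi> i - u" using assms(1) by (rule tangency_general)
  obtain c where c: "q = (\<Sum>i\<in>I. lagrange_basis I (meet u v) i * c i)"
    "\<And>i. i \<in> I \<Longrightarrow> degree (c i) + (card I - 1) \<le> N"
    using lagrange_basis_decomposition[OF finite_I inj_x I_nonempty assms(3,4)] by blast
  \<comment> \<open>The factors \<open>c i\<close> raise the degree of a pair to at most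
    \<open>K\<close>; the product of the other \<open>card I - 1\<close> equations then brings it to
    \<open>k + N\<close>.\<close>
  define K where "K = k + (N - (card I - 1))"
  have card: "card I \<ge> 1" using finite_lines lines_nonempty by (simp add: Suc_le_eq card_gt_0_iff)
  have "(c i * A, c i * n) \<in> fields K" if "i \<in> I" for i
    unfolding K_def by (rule fields_mult[OF assms(2)]) (use c(2)[OF that] in linarith)
  then have "\<forall>i\<in>I. \<exists>FX FW FY. FX \<in> homog (int K) \<and> FW \<in> homog (int K) \<and> FY \<in> homog (int K) \<and>
    on i (FY - Const (\<xi> i) * FX - Const (\<eta> i) * FW) = 0 \<and> along u v (FX, FW, FY) = (c i * A, c i * n)"
    using lift_field_one_line[OF assms(1)] by blast
  then obtain FX FW FY where F: "\<And>i. i \<in> I \<Longrightarrow> FX i \<in> homog (int K)" "\<And>i. i \<in> I \<Longrightarrow> FW i \<in> homog (int K)"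
    "\<And>i. i \<in> I \<Longrightarrow> FY i \<in> homog (int K)"
    "\<And>i. i \<in> I \<Longrightarrow> on i (FY i - Const (\<xi> i) * FX i - Const (\<eta> i) * FW i) = 0"
    "\<And>i. i \<in> I \<Longrightarrow> along u v (FX i, FW i, FY i) = (c i * A, c i * n)"
    by metis
  define g where "g i = (\<Prod>j\<in>I - {i}. u - \<xi> j)" for i
  define f where "f i = Const (1 / g i) * (\<Prod>j\<in>I - {i}. line_form s (\<xi> j) (\<eta> j))" for i
  have f_homog: "f i \<in> homog (int (card I - 1))" if "i \<in> I" for i
    unfolding f_def using homog_prod[of "I - {i}" "\<lambda>j. line_form s (\<xi> j) (\<eta> j)"] forms_homog(3) finite_lines that
    by (intro homog_Const_mult) simp
  have f_on: "on j (f i) = 0" if "j \<in> I" "j \<noteq> i" for i j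
  proof -
    have "(\<Prod>j'\<in>I - {i}. on j (line_form s (\<xi> j') (\<eta> j'))) = 0"
      by (rule prod_zero) (use that finite_lines in auto)
    then show ?thesis by (simp add: f_def rho_prod del: restr_forms)
  qed
  have f_restr: "restr s u v (f i) = lagrange_basis I (meet u v) i" for i
  proof -
    have "restr s u v (line_form s (\<xi> j) (\<eta> j)) = [:u - \<xi> j:] * [:- meet u v j, 1:]" if "j \<in> I - {i}" for j
      using meet_eq[of u j v] assms(1) that by (simp add: general_def algebra_simps)
    then have "(\<Prod>j\<in>I - {i}. restr s u v (line_form s (\<xi> j) (\<eta> j)))
        = (\<Prod>j\<in>I - {i}. [:u - \<xi> j:]) * lagrange_basis I (meet u v) i"
      unfolding lagrange_basis_def prod.distrib[symmetric] by (intro prod.cong) auto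
    moreover have "(\<Prod>j\<in>I - {i}. [:u - \<xi> j:]) = [:g i:]"
      unfolding g_def by (induction "I - {i}" rule: infinite_finite_induct) (simp_all add: one_pCons prod_to_poly)
    moreover have "g i \<noteq> 0" unfolding g_def using assms(1) finite_lines by (auto simp: general_def)
    ultimately show ?thesis by (simp add: f_def rho_prod del: restr_forms)
  qed
  define G where "G = (\<Sum>i\<in>I. f i * FX i, \<Sum>i\<in>I. f i * FW i, \<Sum>i\<in>I. f i * FY i)"
  have KN: "int (k + N) = int (card I - 1) + int K"
  proof -
    obtain i where "i \<in> I" using lines_nonempty by blast
    then show ?thesis using c(2)[of i] by (simp add: K_def)
  qed
  \<comment> \<open>On the \<open>j\<close>-th line every \<open>f i\<close> with
    \<open>i \<noteq> j\<close> vanishes, and the remaining summand is tangent to it.\<close>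
  have "on j ((\<Sum>i\<in>I. f i * FY i) - Const (\<xi> j) * (\<Sum>i\<in>I. f i * FX i) - Const (\<eta> j) * (\<Sum>i\<in>I. f i * FW i)) = 0"
    if "j \<in> I" for j
  proof -
    have "(\<Sum>i\<in>I. f i * FY i) - Const (\<xi> j) * (\<Sum>i\<in>I. f i * FX i) - Const (\<eta> j) * (\<Sum>i\<in>I. f i * FW i)
      = (\<Sum>i\<in>I. f i * (FY i - Const (\<xi> j) * FX i - Const (\<eta> j) * FW i))"
      by (simp add: sum_distrib_left sum_subtractf right_diff_distrib ac_simps)
    moreover have "on j (f i) * on j (FY i - Const (\<xi> j) * FX i - Const (\<eta> j) * FW i) = 0" if "i \<in> I" for i
    proof (cases "i = j")
      case True
      then show ?thesis by (simp only: F(4)[OF \<open>j \<in> I\<close>] mult_zero_right)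
    next
      case False
      then have "on j (f i) = 0" by (intro f_on \<open>j \<in> I\<close>) simp
      then show ?thesis by (simp only: mult_zero_left)
    qed
    ultimately show ?thesis by (simp only: rho_sum rho_simps(7)) (simp add: sum.neutral del: rho_simps)
  qed
  moreover have "(\<Sum>i\<in>I. f i * FX i) \<in> homog (int (k + N))" "(\<Sum>i\<in>I. f i * FW i) \<in> homog (int (k + N))"
    "(\<Sum>i\<in>I. f i * FY i) \<in> homog (int (k + N))"
    unfolding KN by (intro homog_sum homog_mult f_homog F; assumption)+
  ultimately have "G \<in> log_fields (int (k + N))" by (simp add: G_def log_fields_def)
  moreover have "along u v G = (q * A, q * n)"
    unfolding G_def along_combination
    by (simp add: F(5) f_restr c(1) sum_distrib_right mult.assoc cong: sum.cong)
  ultimately show ?thesis by blast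
qed

end

section \<open>Global vector fields from families along lines\<close>

text \<open>\<open>p\<close> is a polynomial in the affine coordinates \<open>X / W\<close> and
  \<open>Y / W\<close>, and \<open>[:v, u:]\<close> substitutes \<open>y = u x + v\<close>. All
  large degrees are covered because the summands of the induction step must meet in one
  degree.\<close>

lemma homogenization:
  "\<exists>N\<^sub>0. \<forall>N\<ge>N\<^sub>0. \<exists>P\<in>homog (int N). \<forall>u v. restr s u v P = poly p [:v, u:]"
proof (induction p)
  case 0
  show ?case by (intro exI[of _ 0] allI impI bexI[of _ 0]) auto
next
  case (pCons a p)
  then obtain N\<^sub>0 where N\<^sub>0: "\<And>N. N \<ge> N\<^sub>0 \<Longrightarrow> \<exists>P\<in>homog (int N). \<forall>u v. restr s u v P = poly p [:v, u:]"
    by blast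
  show ?case
  proof (intro exI[of _ "Suc N\<^sub>0 + degree a"] allI impI)
    fix N assume N: "Suc N\<^sub>0 + degree a \<le> N"
    then obtain P where P: "P \<in> homog (int (N - 1))" "\<And>u v. restr s u v P = poly p [:v, u:]"
      using N\<^sub>0[of "N - 1"] by fastforce
    define Q where "Q = line_frame.lift (form_x s) (form_w s) N a + Var 1 * P"
    have "Var 1 * P \<in> homog (int N)" using homog_mult[OF homog_Var P(1), of 1] N by simp
    then have "Q \<in> homog (int N)"
      unfolding Q_def using line_frame.lift_homog[OF line_frame_pencil, of s N a] by (intro homog_add)
    moreover have "restr s u v Q = poly (pCons a p) [:v, u:]" for u v
      using line_frame.rho_lift[OF line_frame_pencil, of a N s u v] N by (simp add: Q_def P(2))
    ultimately show "\<exists>P\<in>homog (int N). \<forall>u v. restr s u v P = poly (pCons a p) [:v, u:]" by blast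
  qed
qed

lemma poly_zero_if_cofinite:
  fixes p :: "complex poly"
  assumes "finite B" "\<And>u. u \<notin> B \<Longrightarrow> poly p u = 0"
  shows "p = 0"
proof (rule ccontr)
  assume "p \<noteq> 0"
  then have "finite ({u. poly p u = 0} \<union> B)" using assms(1) poly_roots_finite by auto
  moreover have "{u. poly p u = 0} \<union> B = UNIV" using assms(2) by auto
  ultimately show False using infinite_UNIV_char_0 by metis
qed

lemma divide_by_infinity:
  assumes "P \<in> homog (int N)" "restr_infinity s P = 0"
  shows "\<exists>P'\<in>homog (int N - 1). P = form_w s * P'"
  using line_frame.rho_eq_0_imp_multiple[OF line_frame_infinity assms] by metis

text \<open>A form of too high degree that represents \<open>p\<close> has zero top coefficient
  along some line of almost every slope. So it vanishes at almost all points of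
  \<open>W = 0\<close>, hence is divisible by \<open>W\<close>, and its degree descends to
  \<open>d\<close>. One \<open>v\<close> per slope is enough because the top coefficient does not
  depend on \<open>v\<close>.\<close>

lemma bounded_homogenization:
  assumes B: "finite B"
    and deg: "\<And>u. u \<notin> B \<Longrightarrow> \<exists>v. degree (poly p [:v, u:]) \<le> d"
  shows "\<exists>P\<in>homog (int d). \<forall>u v. restr s u v P = poly p [:v, u:]"
proof -
  obtain N\<^sub>0 where N\<^sub>0: "\<And>N. N \<ge> N\<^sub>0 \<Longrightarrow> \<exists>P\<in>homog (int N). \<forall>u v. restr s u v P = poly p [:v, u:]"
    using homogenization[of s p] by blast
  have "\<exists>P\<in>homog (int (d + m)). \<forall>u v. restr s u v P = poly p [:v, u:]" if "m \<le> N\<^sub>0" for m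
    using that
  proof (induction rule: inc_induct)
    case base
    show ?case by (rule N\<^sub>0) simp
  next
    case (step m)
    then obtain P where P: "P \<in> homog (int (d + Suc m))" "\<And>u v. restr s u v P = poly p [:v, u:]" by blast
    have "restr_infinity s P = 0"
    proof (rule poly_zero_if_cofinite[OF B])
      fix u assume "u \<notin> B"
      then obtain v where "degree (poly p [:v, u:]) \<le> d" using deg by blast
      then show "poly (restr_infinity s P) u = 0"
        unfolding coeff_restr_top[OF P(1), of s u v, symmetric] P(2) by (intro coeff_eq_0) simp
    qed
    from divide_by_infinity[OF P(1) this]
    obtain P' where P': "P' \<in> homog (int (d + m))" "P = form_w s * P'" by auto
    have "restr s u v P' = poly p [:v, u:]" for u v using P(2)[of u v] unfolding P'(2) by simp
    then show ?case using P'(1) by blast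
  qed
  from this[of 0] show ?thesis by simp
qed

context lines
begin

text \<open>The affine field \<open>(A, B)\<close> homogenises in degree \<open>e + 1\<close>. The
  bound \<open>e\<close> on its normal component says that on \<open>W = 0\<close> it is a multiple
  of the Euler field. Subtracting such a multiple and dividing by \<open>W\<close> lowers the degree
  to \<open>e\<close>.\<close>

lemma global_field:
  assumes AB: "A \<noteq> 0 \<or> B \<noteq> 0"
    and tangent: "\<And>i. i \<in> I \<Longrightarrow> poly (B - Polynomial.smult [:\<xi> i:] A) [:\<eta> i, \<xi> i:] = 0"
    and fin: "finite {u. \<not> (\<exists>v. degree (poly A [:v, u:]) \<le> e + 1 \<and>
      degree (poly B [:v, u:] - Polynomial.smult u (poly A [:v, u:])) \<le> e)}" (is "finite ?bad")
  shows "\<exists>FX FW FY. (FX, FW, FY) \<in> log_fields (int e) \<and> (\<nexists>g. FX = X * g \<and> FW = W * g \<and> FY = Var 1 * g)"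
proof -
  have degB: "degree b \<le> e + 1" if "degree a \<le> e + 1" "degree (b - Polynomial.smult u a) \<le> e"
    for a b :: "complex poly" and u
  proof -
    have "degree ((b - Polynomial.smult u a) + Polynomial.smult u a) \<le> e + 1"
      using that by (intro degree_add_le order_trans[OF degree_smult_le]) auto
    then show ?thesis by simp
  qed
  obtain P where P: "P \<in> homog (int (e + 1))" "\<And>u v. restr s u v P = poly A [:v, u:]"
    using bounded_homogenization[OF fin, of A "e + 1" s] by auto
  have "\<exists>v. degree (poly B [:v, u:]) \<le> e + 1" if "u \<notin> ?bad" for u
    using that degB by blast
  then obtain Q where Q: "Q \<in> homog (int (e + 1))" "\<And>u v. restr s u v Q = poly B [:v, u:]"
    using bounded_homogenization[OF fin, of B "e + 1" s] by auto
  define p where "p = restr_infinity s P"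
  \<comment> \<open>On \<open>W = 0\<close> the form \<open>Q\<close> is \<open>Y / X\<close> times
    \<open>P\<close>: at slope \<open>u\<close> this is the vanishing of the coefficient of degree
    \<open>e + 1\<close> in \<open>B - u A\<close>.\<close>
  have "restr_infinity s Q - [:0, 1:] * p = 0"
  proof (rule poly_zero_if_cofinite[OF fin])
    fix u assume "u \<notin> ?bad"
    then obtain v where v: "degree (poly B [:v, u:] - Polynomial.smult u (poly A [:v, u:])) \<le> e" by blast
    have "poly (restr_infinity s Q) u - u * poly p u
      = coeff (poly B [:v, u:] - Polynomial.smult u (poly A [:v, u:])) (e + 1)"
      using coeff_restr_top[OF P(1), of s u v] coeff_restr_top[OF Q(1), of s u v] by (simp add: P Q p_def)
    also have "\<dots> = 0" using v by (intro coeff_eq_0) simp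
    finally show "poly (restr_infinity s Q - [:0, 1:] * p) u = 0" by simp
  qed
  then have rQ: "restr_infinity s Q = [:0, 1:] * p" by simp
  have dp: "degree p \<le> e"
  proof (cases "p = 0")
    case False
    have "degree (restr_infinity s Q) = degree p + 1" unfolding rQ using False by simp
    then show ?thesis using degree_rho[OF Q(1), of "infinity_dir s" infinity_base] by simp
  qed simp
  define h where "h = line_frame.lift (Var 1) (form_x s) e p"
  have h: "h \<in> homog (int e)" "restr_infinity s h = p"
    using line_frame.lift_homog[OF line_frame_infinity, of s e p]
      line_frame.rho_lift[OF line_frame_infinity dp, of s] by (simp_all add: h_def)
  have Xh: "X * h \<in> homog (int (e + 1))" "Var 1 * h \<in> homog (int (e + 1))"
    using homog_mult[OF forms_homog(1) h(1)] homog_mult[OF homog_Var h(1), of 1] by (simp_all add: add.commute)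
  have zP: "restr_infinity s (P - X * h) = 0" by (simp add: h p_def)
  obtain FX where FX: "FX \<in> homog (int e)" "P - X * h = W * FX"
    using divide_by_infinity[OF homog_diff[OF P(1) Xh(1)] zP] by auto
  have zQ: "restr_infinity s (Q - Var 1 * h) = 0" by (simp add: h rQ)
  obtain FY where FY: "FY \<in> homog (int e)" "Q - Var 1 * h = W * FY"
    using divide_by_infinity[OF homog_diff[OF Q(1) Xh(2)] zQ] by auto
  \<comment> \<open>The \<open>W\<close>-component is \<open>0\<close> for the affine field, becomes
    \<open>- W h\<close> on subtracting \<open>h\<close> times the Euler field, and is then divided
    by \<open>W\<close>.\<close>
  define FW where "FW = - h"
  have "on i (FY - Const (\<xi> i) * FX - Const (\<eta> i) * FW) = 0" if "i \<in> I" for i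
  proof -
    have "W * (FY - Const (\<xi> i) * FX - Const (\<eta> i) * FW) = W * FY - Const (\<xi> i) * (W * FX) + Const (\<eta> i) * (W * h)"
      by (simp add: FW_def algebra_simps)
    also have "\<dots> = Q - Const (\<xi> i) * P - line_form s (\<xi> i) (\<eta> i) * h"
      unfolding FX(2)[symmetric] FY(2)[symmetric] by (simp add: line_form_def algebra_simps)
    finally have "on i W * on i (FY - Const (\<xi> i) * FX - Const (\<eta> i) * FW)
      = on i (Q - Const (\<xi> i) * P - line_form s (\<xi> i) (\<eta> i) * h)"
      by (simp only: rho_simps(7)[symmetric])
    also have "\<dots> = 0" using tangent[OF that] by (simp add: P(2) Q(2))
    finally show ?thesis by (simp only: restr_forms mult_1_left)
  qed
  moreover have "FW \<in> homog (int e)" using homog_uminus[OF h(1)] by (simp add: FW_def)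
  ultimately have "(FX, FW, FY) \<in> log_fields (int e)"
    using FX(1) FY(1) unfolding log_fields_def by blast
  moreover have False if g: "FX = X * g" "FW = W * g" "FY = Var 1 * g" for g
  proof -
    have "h = - (W * g)" using g(2) FW_def by (metis minus_minus)
    then have "P = 0" "Q = 0" using FX(2) FY(2) g(1,3) by (simp_all add: ac_simps)
    then have "poly A [:v, u:] = 0" "poly B [:v, u:] = 0" for u v using P(2)[of u v] Q(2)[of u v] by simp_all
    then have "eval2 A x y = 0" "eval2 B x y = 0" for x y
      using poly_poly_line[of A "y - x" 1 x] poly_poly_line[of B "y - x" 1 x] by simp_all
    then have "A = 0" "B = 0" by (auto intro: eval2_eq_0)
    then show False using AB by simp
  qed
  ultimately show ?thesis by blast
qed

theorem global_field_or_generic_zero: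
  assumes "2 * e + 3 \<le> card I"
  shows "(\<exists>FX FW FY. (FX, FW, FY) \<in> log_fields (int e) \<and> (\<nexists>g. FX = X * g \<and> FW = W * g \<and> FY = Var 1 * g)) \<or>
    (\<exists>q. q \<noteq> 0 \<and> (\<forall>u v. eval2 q u v \<noteq> 0 \<longrightarrow> general u v \<longrightarrow>
      tangency.fields I (meet u v) (\<lambda>i. \<xi> i - u) e = {(0, 0)}))"
  using tangent_family_or_generic_zero[OF finite_lines, where e = e and \<xi> = \<xi> and \<eta> = \<eta>]
proof (elim disjE exE conjE, goal_cases)
  \<comment> \<open>The first two cases are the two ways in which a family can be nonzero: through
    its tangential or its normal coefficients.\<close>
  case (1 a b)
  have "\<exists>A B. (A \<noteq> 0 \<or> B \<noteq> 0) \<and> (\<forall>i\<in>I. poly (B - Polynomial.smult [:\<xi> i:] A) [:\<eta> i, \<xi> i:] = 0) \<and>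
    finite {u. \<not> (\<exists>v. degree (poly A [:v, u:]) \<le> e + 1 \<and>
      degree (poly B [:v, u:] - Polynomial.smult u (poly A [:v, u:])) \<le> e)}"
    by (rule tangent_family_constant_direction[OF finite_lines distinct_lines assms, of a b]) (use 1 in auto)
  then show ?case using global_field by blast
next
  case (2 a b)
  have "\<exists>A B. (A \<noteq> 0 \<or> B \<noteq> 0) \<and> (\<forall>i\<in>I. poly (B - Polynomial.smult [:\<xi> i:] A) [:\<eta> i, \<xi> i:] = 0) \<and>
    finite {u. \<not> (\<exists>v. degree (poly A [:v, u:]) \<le> e + 1 \<and>
      degree (poly B [:v, u:] - Polynomial.smult u (poly A [:v, u:])) \<le> e)}"
    by (rule tangent_family_constant_direction[OF finite_lines distinct_lines assms, of a b]) (use 2 in auto)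
  then show ?case using global_field by blast
next
  case (3 q)
  have "tangency.fields I (meet u v) (\<lambda>i. \<xi> i - u) e = {(0, 0)}"
    if uv: "eval2 q u v \<noteq> 0" "general u v" for u v
  proof -
    interpret tangency I "meet u v" "\<lambda>i. \<xi> i - u" using uv(2) by (rule tangency_general)
    have "(A, n) = (0, 0)" if "(A, n) \<in> fields e" for A n
    proof -
      have "\<forall>i\<in>I. u \<noteq> \<xi> i" using uv(2) by (simp add: general_def)
      moreover have "degree A \<le> e + 1" "degree n \<le> e"
        "\<forall>i\<in>I. poly n ((v - \<eta> i) / (\<xi> i - u)) = (\<xi> i - u) * poly A ((v - \<eta> i) / (\<xi> i - u))"
        using that by (auto simp: fields_def meet_def)
      ultimately have "A = 0 \<and> n = 0" using 3(2)[rule_format, OF uv(1)] by blast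
      then show ?thesis by simp
    qed
    then show ?thesis using fields_zero by auto
  qed
  then show ?case using 3(1) by blast
qed

lemma generic_general: "\<exists>q. q \<noteq> 0 \<and> (\<forall>u v. eval2 q u v \<noteq> 0 \<longrightarrow> general u v)"
proof -
  obtain q where "q \<noteq> 0" "\<And>u v i. eval2 q u v \<noteq> 0 \<Longrightarrow> i \<in> I \<Longrightarrow> u \<noteq> \<xi> i"
    "\<And>u v. eval2 q u v \<noteq> 0 \<Longrightarrow> inj_on (\<lambda>i. (v - \<eta> i) / (\<xi> i - u)) I"
    using generic_intersections[OF finite_lines distinct_lines] by blast
  then show ?thesis unfolding general_def meet_def[abs_def] by (intro exI[of _ q]) blast
qed

end

lemma to_fract_power: "to_fract (x ^ n) = to_fract x ^ n"
  by (induction n) auto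

section \<open>Localisation and restriction of graded modules\<close>

text \<open>What the comparison of sheaves needs of a graded module and a line: the module axioms
  and a map \<open>ev\<close> into pairs of polynomials whose kernel in each degree consists of
  multiples of \<open>l\<close>. The image of \<open>ev\<close> is left open; it is determined
  separately for \<open>S(n)\<close> and for \<open>D_0\<close>.\<close>

locale restricted_module = line_frame a b l X W
  for a b :: "complex ^ 3" and l X W :: poly3 +
  fixes M :: "(poly3, 'b) graded_module" and ev :: "'b \<Rightarrow> complex poly \<times> complex poly"
    and L :: "(complex ^ 3) set set"
  assumes hcomp_carrier: "m \<in> hcomp M d \<Longrightarrow> m \<in> carrier M"
    and hcomp_zero: "\<zero>\<^bsub>M\<^esub> \<in> hcomp M d"
    and hcomp_add: "m \<in> hcomp M d \<Longrightarrow> n \<in> hcomp M d \<Longrightarrow> m \<oplus>\<^bsub>M\<^esub> n \<in> hcomp M d"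
    and hcomp_smult: "g \<in> homog e \<Longrightarrow> m \<in> hcomp M d \<Longrightarrow> g \<odot>\<^bsub>M\<^esub> m \<in> hcomp M (e + d)"
    and M_assoc: "m \<in> carrier M \<Longrightarrow> n \<in> carrier M \<Longrightarrow> p \<in> carrier M \<Longrightarrow>
      (m \<oplus>\<^bsub>M\<^esub> n) \<oplus>\<^bsub>M\<^esub> p = m \<oplus>\<^bsub>M\<^esub> (n \<oplus>\<^bsub>M\<^esub> p)"
    and M_comm: "m \<in> carrier M \<Longrightarrow> n \<in> carrier M \<Longrightarrow> m \<oplus>\<^bsub>M\<^esub> n = n \<oplus>\<^bsub>M\<^esub> m"
    and M_zero: "m \<in> carrier M \<Longrightarrow> m \<oplus>\<^bsub>M\<^esub> \<zero>\<^bsub>M\<^esub> = m"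
    and M_neg: "m \<in> carrier M \<Longrightarrow> m \<oplus>\<^bsub>M\<^esub> ((- 1) \<odot>\<^bsub>M\<^esub> m) = \<zero>\<^bsub>M\<^esub>"
    and smult_one: "m \<in> carrier M \<Longrightarrow> 1 \<odot>\<^bsub>M\<^esub> m = m"
    and smult_smult: "m \<in> carrier M \<Longrightarrow> g \<odot>\<^bsub>M\<^esub> (h \<odot>\<^bsub>M\<^esub> m) = (g * h) \<odot>\<^bsub>M\<^esub> m"
    and smult_add: "m \<in> carrier M \<Longrightarrow> n \<in> carrier M \<Longrightarrow>
      g \<odot>\<^bsub>M\<^esub> (m \<oplus>\<^bsub>M\<^esub> n) = g \<odot>\<^bsub>M\<^esub> m \<oplus>\<^bsub>M\<^esub> g \<odot>\<^bsub>M\<^esub> n"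
    and add_smult: "m \<in> carrier M \<Longrightarrow> (g + h) \<odot>\<^bsub>M\<^esub> m = g \<odot>\<^bsub>M\<^esub> m \<oplus>\<^bsub>M\<^esub> h \<odot>\<^bsub>M\<^esub> m"
    and smult_carrier: "m \<in> carrier M \<Longrightarrow> g \<odot>\<^bsub>M\<^esub> m \<in> carrier M"
    and ev_add: "m \<in> carrier M \<Longrightarrow> n \<in> carrier M \<Longrightarrow> ev (m \<oplus>\<^bsub>M\<^esub> n) = ev m + ev n"
    and ev_smult: "m \<in> carrier M \<Longrightarrow> ev (g \<odot>\<^bsub>M\<^esub> m) = (rho a b g * fst (ev m), rho a b g * snd (ev m))"
    and ev_kernel: "m \<in> hcomp M d \<Longrightarrow> ev m = (0, 0) \<Longrightarrow> \<exists>n\<in>hcomp M (d - 1). m = l \<odot>\<^bsub>M\<^esub> n"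
    and L_ideal: "vanishing_ideal L \<inter> homog d = {g \<in> homog d. rho a b g = 0}"
begin

abbreviation "r \<equiv> rho a b"

abbreviation "Loc f \<equiv> hom_localization M f"

definition level :: "poly3 \<Rightarrow> nat \<Rightarrow> 'b set"
  where "level f k = hcomp M (int (k * tdeg f))"

lemma level_carrier: "m \<in> level f k \<Longrightarrow> m \<in> carrier M"
  unfolding level_def by (rule hcomp_carrier)

lemma level_zero: "\<zero>\<^bsub>M\<^esub> \<in> level f k"
  unfolding level_def by (rule hcomp_zero)

lemma level_add: "m \<in> level f k \<Longrightarrow> n \<in> level f k \<Longrightarrow> m \<oplus>\<^bsub>M\<^esub> n \<in> level f k"
  unfolding level_def by (rule hcomp_add)

lemma base_degree:
  assumes "f \<in> base"
  shows "f \<in> homog (int (tdeg f))" "tdeg f > 0" "f \<noteq> 0"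
proof -
  obtain d where d: "f \<noteq> 0" "d > 0" "f \<in> homog d" using assms by (auto simp: base_def)
  then show "f \<in> homog (int (tdeg f))" "tdeg f > 0" "f \<noteq> 0" using tdeg_homog[OF d(3,1)] by auto
qed

lemma level_smult:
  assumes "f \<in> base" "m \<in> level f k"
  shows "f ^ j \<odot>\<^bsub>M\<^esub> m \<in> level f (j + k)"
  using hcomp_smult[OF homog_power[OF base_degree(1)[OF assms(1)], of j] assms(2)[unfolded level_def]]
  by (simp add: level_def distrib_right)

lemma fraction_iff:
  "(m', k') \<in> fraction M f m k \<longleftrightarrow> m' \<in> level f k' \<and> (\<exists>n. f ^ (n + k') \<odot>\<^bsub>M\<^esub> m = f ^ (n + k) \<odot>\<^bsub>M\<^esub> m')"
  by (simp add: fraction_def level_def)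

lemma fraction_self: "m \<in> level f k \<Longrightarrow> (m, k) \<in> fraction M f m k"
  by (auto simp: fraction_iff)

lemma fraction_subset:
  assumes m: "m \<in> level f k" and m': "m' \<in> level f k'"
    and e: "f ^ (n + k') \<odot>\<^bsub>M\<^esub> m = f ^ (n + k) \<odot>\<^bsub>M\<^esub> m'"
  shows "fraction M f m' k' \<subseteq> fraction M f m k"
proof (rule subsetI, clarify)
  fix m'' k'' assume "(m'', k'') \<in> fraction M f m' k'"
  then obtain p where m'': "m'' \<in> level f k''" and p: "f ^ (p + k'') \<odot>\<^bsub>M\<^esub> m' = f ^ (p + k') \<odot>\<^bsub>M\<^esub> m''"
    by (auto simp: fraction_iff)
  have "f ^ (n + p + k' + k'') \<odot>\<^bsub>M\<^esub> m = f ^ (p + k'') \<odot>\<^bsub>M\<^esub> (f ^ (n + k') \<odot>\<^bsub>M\<^esub> m)"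
    using level_carrier[OF m] by (simp add: smult_smult power_add ac_simps)
  also have "\<dots> = f ^ (n + k) \<odot>\<^bsub>M\<^esub> (f ^ (p + k'') \<odot>\<^bsub>M\<^esub> m')"
    unfolding e using level_carrier[OF m'] by (simp add: smult_smult ac_simps)
  also have "\<dots> = f ^ (n + p + k' + k) \<odot>\<^bsub>M\<^esub> m''"
    unfolding p using level_carrier[OF m''] by (simp add: smult_smult power_add ac_simps)
  finally show "(m'', k'') \<in> fraction M f m k" using m'' by (auto simp: fraction_iff)
qed

lemma fraction_eqI:
  assumes "m \<in> level f k" "m' \<in> level f k'" "f ^ (n + k') \<odot>\<^bsub>M\<^esub> m = f ^ (n + k) \<odot>\<^bsub>M\<^esub> m'"
  shows "fraction M f m k = fraction M f m' k'"
  using fraction_subset[OF assms] fraction_subset[OF assms(2,1) assms(3)[symmetric]] by blast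

lemma fraction_shift:
  assumes "f \<in> base" "m \<in> level f k"
  shows "fraction M f (f ^ j \<odot>\<^bsub>M\<^esub> m) (j + k) = fraction M f m k"
  by (rule fraction_eqI[where n = 0, OF level_smult[OF assms] assms(2)])
    (use level_carrier[OF assms(2)] in \<open>simp add: smult_smult power_add ac_simps\<close>)

lemma Loc_carrier: "carrier (Loc f) = {fraction M f m k | m k. m \<in> level f k}"
  by (simp add: hom_localization_def level_def)

lemma Loc_carrierI: "m \<in> level f k \<Longrightarrow> fraction M f m k \<in> carrier (Loc f)"
  by (auto simp: Loc_carrier)

text \<open>The defining union runs over all representatives and collapses because they all yield
  the same class. Equal denominators suffice, since any two sections can be brought to that
  form.\<close>

lemma Loc_add:
  assumes f: "f \<in> base" and m: "m \<in> level f k" and n: "n \<in> level f k"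
  shows "fraction M f m k \<oplus>\<^bsub>Loc f\<^esub> fraction M f n k = fraction M f (m \<oplus>\<^bsub>M\<^esub> n) k"
proof -
  have *: "fraction M f ((f ^ k\<^sub>2 \<odot>\<^bsub>M\<^esub> m\<^sub>1) \<oplus>\<^bsub>M\<^esub> (f ^ k\<^sub>1 \<odot>\<^bsub>M\<^esub> m\<^sub>2)) (k\<^sub>1 + k\<^sub>2) = fraction M f (m \<oplus>\<^bsub>M\<^esub> n) k"
    if mem: "(m\<^sub>1, k\<^sub>1) \<in> fraction M f m k" "(m\<^sub>2, k\<^sub>2) \<in> fraction M f n k" for m\<^sub>1 k\<^sub>1 m\<^sub>2 k\<^sub>2
  proof -
    obtain p q where m1: "m\<^sub>1 \<in> level f k\<^sub>1" and m2: "m\<^sub>2 \<in> level f k\<^sub>2"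
      and p: "f ^ (p + k\<^sub>1) \<odot>\<^bsub>M\<^esub> m = f ^ (p + k) \<odot>\<^bsub>M\<^esub> m\<^sub>1"
      and q: "f ^ (q + k\<^sub>2) \<odot>\<^bsub>M\<^esub> n = f ^ (q + k) \<odot>\<^bsub>M\<^esub> m\<^sub>2"
      using mem by (auto simp: fraction_iff)
    note c = level_carrier[OF m] level_carrier[OF n] level_carrier[OF m1] level_carrier[OF m2]
    have "f ^ (p + q + k) \<odot>\<^bsub>M\<^esub> ((f ^ k\<^sub>2 \<odot>\<^bsub>M\<^esub> m\<^sub>1) \<oplus>\<^bsub>M\<^esub> (f ^ k\<^sub>1 \<odot>\<^bsub>M\<^esub> m\<^sub>2))
      = f ^ (q + k\<^sub>2) \<odot>\<^bsub>M\<^esub> (f ^ (p + k) \<odot>\<^bsub>M\<^esub> m\<^sub>1) \<oplus>\<^bsub>M\<^esub> f ^ (p + k\<^sub>1) \<odot>\<^bsub>M\<^esub> (f ^ (q + k) \<odot>\<^bsub>M\<^esub> m\<^sub>2)"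
      using c by (simp add: smult_add smult_carrier smult_smult power_add ac_simps)
    also have "\<dots> = f ^ (p + q + (k\<^sub>1 + k\<^sub>2)) \<odot>\<^bsub>M\<^esub> (m \<oplus>\<^bsub>M\<^esub> n)"
      unfolding p[symmetric] q[symmetric] using c by (simp add: smult_add smult_carrier smult_smult power_add ac_simps)
    finally show ?thesis
      using level_smult[OF f m1, of k\<^sub>2] level_smult[OF f m2, of k\<^sub>1] m n
      by (intro fraction_eqI[where n = "p + q"]) (auto intro: level_add simp: add.commute)
  qed
  have "fraction M f m k \<oplus>\<^bsub>Loc f\<^esub> fraction M f n k = (\<Union>(m, k')\<in>fraction M f m k. \<Union>(m', k'')\<in>fraction M f n k.
      fraction M f ((f ^ k'' \<odot>\<^bsub>M\<^esub> m) \<oplus>\<^bsub>M\<^esub> (f ^ k' \<odot>\<^bsub>M\<^esub> m')) (k' + k''))"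
    by (simp add: hom_localization_def)
  also have "\<dots> = (\<Union>(m\<^sub>1, k\<^sub>1)\<in>fraction M f m k. \<Union>(m\<^sub>2, k\<^sub>2)\<in>fraction M f n k. fraction M f (m \<oplus>\<^bsub>M\<^esub> n) k)"
    using * by (intro SUP_cong refl) auto
  also have "\<dots> = fraction M f (m \<oplus>\<^bsub>M\<^esub> n) k"
    using fraction_self[OF m] fraction_self[OF n] by auto
  finally show ?thesis .
qed

lemma Loc_common:
  assumes f: "f \<in> base" and "x \<in> carrier (Loc f)" "y \<in> carrier (Loc f)"
  shows "\<exists>m n k. m \<in> level f k \<and> n \<in> level f k \<and> x = fraction M f m k \<and> y = fraction M f n k"
proof -
  obtain m i n j where m: "m \<in> level f i" "x = fraction M f m i" and n: "n \<in> level f j" "y = fraction M f n j"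
    using assms by (auto simp: Loc_carrier)
  show ?thesis
    using level_smult[OF f m(1), of j] level_smult[OF f n(1), of i]
      fraction_shift[OF f m(1), of j] fraction_shift[OF f n(1), of i] m(2) n(2)
    by (intro exI[of _ "f ^ j \<odot>\<^bsub>M\<^esub> m"] exI[of _ "f ^ i \<odot>\<^bsub>M\<^esub> n"] exI[of _ "j + i"]) (simp add: add.commute)
qed

lemma Loc_common3:
  assumes f: "f \<in> base" and "x \<in> carrier (Loc f)" "y \<in> carrier (Loc f)" "z \<in> carrier (Loc f)"
  shows "\<exists>m n p k. m \<in> level f k \<and> n \<in> level f k \<and> p \<in> level f k \<and>
    x = fraction M f m k \<and> y = fraction M f n k \<and> z = fraction M f p k"
proof -
  obtain m n i where mn: "m \<in> level f i" "n \<in> level f i" "x = fraction M f m i" "y = fraction M f n i"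
    using Loc_common[OF f assms(2,3)] by (elim exE conjE)
  obtain p j where p: "p \<in> level f j" "z = fraction M f p j" using assms(4) by (auto simp: Loc_carrier)
  show ?thesis
    using level_smult[OF f mn(1), of j] level_smult[OF f mn(2), of j] level_smult[OF f p(1), of i]
      fraction_shift[OF f mn(1), of j] fraction_shift[OF f mn(2), of j] fraction_shift[OF f p(1), of i] mn(3,4) p(2)
    by (intro exI[of _ "f ^ j \<odot>\<^bsub>M\<^esub> m"] exI[of _ "f ^ j \<odot>\<^bsub>M\<^esub> n"]
        exI[of _ "f ^ i \<odot>\<^bsub>M\<^esub> p"] exI[of _ "j + i"]) (simp add: add.commute)
qed

lemma Loc_zero: "f \<in> base \<Longrightarrow> \<zero>\<^bsub>Loc f\<^esub> = fraction M f \<zero>\<^bsub>M\<^esub> k"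
proof -
  assume f: "f \<in> base"
  have z: "g \<odot>\<^bsub>M\<^esub> \<zero>\<^bsub>M\<^esub> = \<zero>\<^bsub>M\<^esub>" for g
  proof -
    have c: "\<zero>\<^bsub>M\<^esub> \<in> carrier M" by (rule level_carrier[OF level_zero])
    have "(- 1) \<odot>\<^bsub>M\<^esub> \<zero>\<^bsub>M\<^esub> = \<zero>\<^bsub>M\<^esub>"
      using M_neg[OF c] M_comm[OF c smult_carrier[OF c]] M_zero[OF smult_carrier[OF c]] by metis
    then have "g \<odot>\<^bsub>M\<^esub> \<zero>\<^bsub>M\<^esub> = (- g) \<odot>\<^bsub>M\<^esub> \<zero>\<^bsub>M\<^esub>" using smult_smult[OF c, of g "- 1"] by simp
    moreover have "g \<odot>\<^bsub>M\<^esub> \<zero>\<^bsub>M\<^esub> \<oplus>\<^bsub>M\<^esub> (- g) \<odot>\<^bsub>M\<^esub> \<zero>\<^bsub>M\<^esub> = \<zero>\<^bsub>M\<^esub>"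
      using M_neg[OF smult_carrier[OF c, of g]] smult_smult[OF c, of "- 1" g] by simp
    moreover have "g \<odot>\<^bsub>M\<^esub> \<zero>\<^bsub>M\<^esub> \<oplus>\<^bsub>M\<^esub> g \<odot>\<^bsub>M\<^esub> \<zero>\<^bsub>M\<^esub> = g \<odot>\<^bsub>M\<^esub> \<zero>\<^bsub>M\<^esub>"
      using smult_add[OF c c, of g] M_zero[OF c] by simp
    ultimately show ?thesis by simp
  qed
  have "\<zero>\<^bsub>Loc f\<^esub> = fraction M f \<zero>\<^bsub>M\<^esub> 0" by (simp add: hom_localization_def)
  also have "\<dots> = fraction M f \<zero>\<^bsub>M\<^esub> k"
    by (rule fraction_eqI[where n = 0, OF level_zero level_zero]) (simp only: z)
  finally show ?thesis .
qed

lemma Loc_closed: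
  assumes f: "f \<in> base" and "x \<in> carrier (Loc f)" "y \<in> carrier (Loc f)"
  shows "x \<oplus>\<^bsub>Loc f\<^esub> y \<in> carrier (Loc f)"
proof -
  obtain m n k where mn: "m \<in> level f k" "n \<in> level f k" "x = fraction M f m k" "y = fraction M f n k"
    using Loc_common[OF assms] by (elim exE conjE)
  show ?thesis unfolding mn(3,4) Loc_add[OF f mn(1,2)] by (rule Loc_carrierI[OF level_add[OF mn(1,2)]])
qed

lemma Loc_assoc:
  assumes f: "f \<in> base" and "x \<in> carrier (Loc f)" "y \<in> carrier (Loc f)" "z \<in> carrier (Loc f)"
  shows "(x \<oplus>\<^bsub>Loc f\<^esub> y) \<oplus>\<^bsub>Loc f\<^esub> z = x \<oplus>\<^bsub>Loc f\<^esub> (y \<oplus>\<^bsub>Loc f\<^esub> z)"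
proof -
  obtain m n p k where mnp: "m \<in> level f k" "n \<in> level f k" "p \<in> level f k"
    "x = fraction M f m k" "y = fraction M f n k" "z = fraction M f p k"
    using Loc_common3[OF assms] by (elim exE conjE)
  show ?thesis
    unfolding mnp(4-6) Loc_add[OF f mnp(1,2)] Loc_add[OF f mnp(2,3)]
      Loc_add[OF f level_add[OF mnp(1,2)] mnp(3)] Loc_add[OF f mnp(1) level_add[OF mnp(2,3)]]
    by (simp only: M_assoc[OF mnp(1-3)[THEN level_carrier]])
qed

lemma Loc_comm:
  assumes f: "f \<in> base" and "x \<in> carrier (Loc f)" "y \<in> carrier (Loc f)"
  shows "x \<oplus>\<^bsub>Loc f\<^esub> y = y \<oplus>\<^bsub>Loc f\<^esub> x"
proof -
  obtain m n k where mn: "m \<in> level f k" "n \<in> level f k" "x = fraction M f m k" "y = fraction M f n k"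
    using Loc_common[OF assms] by (elim exE conjE)
  show ?thesis
    unfolding mn(3,4) Loc_add[OF f mn(1,2)] Loc_add[OF f mn(2,1)] M_comm[OF mn(1,2)[THEN level_carrier]] ..
qed

lemma Loc_zero_left:
  assumes f: "f \<in> base" and "x \<in> carrier (Loc f)"
  shows "\<zero>\<^bsub>Loc f\<^esub> \<oplus>\<^bsub>Loc f\<^esub> x = x"
proof -
  obtain m k where m: "m \<in> level f k" "x = fraction M f m k" using assms(2) by (auto simp: Loc_carrier)
  show ?thesis
    unfolding m(2) Loc_zero[OF f, of k] Loc_add[OF f level_zero m(1)] M_comm[OF level_carrier[OF level_zero] level_carrier[OF m(1)]]
      M_zero[OF level_carrier[OF m(1)]] ..
qed

lemma level_neg: "m \<in> level f k \<Longrightarrow> (- 1) \<odot>\<^bsub>M\<^esub> m \<in> level f k"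
  using hcomp_smult[OF homog_uminus[OF homog_1], of m] by (simp add: level_def)

lemma Loc_neg:
  assumes f: "f \<in> base" and "x \<in> carrier (Loc f)"
  shows "\<exists>y\<in>carrier (Loc f). y \<oplus>\<^bsub>Loc f\<^esub> x = \<zero>\<^bsub>Loc f\<^esub>"
proof -
  obtain m k where m: "m \<in> level f k" "x = fraction M f m k" using assms(2) by (auto simp: Loc_carrier)
  show ?thesis
  proof (rule bexI[OF _ Loc_carrierI[OF level_neg[OF m(1)]]])
    show "fraction M f ((- 1) \<odot>\<^bsub>M\<^esub> m) k \<oplus>\<^bsub>Loc f\<^esub> x = \<zero>\<^bsub>Loc f\<^esub>"
      unfolding m(2) Loc_zero[OF f, of k] Loc_add[OF f level_neg[OF m(1)] m(1)]
        M_comm[OF level_carrier[OF level_neg[OF m(1)]] level_carrier[OF m(1)]] M_neg[OF level_carrier[OF m(1)]] ..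
  qed
qed

lemma Loc_zero_carrier: "f \<in> base \<Longrightarrow> \<zero>\<^bsub>Loc f\<^esub> \<in> carrier (Loc f)"
  by (simp only: Loc_zero[of f 0] Loc_carrierI[OF level_zero])

lemma Loc_group:
  assumes f: "f \<in> base"
  shows "comm_group (add_monoid (Loc f))"
proof (rule comm_groupI; unfold monoid.simps partial_object.simps)
  show "x \<oplus>\<^bsub>Loc f\<^esub> y \<in> carrier (Loc f)" if "x \<in> carrier (Loc f)" "y \<in> carrier (Loc f)" for x y
    using that by (rule Loc_closed[OF f])
  show "\<zero>\<^bsub>Loc f\<^esub> \<in> carrier (Loc f)" by (rule Loc_zero_carrier[OF f])
  show "(x \<oplus>\<^bsub>Loc f\<^esub> y) \<oplus>\<^bsub>Loc f\<^esub> z = x \<oplus>\<^bsub>Loc f\<^esub> (y \<oplus>\<^bsub>Loc f\<^esub> z)"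
    if "x \<in> carrier (Loc f)" "y \<in> carrier (Loc f)" "z \<in> carrier (Loc f)" for x y z
    using that by (rule Loc_assoc[OF f])
  show "x \<oplus>\<^bsub>Loc f\<^esub> y = y \<oplus>\<^bsub>Loc f\<^esub> x" if "x \<in> carrier (Loc f)" "y \<in> carrier (Loc f)" for x y
    using that by (rule Loc_comm[OF f])
  show "\<zero>\<^bsub>Loc f\<^esub> \<oplus>\<^bsub>Loc f\<^esub> x = x" if "x \<in> carrier (Loc f)" for x
    using that by (rule Loc_zero_left[OF f])
  show "\<exists>y\<in>carrier (Loc f). y \<oplus>\<^bsub>Loc f\<^esub> x = \<zero>\<^bsub>Loc f\<^esub>" if "x \<in> carrier (Loc f)" for x
    using that by (rule Loc_neg[OF f])
qed

subsection \<open>Values along the line\<close>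

text \<open>If \<open>f\<close> vanishes on the line, then \<open>f / f\<close> is a section of its ideal, so all sections over
  \<open>D\<^sub>+(f)\<close> restrict to zero; this is why they get the value zero.\<close>

definition val :: "poly3 \<Rightarrow> 'b fractions \<Rightarrow> complex poly fract \<times> complex poly fract"
  where "val f x = (let (m, k) = (SOME p. p \<in> x) in if r f = 0 then (0, 0)
    else (to_fract (fst (ev m)) / to_fract (r f) ^ k, to_fract (snd (ev m)) / to_fract (r f) ^ k))"

lemma val_fraction:
  assumes "m \<in> level f k"
  shows "val f (fraction M f m k) = (if r f = 0 then (0, 0)
    else (to_fract (fst (ev m)) / to_fract (r f) ^ k, to_fract (snd (ev m)) / to_fract (r f) ^ k))"
proof -
  obtain m' k' where s: "(SOME p. p \<in> fraction M f m k) = (m', k')" by fastforce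
  have "(m', k') \<in> fraction M f m k" using someI[of "\<lambda>p. p \<in> fraction M f m k", OF fraction_self[OF assms]] s by simp
  then obtain n where m': "m' \<in> level f k'" and n: "f ^ (n + k') \<odot>\<^bsub>M\<^esub> m = f ^ (n + k) \<odot>\<^bsub>M\<^esub> m'"
    by (auto simp: fraction_iff)
  show ?thesis
  proof (cases "r f = 0")
    case False
    have "r f ^ (n + k') * fst (ev m) = r f ^ (n + k) * fst (ev m')" "r f ^ (n + k') * snd (ev m) = r f ^ (n + k) * snd (ev m')"
      using arg_cong[OF n, of ev] level_carrier[OF assms] level_carrier[OF m'] by (simp_all add: ev_smult)
    then have "r f ^ k' * fst (ev m) = r f ^ k * fst (ev m')" "r f ^ k' * snd (ev m) = r f ^ k * snd (ev m')"
      using False by (simp_all add: power_add)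
    from this[THEN arg_cong[of _ _ to_fract]]
    have "to_fract (r f) ^ k' * to_fract (fst (ev m)) = to_fract (r f) ^ k * to_fract (fst (ev m'))"
      "to_fract (r f) ^ k' * to_fract (snd (ev m)) = to_fract (r f) ^ k * to_fract (snd (ev m'))"
      by (simp_all add: to_fract_power)
    then show ?thesis using False by (simp add: val_def s field_simps)
  qed (simp add: val_def s)
qed

lemma val_zero_if: "x \<in> carrier (Loc f) \<Longrightarrow> r f = 0 \<Longrightarrow> val f x = (0, 0)"
  by (auto simp: Loc_carrier val_fraction)

lemma val_add:
  assumes f: "f \<in> base" and "x \<in> carrier (Loc f)" "y \<in> carrier (Loc f)"
  shows "val f (x \<oplus>\<^bsub>Loc f\<^esub> y) = val f x + val f y"
proof -
  obtain m n k where mn: "m \<in> level f k" "n \<in> level f k" "x = fraction M f m k" "y = fraction M f n k"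
    using Loc_common[OF assms] by (elim exE conjE)
  then show ?thesis
    using level_carrier[OF mn(1)] level_carrier[OF mn(2)]
    by (auto simp: Loc_add[OF f] val_fraction level_add ev_add add_divide_distrib)
qed

lemma val_zero: "f \<in> base \<Longrightarrow> val f \<zero>\<^bsub>Loc f\<^esub> = (0, 0)"
proof -
  assume f: "f \<in> base"
  have z: "\<zero>\<^bsub>M\<^esub> \<in> carrier M" by (rule level_carrier[OF level_zero])
  have "ev \<zero>\<^bsub>M\<^esub> + ev \<zero>\<^bsub>M\<^esub> = ev \<zero>\<^bsub>M\<^esub>" using ev_add[OF z z] M_zero[OF z] by simp
  then have "ev \<zero>\<^bsub>M\<^esub> = 0" by (metis add_cancel_right_right)
  then have e: "fst (ev \<zero>\<^bsub>M\<^esub>) = 0" "snd (ev \<zero>\<^bsub>M\<^esub>) = 0" by (simp_all only: fst_zero snd_zero)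
  have "val f (fraction M f \<zero>\<^bsub>M\<^esub> 0) = (0, 0)"
    by (simp only: val_fraction[OF level_zero] e to_fract_0 div_0 if_cancel)
  then show ?thesis by (simp only: Loc_zero[OF f, of 0])
qed

lemma Loc_subtract:
  assumes f: "f \<in> base" and x: "x \<in> carrier (Loc f)" and y: "y \<in> carrier (Loc f)"
  obtains z where "z \<in> carrier (Loc f)" "z \<oplus>\<^bsub>Loc f\<^esub> x = y" "val f z = val f y - val f x"
proof -
  obtain m n k where mn: "m \<in> level f k" "n \<in> level f k" "x = fraction M f m k" "y = fraction M f n k"
    using Loc_common[OF f x y] by (elim exE conjE)
  note c = level_carrier[OF mn(1)] level_carrier[OF mn(2)]
  have neg: "(- 1) \<odot>\<^bsub>M\<^esub> m \<in> level f k"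
    using hcomp_smult[OF homog_uminus[OF homog_1] mn(1)[unfolded level_def]] by (simp add: level_def)
  have p: "n \<oplus>\<^bsub>M\<^esub> ((- 1) \<odot>\<^bsub>M\<^esub> m) \<in> level f k" by (rule level_add[OF mn(2) neg])
  define z where "z = fraction M f (n \<oplus>\<^bsub>M\<^esub> ((- 1) \<odot>\<^bsub>M\<^esub> m)) k"
  have z: "z \<in> carrier (Loc f)" unfolding z_def by (rule Loc_carrierI[OF p])
  have "(n \<oplus>\<^bsub>M\<^esub> ((- 1) \<odot>\<^bsub>M\<^esub> m)) \<oplus>\<^bsub>M\<^esub> m = n"
    unfolding M_assoc[OF c(2) level_carrier[OF neg] c(1)] M_comm[OF level_carrier[OF neg] c(1)] M_neg[OF c(1)]
    by (rule M_zero[OF c(2)])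
  then have zx: "z \<oplus>\<^bsub>Loc f\<^esub> x = y" unfolding z_def mn(3,4) Loc_add[OF f p mn(1)] by simp
  moreover have "val f z = val f y - val f x"
    unfolding zx[symmetric] val_add[OF f z x] by simp
  ultimately show thesis using that[OF z] by blast
qed

end

text \<open>Sheaves on a line are compared through an embedding of their sections into \<open>K\<^sup>2\<close>, where
  \<open>K = \<complex>(x)\<close> is the function field of the line. The function \<open>sval\<close> is the corresponding embedding for
  the structure sheaf.\<close>

definition sval :: "(poly3 \<Rightarrow> complex poly) \<Rightarrow> poly3 \<Rightarrow> poly3 fractions \<Rightarrow> complex poly fract"
  where "sval r f R = (let (g, j) = (SOME p. p \<in> R) in
    if r f = 0 then 0 else to_fract (r g) / to_fract (r f) ^ j)"

definition scale :: "'a::times \<Rightarrow> 'a \<times> 'a \<Rightarrow> 'a \<times> 'a"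
  where "scale c v = (c * fst v, c * snd v)"

lemma S_fraction_iff:
  "(g', j') \<in> fraction (S_twist 0) f g j \<longleftrightarrow> g' \<in> homog (int (j' * tdeg f)) \<and> (\<exists>n. f ^ (n + j') * g = f ^ (n + j) * g')"
  by (simp add: fraction_def S_twist_def)

lemma S_sections: "carrier (sections structure_sheaf f) = {fraction (S_twist 0) f g j | g j. g \<in> homog (int (j * tdeg f))}"
  by (simp add: structure_sheaf_def sheaf_of_def hom_localization_def S_twist_def)

lemma sval_fraction:
  assumes "g \<in> homog (int (j * tdeg f))"
  shows "sval (rho a b) f (fraction (S_twist 0) f g j)
    = (if rho a b f = 0 then 0 else to_fract (rho a b g) / to_fract (rho a b f) ^ j)"
proof -
  obtain g' j' where s: "(SOME p. p \<in> fraction (S_twist 0) f g j) = (g', j')" by fastforce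
  have "(g, j) \<in> fraction (S_twist 0) f g j" unfolding S_fraction_iff using assms by blast
  then have "(g', j') \<in> fraction (S_twist 0) f g j" using someI[of "\<lambda>p. p \<in> fraction (S_twist 0) f g j"] s by metis
  then obtain n where n: "f ^ (n + j') * g = f ^ (n + j) * g'" unfolding S_fraction_iff by blast
  show ?thesis
  proof (cases "rho a b f = 0")
    case False
    have "rho a b f ^ (n + j') * rho a b g = rho a b f ^ (n + j) * rho a b g'"
      using arg_cong[OF n, of "rho a b"] by simp
    then have "rho a b f ^ j' * rho a b g = rho a b f ^ j * rho a b g'" using False by (simp add: power_add)
    from arg_cong[OF this, of to_fract]
    have "to_fract (rho a b f) ^ j' * to_fract (rho a b g) = to_fract (rho a b f) ^ j * to_fract (rho a b g')"
      by (simp add: to_fract_power)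
    then show ?thesis using False by (simp add: sval_def s field_simps)
  qed (simp add: sval_def s)
qed

text \<open>\<open>\<psi> f\<close> identifies the sections over \<open>D_+(f)\<close> with a subset
  \<open>V f\<close> of \<open>K^2\<close>. Scalars act through their values, and restriction maps
  become inclusions, except that restricting to \<open>D_+(g)\<close> gives \<open>0\<close> when
  \<open>g\<close> vanishes on the line.\<close>

definition realizes :: "(poly3 \<Rightarrow> complex poly) \<Rightarrow> 'b base_sheaf \<Rightarrow>
    (poly3 \<Rightarrow> 'b \<Rightarrow> complex poly fract \<times> complex poly fract) \<Rightarrow>
    (poly3 \<Rightarrow> (complex poly fract \<times> complex poly fract) set) \<Rightarrow> bool"
  where "realizes r F \<psi> V \<longleftrightarrow> (\<forall>f\<in>base. bij_betw (\<psi> f) (carrier (sections F f)) (V f) \<and>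
    (\<forall>x\<in>carrier (sections F f). \<forall>y\<in>carrier (sections F f). x \<oplus>\<^bsub>sections F f\<^esub> y \<in> carrier (sections F f) \<and>
      \<psi> f (x \<oplus>\<^bsub>sections F f\<^esub> y) = \<psi> f x + \<psi> f y) \<and>
    (\<forall>R\<in>carrier (sections structure_sheaf f). \<forall>x\<in>carrier (sections F f). R \<odot>\<^bsub>sections F f\<^esub> x \<in> carrier (sections F f) \<and>
      \<psi> f (R \<odot>\<^bsub>sections F f\<^esub> x) = scale (sval r f R) (\<psi> f x)) \<and>
    (\<forall>g\<in>base. (\<exists>n. f dvd g ^ n) \<longrightarrow> (\<forall>x\<in>carrier (sections F f). restriction F f g x \<in> carrier (sections F g) \<and>
      \<psi> g (restriction F f g x) = (if r g = 0 then 0 else \<psi> f x))))"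

lemma realizesD:
  assumes "realizes r F \<psi> V" "f \<in> base"
  shows "bij_betw (\<psi> f) (carrier (sections F f)) (V f)"
    "\<And>x y. x \<in> carrier (sections F f) \<Longrightarrow> y \<in> carrier (sections F f) \<Longrightarrow> x \<oplus>\<^bsub>sections F f\<^esub> y \<in> carrier (sections F f)"
    "\<And>x y. x \<in> carrier (sections F f) \<Longrightarrow> y \<in> carrier (sections F f) \<Longrightarrow> \<psi> f (x \<oplus>\<^bsub>sections F f\<^esub> y) = \<psi> f x + \<psi> f y"
    "\<And>R x. R \<in> carrier (sections structure_sheaf f) \<Longrightarrow> x \<in> carrier (sections F f) \<Longrightarrow> R \<odot>\<^bsub>sections F f\<^esub> x \<in> carrier (sections F f)"
    "\<And>R x. R \<in> carrier (sections structure_sheaf f) \<Longrightarrow> x \<in> carrier (sections F f) \<Longrightarrow>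
      \<psi> f (R \<odot>\<^bsub>sections F f\<^esub> x) = scale (sval r f R) (\<psi> f x)"
    "\<And>g n x. g \<in> base \<Longrightarrow> f dvd g ^ n \<Longrightarrow> x \<in> carrier (sections F f) \<Longrightarrow> restriction F f g x \<in> carrier (sections F g)"
    "\<And>g n x. g \<in> base \<Longrightarrow> f dvd g ^ n \<Longrightarrow> x \<in> carrier (sections F f) \<Longrightarrow>
      \<psi> g (restriction F f g x) = (if r g = 0 then 0 else \<psi> f x)"
proof -
  note B = bspec[OF assms(1)[unfolded realizes_def] assms(2)]
  note B1 = conjunct1[OF B] and B2 = conjunct1[OF conjunct2[OF B]]
    and B3 = conjunct1[OF conjunct2[OF conjunct2[OF B]]] and B4 = conjunct2[OF conjunct2[OF conjunct2[OF B]]]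
  show "bij_betw (\<psi> f) (carrier (sections F f)) (V f)" by (rule B1)
  fix x assume x: "x \<in> carrier (sections F f)"
  show "x \<oplus>\<^bsub>sections F f\<^esub> y \<in> carrier (sections F f)" "\<psi> f (x \<oplus>\<^bsub>sections F f\<^esub> y) = \<psi> f x + \<psi> f y"
    if "y \<in> carrier (sections F f)" for y
    using bspec[OF bspec[OF B2 x] that] by (rule conjunct1, rule conjunct2)
  show "R \<odot>\<^bsub>sections F f\<^esub> x \<in> carrier (sections F f)" "\<psi> f (R \<odot>\<^bsub>sections F f\<^esub> x) = scale (sval r f R) (\<psi> f x)"
    if "R \<in> carrier (sections structure_sheaf f)" for R
    using bspec[OF bspec[OF B3 that] x] by (rule conjunct1, rule conjunct2)
  show "restriction F f g x \<in> carrier (sections F g)" "\<psi> g (restriction F f g x) = (if r g = 0 then 0 else \<psi> f x)"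
    if "g \<in> base" "f dvd g ^ n" for g n
  proof -
    have "\<exists>n. f dvd g ^ n" using that(2) by blast
    from bspec[OF mp[OF bspec[OF B4 that(1)] this] x]
    show "restriction F f g x \<in> carrier (sections F g)" "\<psi> g (restriction F f g x) = (if r g = 0 then 0 else \<psi> f x)"
      by (rule conjunct1, rule conjunct2)
  qed
qed

text \<open>A single linear map \<open>T\<close> that carries each \<open>V f\<close> onto
  \<open>V' f\<close> commutes with inclusions and with \<open>0\<close>. Transported by the
  identifications it is an isomorphism over all open sets simultaneously.\<close>

lemma sheaf_iso_realized:
  assumes F: "realizes r F \<psi> V" and G: "realizes r G \<omega> V'"
    and T_add: "\<And>v w. T (v + w) = T v + T w" and T_scale: "\<And>c v. T (scale c v) = scale c (T v)"
    and T_bij: "\<And>f. f \<in> base \<Longrightarrow> bij_betw T (V f) (V' f)"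
  shows "sheaf_iso F G"
proof -
  define \<phi> where "\<phi> f = inv_into (carrier (sections G f)) (\<omega> f) \<circ> (T \<circ> \<psi> f)" for f
  have bij: "bij_betw (\<phi> f) (carrier (sections F f)) (carrier (sections G f))" if f: "f \<in> base" for f
    unfolding \<phi>_def
    by (rule bij_betw_trans[OF bij_betw_trans[OF realizesD(1)[OF F f] T_bij[OF f]] bij_betw_inv_into[OF realizesD(1)[OF G f]]])
  have \<phi>: "\<phi> f x \<in> carrier (sections G f)" "\<omega> f (\<phi> f x) = T (\<psi> f x)"
    if f: "f \<in> base" and x: "x \<in> carrier (sections F f)" for f x
  proof -
    show "\<phi> f x \<in> carrier (sections G f)" using bij_betwE[OF bij[OF f]] x by blast
    have "T (\<psi> f x) \<in> V' f" using bij_betwE[OF T_bij[OF f]] bij_betwE[OF realizesD(1)[OF F f]] x by blast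
    then show "\<omega> f (\<phi> f x) = T (\<psi> f x)"
      unfolding \<phi>_def o_apply by (rule bij_betw_inv_into_right[OF realizesD(1)[OF G f]])
  qed
  have eqI: "y = z" if "f \<in> base" "y \<in> carrier (sections G f)" "z \<in> carrier (sections G f)" "\<omega> f y = \<omega> f z" for f y z
    using realizesD(1)[OF G that(1)] that(2-) by (auto simp: bij_betw_def inj_on_def)
  have T0: "T 0 = 0" using T_add[of 0 0] by simp
  show ?thesis
    unfolding sheaf_iso_def
  proof (rule exI[of _ \<phi>], intro conjI ballI impI)
    fix f assume f: "f \<in> base"
    show "bij_betw (\<phi> f) (carrier (sections F f)) (carrier (sections G f))" by (rule bij[OF f])
    fix x assume x: "x \<in> carrier (sections F f)"
    show "\<phi> f (x \<oplus>\<^bsub>sections F f\<^esub> y) = \<phi> f x \<oplus>\<^bsub>sections G f\<^esub> \<phi> f y" if y: "y \<in> carrier (sections F f)" for y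
      by (rule eqI[OF f]) (simp_all only: realizesD(2,3)[OF F f x y] \<phi>[OF f] x y
          realizesD(2,3)[OF G f \<phi>(1)[OF f x] \<phi>(1)[OF f y]] T_add)
    show "\<phi> f (R \<odot>\<^bsub>sections F f\<^esub> x) = R \<odot>\<^bsub>sections G f\<^esub> \<phi> f x" if R: "R \<in> carrier (sections structure_sheaf f)" for R
      by (rule eqI[OF f]) (simp_all only: realizesD(4,5)[OF F f R x] \<phi>[OF f] x
          realizesD(4,5)[OF G f R \<phi>(1)[OF f x]] T_scale)
  next
    fix f g x assume f: "f \<in> base" and g: "g \<in> base" and "\<exists>n. f dvd g ^ n" and x: "x \<in> carrier (sections F f)"
    then obtain n where n: "f dvd g ^ n" by blast
    show "\<phi> g (restriction F f g x) = restriction G f g (\<phi> f x)"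
    proof (rule eqI[OF g])
      show "\<omega> g (\<phi> g (restriction F f g x)) = \<omega> g (restriction G f g (\<phi> f x))"
        unfolding \<phi>(2)[OF g realizesD(6)[OF F f g n x]] realizesD(7)[OF F f g n x]
          realizesD(7)[OF G f g n \<phi>(1)[OF f x]] \<phi>(2)[OF f x]
        using T0 by simp
    qed (rule \<phi>(1)[OF g realizesD(6)[OF F f g n x]], rule realizesD(6)[OF G f g n \<phi>(1)[OF f x]])
  qed
qed

text \<open>Line bundles are realised in the first coordinate of \<open>K^2\<close> with second
  coordinate \<open>0\<close>, so two of them fit into the two coordinates.\<close>

lemma realizes_direct_sum:
  assumes F: "realizes r F \<psi> V" and G: "realizes r G \<omega> V'"
    and V: "\<And>f v. f \<in> base \<Longrightarrow> v \<in> V f \<Longrightarrow> snd v = 0" and V': "\<And>f v. f \<in> base \<Longrightarrow> v \<in> V' f \<Longrightarrow> snd v = 0"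
  shows "realizes r (direct_sum F G) (\<lambda>f (x, y). (fst (\<psi> f x), fst (\<omega> f y))) (\<lambda>f. (fst ` V f) \<times> (fst ` V' f))"
  unfolding realizes_def
proof (rule ballI, goal_cases)
  case (1 f)
  have "inj_on fst (V f)" "inj_on fst (V' f)" using V[OF 1] V'[OF 1] by (auto simp: inj_on_def prod_eq_iff)
  then have "bij_betw fst (V f) (fst ` V f)" "bij_betw fst (V' f) (fst ` V' f)" by (simp_all add: inj_on_imp_bij_betw)
  then have b: "bij_betw (fst \<circ> \<psi> f) (carrier (sections F f)) (fst ` V f)"
    "bij_betw (fst \<circ> \<omega> f) (carrier (sections G f)) (fst ` V' f)"
    using bij_betw_trans[OF realizesD(1)[OF F 1]] bij_betw_trans[OF realizesD(1)[OF G 1]] by blast+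
  have "bij_betw (\<lambda>(x, y). (fst (\<psi> f x), fst (\<omega> f y))) (carrier (sections F f) \<times> carrier (sections G f)) ((fst ` V f) \<times> (fst ` V' f))"
    using bij_betw_map_prod[OF b] by (simp add: map_prod_def o_def case_prod_unfold)
  then show ?case
    using realizesD(2-7)[OF F 1] realizesD(2-7)[OF G 1]
    by (auto simp: direct_sum_def scale_def zero_prod_def)
qed

section \<open>The restricted sheaf and its values in the function field\<close>

context restricted_module
begin

lemma Loc_smult:
  assumes g: "g \<in> homog (int (j * tdeg f))" and m: "m \<in> level f k"
  shows "fraction (S_twist 0) f g j \<odot>\<^bsub>Loc f\<^esub> fraction M f m k = fraction M f (g \<odot>\<^bsub>M\<^esub> m) (j + k)"
    "g \<odot>\<^bsub>M\<^esub> m \<in> level f (j + k)"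
proof -
  have lev: "g \<odot>\<^bsub>M\<^esub> m \<in> level f (j + k)" if "g \<in> homog (int (j * tdeg f))" "m \<in> level f k" for g j m k
    using hcomp_smult[OF that(1) that(2)[unfolded level_def]] by (simp add: level_def distrib_right)
  show gm: "g \<odot>\<^bsub>M\<^esub> m \<in> level f (j + k)" by (rule lev[OF g m])
  have *: "fraction M f (g\<^sub>1 \<odot>\<^bsub>M\<^esub> m\<^sub>1) (j\<^sub>1 + k\<^sub>1) = fraction M f (g \<odot>\<^bsub>M\<^esub> m) (j + k)"
    if mem: "(g\<^sub>1, j\<^sub>1) \<in> fraction (S_twist 0) f g j" "(m\<^sub>1, k\<^sub>1) \<in> fraction M f m k" for g\<^sub>1 j\<^sub>1 m\<^sub>1 k\<^sub>1
  proof -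
    obtain n p where g1: "g\<^sub>1 \<in> homog (int (j\<^sub>1 * tdeg f))" and n: "f ^ (n + j\<^sub>1) * g = f ^ (n + j) * g\<^sub>1"
      and m1: "m\<^sub>1 \<in> level f k\<^sub>1" and p: "f ^ (p + k\<^sub>1) \<odot>\<^bsub>M\<^esub> m = f ^ (p + k) \<odot>\<^bsub>M\<^esub> m\<^sub>1"
      using mem unfolding S_fraction_iff fraction_iff by blast
    note c = level_carrier[OF m] level_carrier[OF m1]
    have "f ^ (n + p + (j + k)) \<odot>\<^bsub>M\<^esub> (g\<^sub>1 \<odot>\<^bsub>M\<^esub> m\<^sub>1) = (f ^ (n + j) * g\<^sub>1) \<odot>\<^bsub>M\<^esub> (f ^ (p + k) \<odot>\<^bsub>M\<^esub> m\<^sub>1)"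
      using c by (simp add: smult_smult power_add ac_simps)
    also have "\<dots> = f ^ (n + p + (j\<^sub>1 + k\<^sub>1)) \<odot>\<^bsub>M\<^esub> (g \<odot>\<^bsub>M\<^esub> m)"
      unfolding n[symmetric] p[symmetric] using c by (simp add: smult_smult power_add ac_simps)
    finally show ?thesis by (rule fraction_eqI[OF lev[OF g1 m1] gm])
  qed
  have "fraction (S_twist 0) f g j \<odot>\<^bsub>Loc f\<^esub> fraction M f m k = (\<Union>(g, j)\<in>fraction (S_twist 0) f g j. \<Union>(m, k)\<in>fraction M f m k.
      fraction M f (g \<odot>\<^bsub>M\<^esub> m) (j + k))"
    by (simp add: hom_localization_def)
  also have "\<dots> = (\<Union>(g\<^sub>1, j\<^sub>1)\<in>fraction (S_twist 0) f g j. \<Union>(m\<^sub>1, k\<^sub>1)\<in>fraction M f m k. fraction M f (g \<odot>\<^bsub>M\<^esub> m) (j + k))"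
    using * by (intro SUP_cong refl) auto
  also have "\<dots> = fraction M f (g \<odot>\<^bsub>M\<^esub> m) (j + k)"
  proof -
    have "(g, j) \<in> fraction (S_twist 0) f g j" unfolding S_fraction_iff using g by blast
    then show ?thesis using fraction_self[OF m] by auto
  qed
  finally show "fraction (S_twist 0) f g j \<odot>\<^bsub>Loc f\<^esub> fraction M f m k = fraction M f (g \<odot>\<^bsub>M\<^esub> m) (j + k)" .
qed

lemma Loc_smult_closed:
  assumes "R \<in> carrier (sections structure_sheaf f)" "x \<in> carrier (Loc f)"
  shows "R \<odot>\<^bsub>Loc f\<^esub> x \<in> carrier (Loc f)" "val f (R \<odot>\<^bsub>Loc f\<^esub> x) = scale (sval r f R) (val f x)"
proof -
  obtain g j where g: "g \<in> homog (int (j * tdeg f))" "R = fraction (S_twist 0) f g j"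
    using assms(1) unfolding S_sections by blast
  obtain m k where m: "m \<in> level f k" "x = fraction M f m k" using assms(2) by (auto simp: Loc_carrier)
  show "R \<odot>\<^bsub>Loc f\<^esub> x \<in> carrier (Loc f)"
    unfolding g(2) m(2) Loc_smult(1)[OF g(1) m(1)] by (rule Loc_carrierI[OF Loc_smult(2)[OF g(1) m(1)]])
  show "val f (R \<odot>\<^bsub>Loc f\<^esub> x) = scale (sval r f R) (val f x)"
    unfolding g(2) m(2) Loc_smult(1)[OF g(1) m(1)] val_fraction[OF Loc_smult(2)[OF g(1) m(1)]] val_fraction[OF m(1)]
      sval_fraction[OF g(1)] scale_def
    using level_carrier[OF m(1)] by (simp add: ev_smult power_add)
qed

abbreviation "line_kernel f \<equiv> ideal_mult (ideal_sections L f) (Loc f)"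

lemma kernel_generator:
  assumes "g \<in> homog (int (j * tdeg f))" "r g = 0" "m \<in> level f k"
  shows "fraction M f (g \<odot>\<^bsub>M\<^esub> m) (j + k) \<in> line_kernel f"
proof -
  have "g \<in> vanishing_ideal L \<inter> homog (int (j * tdeg f))" unfolding L_ideal using assms by blast
  then have "fraction (S_twist 0) f g j \<in> ideal_sections L f" unfolding ideal_sections_def by blast
  then show ?thesis
    unfolding ideal_mult_def Loc_smult(1)[OF assms(1,3), symmetric]
    using Loc_carrierI[OF assms(3)] by (intro generate.incl) blast
qed

lemma kernel_add: "x \<in> line_kernel f \<Longrightarrow> y \<in> line_kernel f \<Longrightarrow> x \<oplus>\<^bsub>Loc f\<^esub> y \<in> line_kernel f"
  unfolding ideal_mult_def using generate.eng[of x "add_monoid (Loc f)" _ y] by simp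

lemma kernel_val:
  assumes f: "f \<in> base" and x: "x \<in> line_kernel f"
  shows "x \<in> carrier (Loc f) \<and> val f x = (0, 0)"
proof -
  have gen: "R \<odot>\<^bsub>Loc f\<^esub> y \<in> carrier (Loc f) \<and> val f (R \<odot>\<^bsub>Loc f\<^esub> y) = (0, 0)"
    if R: "R \<in> ideal_sections L f" and y: "y \<in> carrier (Loc f)" for R y
  proof -
    obtain g j where g: "R = fraction (S_twist 0) f g j" "g \<in> vanishing_ideal L \<inter> homog (int (j * tdeg f))"
      using R unfolding ideal_sections_def by blast
    then have g': "g \<in> homog (int (j * tdeg f))" "r g = 0" unfolding L_ideal by blast+
    then have "R \<in> carrier (sections structure_sheaf f)" unfolding S_sections g(1) by blast
    from Loc_smult_closed[OF this y] show ?thesis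
      unfolding g(1) sval_fraction[OF g'(1)] by (simp add: g'(2) scale_def)
  qed
  show ?thesis
    using x unfolding ideal_mult_def
  proof induction
    case one
    then show ?case using Loc_zero_carrier[OF f] val_zero[OF f] by simp
  next
    case (incl h)
    then show ?case using gen by blast
  next
    case (inv h)
    then have h: "h \<in> carrier (Loc f)" "val f h = (0, 0)" using gen by blast+
    have grp: "group (add_monoid (Loc f))" using Loc_group[OF f] by (rule comm_group.axioms(2))
    have i: "inv\<^bsub>add_monoid (Loc f)\<^esub> h \<in> carrier (Loc f)" using group.inv_closed[OF grp, of h] h(1) by simp
    have "h \<oplus>\<^bsub>Loc f\<^esub> inv\<^bsub>add_monoid (Loc f)\<^esub> h = \<zero>\<^bsub>Loc f\<^esub>" using group.r_inv[OF grp, of h] h(1) by simp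
    then have "val f h + val f (inv\<^bsub>add_monoid (Loc f)\<^esub> h) = (0, 0)"
      using val_add[OF f h(1) i] val_zero[OF f] by simp
    then show ?case using i h(2) by (cases "val f (inv\<^bsub>add_monoid (Loc f)\<^esub> h)") simp
  next
    case (eng x y)
    then show ?case using Loc_closed[OF f, of x y] val_add[OF f, of x y] by simp
  qed
qed

lemma base_decomposition:
  assumes "f \<in> base"
  obtains F :: "3 \<Rightarrow> poly3" where "\<And>i. F i \<in> homog (int (tdeg f) - 1)" "f = F 1 * Var 1 + F 2 * Var 2 + F 3 * Var 3"
proof
  let ?D = "of_nat (tdeg f) :: complex"
  have D: "?D \<noteq> 0" using base_degree(2)[OF assms] by simp
  have c: "Const (of_nat n) = of_nat n" for n by (induction n) (simp_all add: Const_simps)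
  define F :: "3 \<Rightarrow> poly3" where "F i = Const (1 / ?D) * pderivative i f" for i
  show "F i \<in> homog (int (tdeg f) - 1)" for i
    unfolding F_def by (intro homog_Const_mult pderivative_homog base_degree(1)[OF assms])
  have "F 1 * Var 1 + F 2 * Var 2 + F 3 * Var 3 = Const (1 / ?D) * euler f"
    by (simp add: F_def euler_def sum_3 algebra_simps)
  also have "\<dots> = Const (1 / ?D) * Const ?D * f"
    using euler_homog[OF base_degree(1)[OF assms]] by (simp add: c mult.assoc)
  also have "\<dots> = f" using D by (simp add: Const_simps(6)[symmetric] Const_simps(2))
  finally show "f = F 1 * Var 1 + F 2 * Var 2 + F 3 * Var 3" by simp
qed

text \<open>If \<open>m = l n\<close>, then \<open>n\<close> need not have a degree divisible by that of \<open>f\<close>. Euler's formula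
  \<open>f = \<Sum>F\<^sub>i Y\<^sub>i\<close> repairs this: \<open>f m = \<Sum>(l F\<^sub>i) (Y\<^sub>i n)\<close>.\<close>

lemma val_zero_kernel:
  assumes f: "f \<in> base" and x: "x \<in> carrier (Loc f)" "val f x = (0, 0)"
  shows "x \<in> line_kernel f"
proof -
  obtain m k where m: "m \<in> level f k" "x = fraction M f m k" using x(1) by (auto simp: Loc_carrier)
  \<comment> \<open>The extra factor \<open>f\<close> makes room for Euler's formula. If
    \<open>f\<close> vanishes on the line, it exhibits \<open>x\<close> as a multiple of the section
    \<open>f / f\<close> of the ideal.\<close>
  have x1: "x = fraction M f (f \<odot>\<^bsub>M\<^esub> m) (1 + k)"
    unfolding m(2) using fraction_shift[OF f m(1), of 1] by simp
  have fh: "f \<in> homog (int (1 * tdeg f))" using base_degree(1)[OF f] by simp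
  show ?thesis
  proof (cases "r f = 0")
    case True
    then show ?thesis unfolding x1 using kernel_generator[OF fh _ m(1)] by blast
  next
    case False
    then have "ev m = (0, 0)"
      using x(2) unfolding m(2) val_fraction[OF m(1)] by (cases "ev m") (simp add: prod_eq_iff)
    then obtain n where n: "n \<in> hcomp M (int (k * tdeg f) - 1)" "m = l \<odot>\<^bsub>M\<^esub> n"
      using ev_kernel m(1)[unfolded level_def] by blast
    obtain F :: "3 \<Rightarrow> poly3" where F: "\<And>i. F i \<in> homog (int (tdeg f) - 1)" "f = F 1 * Var 1 + F 2 * Var 2 + F 3 * Var 3"
      using base_decomposition[OF f] by metis
    have c: "n \<in> carrier M" by (rule hcomp_carrier[OF n(1)])
    have lv: "Var i \<odot>\<^bsub>M\<^esub> n \<in> level f k" for i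
      using hcomp_smult[OF homog_Var n(1)] by (simp add: level_def)
    have lF: "l * F i \<in> homog (int (1 * tdeg f))" "r (l * F i) = 0" for i
      using homog_mult[OF l_homog F(1)] by simp_all
    define y where "y i = (l * F i) \<odot>\<^bsub>M\<^esub> (Var i \<odot>\<^bsub>M\<^esub> n)" for i
    have y: "y i \<in> level f (1 + k)" "fraction M f (y i) (1 + k) \<in> line_kernel f" for i
      unfolding y_def by (rule Loc_smult(2)[OF lF(1) lv], rule kernel_generator[OF lF lv])
    have "f \<odot>\<^bsub>M\<^esub> m = (f * l) \<odot>\<^bsub>M\<^esub> n" unfolding n(2) by (rule smult_smult[OF c])
    also have "f * l = l * F 1 * Var 1 + l * F 2 * Var 2 + l * F 3 * Var 3"
      by (subst F(2)) (simp add: algebra_simps)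
    also have "\<dots> \<odot>\<^bsub>M\<^esub> n = (y 1 \<oplus>\<^bsub>M\<^esub> y 2) \<oplus>\<^bsub>M\<^esub> y 3"
      by (simp only: add_smult[OF c] y_def smult_smult[OF c])
    finally have "x = (fraction M f (y 1) (1 + k) \<oplus>\<^bsub>Loc f\<^esub> fraction M f (y 2) (1 + k)) \<oplus>\<^bsub>Loc f\<^esub> fraction M f (y 3) (1 + k)"
      unfolding x1 by (simp only: Loc_add[OF f y(1) y(1)] Loc_add[OF f level_add[OF y(1) y(1)] y(1)])
    then show ?thesis using kernel_add y(2) by simp
  qed
qed

text \<open>Cosets of the kernel are exactly the fibres of \<open>val f\<close>, so a section of the
  restricted sheaf can be named by its value.\<close>

definition fiber :: "poly3 \<Rightarrow> complex poly fract \<times> complex poly fract \<Rightarrow> 'b fractions set"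
  where "fiber f v = {y \<in> carrier (Loc f). val f y = v}"

lemma kernel_coset:
  assumes f: "f \<in> base" and x: "x \<in> carrier (Loc f)"
  shows "line_kernel f +>\<^bsub>Loc f\<^esub> x = fiber f (val f x)"
proof -
  have A: "y \<in> fiber f (val f x)" if "h \<in> line_kernel f" "y = h \<oplus>\<^bsub>Loc f\<^esub> x" for h y
    using kernel_val[OF f that(1)] that(2) Loc_closed[OF f _ x] val_add[OF f _ x]
    by (simp add: fiber_def zero_prod_def[symmetric])
  have B: "\<exists>h\<in>line_kernel f. y = h \<oplus>\<^bsub>Loc f\<^esub> x" if "y \<in> fiber f (val f x)" for y
  proof -
    have y: "y \<in> carrier (Loc f)" "val f y = val f x" using that by (simp_all add: fiber_def)
    obtain z where "z \<in> carrier (Loc f)" "z \<oplus>\<^bsub>Loc f\<^esub> x = y" "val f z = val f y - val f x"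
      by (rule Loc_subtract[OF f x y(1)])
    then show ?thesis using val_zero_kernel[OF f] y(2) by (intro bexI[of _ z]) (simp_all add: zero_prod_def)
  qed
  show ?thesis
    unfolding a_r_coset_def'
  proof (intro equalityI subsetI)
    fix y assume "y \<in> (\<Union>h\<in>line_kernel f. {h \<oplus>\<^bsub>Loc f\<^esub> x})"
    then show "y \<in> fiber f (val f x)" by (elim UN_E singletonE) (rule A)
  next
    fix y assume "y \<in> fiber f (val f x)"
    from B[OF this] show "y \<in> (\<Union>h\<in>line_kernel f. {h \<oplus>\<^bsub>Loc f\<^esub> x})"
      by (elim bexE) (intro UN_I singletonI, assumption, simp only: singleton_iff)
  qed
qed

abbreviation "Res \<equiv> restrict_to L (sheaf_of M)"

definition value_set :: "poly3 \<Rightarrow> (complex poly fract \<times> complex poly fract) set"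
  where "value_set f = val f ` carrier (Loc f)"

definition class_val :: "poly3 \<Rightarrow> 'b fractions set \<Rightarrow> complex poly fract \<times> complex poly fract"
  where "class_val f C = val f (SOME x. x \<in> C)"

lemma fiber_nonempty: "v \<in> value_set f \<Longrightarrow> \<exists>x\<in>carrier (Loc f). val f x = v"
  by (auto simp: value_set_def)

lemma class_val_fiber:
  assumes "v \<in> value_set f"
  shows "class_val f (fiber f v) = v"
proof -
  have "\<exists>x. x \<in> fiber f v" using fiber_nonempty[OF assms] by (auto simp: fiber_def)
  then have "(SOME x. x \<in> fiber f v) \<in> fiber f v" by (rule someI_ex)
  then show ?thesis by (simp add: class_val_def fiber_def)
qed

lemma sections_Res: "sections Res f = quotient_module (Loc f) (line_kernel f)"
  by (simp add: restrict_to_def sheaf_of_def)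

lemma Res_carrier: "f \<in> base \<Longrightarrow> carrier (sections Res f) = fiber f ` value_set f"
  unfolding sections_Res quotient_module_def
  by (auto simp: A_RCOSETS_def' kernel_coset value_set_def)

lemma Res_add:
  assumes f: "f \<in> base" and v: "v \<in> value_set f" and w: "w \<in> value_set f"
  shows "fiber f v \<oplus>\<^bsub>sections Res f\<^esub> fiber f w = fiber f (v + w)" "v + w \<in> value_set f"
proof -
  obtain x y where x: "x \<in> carrier (Loc f)" "val f x = v" and y: "y \<in> carrier (Loc f)" "val f y = w"
    using fiber_nonempty[OF v] fiber_nonempty[OF w] by blast
  show "v + w \<in> value_set f"
    unfolding value_set_def using imageI[OF Loc_closed[OF f x(1) y(1)], of "val f"]
    by (simp only: val_add[OF f x(1) y(1)] x(2) y(2))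
  have A: "z \<in> fiber f (v + w)" if "p \<in> fiber f v" "q \<in> fiber f w" "z = p \<oplus>\<^bsub>Loc f\<^esub> q" for p q z
    using that Loc_closed[OF f, of p q] val_add[OF f, of p q] by (simp add: fiber_def)
  have B: "\<exists>p\<in>fiber f v. \<exists>q\<in>fiber f w. z = p \<oplus>\<^bsub>Loc f\<^esub> q" if "z \<in> fiber f (v + w)" for z
  proof -
    have z: "z \<in> carrier (Loc f)" "val f z = v + w" using that by (simp_all add: fiber_def)
    obtain p where "p \<in> carrier (Loc f)" "p \<oplus>\<^bsub>Loc f\<^esub> y = z" "val f p = val f z - val f y"
      by (rule Loc_subtract[OF f y(1) z(1)])
    then show ?thesis using y z(2) by (intro bexI[of _ p] bexI[of _ y]) (simp_all add: fiber_def)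
  qed
  have "fiber f v <+>\<^bsub>Loc f\<^esub> fiber f w = fiber f (v + w)"
    unfolding set_add_def'
  proof (intro equalityI subsetI)
    fix z assume "z \<in> (\<Union>p\<in>fiber f v. \<Union>q\<in>fiber f w. {p \<oplus>\<^bsub>Loc f\<^esub> q})"
    then show "z \<in> fiber f (v + w)" by (elim UN_E singletonE) (rule A)
  next
    fix z assume "z \<in> fiber f (v + w)"
    from B[OF this] show "z \<in> (\<Union>p\<in>fiber f v. \<Union>q\<in>fiber f w. {p \<oplus>\<^bsub>Loc f\<^esub> q})"
      by (elim bexE) (intro UN_I singletonI, assumption+, simp only: singleton_iff)
  qed
  then show "fiber f v \<oplus>\<^bsub>sections Res f\<^esub> fiber f w = fiber f (v + w)"
    by (simp add: sections_Res quotient_module_def)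
qed

lemma Res_smult:
  assumes f: "f \<in> base" and R: "R \<in> carrier (sections structure_sheaf f)" and v: "v \<in> value_set f"
  shows "R \<odot>\<^bsub>sections Res f\<^esub> fiber f v = fiber f (scale (sval r f R) v)" "scale (sval r f R) v \<in> value_set f"
proof -
  obtain x where x: "x \<in> carrier (Loc f)" "val f x = v" using fiber_nonempty[OF v] by blast
  show "scale (sval r f R) v \<in> value_set f"
    unfolding value_set_def using imageI[OF Loc_smult_closed(1)[OF R x(1)], of "val f"]
    by (simp only: Loc_smult_closed(2)[OF R x(1)] x(2))
  have "line_kernel f +>\<^bsub>Loc f\<^esub> (R \<odot>\<^bsub>Loc f\<^esub> y) = fiber f (scale (sval r f R) v)" if "y \<in> fiber f v" for y
    using that kernel_coset[OF f Loc_smult_closed(1)[OF R]] Loc_smult_closed(2)[OF R] by (simp add: fiber_def)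
  moreover have "x \<in> fiber f v" using x by (simp add: fiber_def)
  ultimately have "(\<Union>y\<in>fiber f v. line_kernel f +>\<^bsub>Loc f\<^esub> (R \<odot>\<^bsub>Loc f\<^esub> y)) = fiber f (scale (sval r f R) v)" by blast
  then show "R \<odot>\<^bsub>sections Res f\<^esub> fiber f v = fiber f (scale (sval r f R) v)"
    by (simp add: sections_Res quotient_module_def)
qed

text \<open>The union over all \<open>n\<close>, \<open>h\<close> and all representatives collapses:
  \<open>g ^ (n * q) = f ^ q * h ^ q\<close> lets any two choices be compared by cross
  multiplication.\<close>

lemma restriction_fraction:
  assumes f: "f \<in> base" and g: "g \<in> base" and n: "g ^ n = f * h" and m: "m \<in> level f k"
  shows "restriction (sheaf_of M) f g (fraction M f m k) = fraction M g (h ^ k \<odot>\<^bsub>M\<^esub> m) (n * k)"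
    "h ^ k \<odot>\<^bsub>M\<^esub> m \<in> level g (n * k)"
proof -
  have lev: "h ^ k \<odot>\<^bsub>M\<^esub> m \<in> level g (n * k)" if n: "g ^ n = f * h" and m: "m \<in> level f k" for n h m k
  proof -
    have "f * h \<in> homog (int n * int (tdeg g))"
      unfolding n[symmetric] by (rule homog_power[OF base_degree(1)[OF g]])
    from homog_cofactor[OF base_degree(1,3)[OF f] this]
    have "h ^ k \<in> homog (int k * (int n * int (tdeg g) - int (tdeg f)))" by (rule homog_power)
    from hcomp_smult[OF this m[unfolded level_def]] show ?thesis
      by (simp add: level_def algebra_simps)
  qed
  show hm: "h ^ k \<odot>\<^bsub>M\<^esub> m \<in> level g (n * k)" by (rule lev[OF n m])
  have *: "fraction M g (h\<^sub>1 ^ k\<^sub>1 \<odot>\<^bsub>M\<^esub> m\<^sub>1) (n\<^sub>1 * k\<^sub>1) = fraction M g (h ^ k \<odot>\<^bsub>M\<^esub> m) (n * k)"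
    if mem: "(m\<^sub>1, k\<^sub>1) \<in> fraction M f m k" and n1: "g ^ n\<^sub>1 = f * h\<^sub>1" for m\<^sub>1 k\<^sub>1 n\<^sub>1 h\<^sub>1
  proof -
    obtain p where m1: "m\<^sub>1 \<in> level f k\<^sub>1" and p: "f ^ (p + k\<^sub>1) \<odot>\<^bsub>M\<^esub> m = f ^ (p + k) \<odot>\<^bsub>M\<^esub> m\<^sub>1"
      using mem unfolding fraction_iff by blast
    note c = level_carrier[OF m] level_carrier[OF m1]
    have pow: "g ^ (n * q) = f ^ q * h ^ q" "g ^ (q * n) = f ^ q * h ^ q"
      "g ^ (n\<^sub>1 * q) = f ^ q * h\<^sub>1 ^ q" "g ^ (q * n\<^sub>1) = f ^ q * h\<^sub>1 ^ q" for q
      by (simp_all add: mult.commute[of q] power_mult n n1 power_mult_distrib)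
    have "g ^ (n * p + n * k) \<odot>\<^bsub>M\<^esub> (h\<^sub>1 ^ k\<^sub>1 \<odot>\<^bsub>M\<^esub> m\<^sub>1) = (h ^ (p + k) * h\<^sub>1 ^ k\<^sub>1) \<odot>\<^bsub>M\<^esub> (f ^ (p + k) \<odot>\<^bsub>M\<^esub> m\<^sub>1)"
      using c by (simp add: smult_smult power_add pow ac_simps)
    also have "\<dots> = g ^ (n * p + n\<^sub>1 * k\<^sub>1) \<odot>\<^bsub>M\<^esub> (h ^ k \<odot>\<^bsub>M\<^esub> m)"
      unfolding p[symmetric] using c by (simp add: smult_smult power_add pow ac_simps)
    finally show ?thesis by (rule fraction_eqI[OF lev[OF n1 m1] hm])
  qed
  have "restriction (sheaf_of M) f g (fraction M f m k)
      = (\<Union>(m, k)\<in>fraction M f m k. \<Union>(n, h)\<in>{(n, h). g ^ n = f * h}. fraction M g (h ^ k \<odot>\<^bsub>M\<^esub> m) (n * k))"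
    by (simp add: sheaf_of_def)
  also have "\<dots> = (\<Union>(m\<^sub>1, k\<^sub>1)\<in>fraction M f m k. \<Union>(n\<^sub>1, h\<^sub>1)\<in>{(n, h). g ^ n = f * h}. fraction M g (h ^ k \<odot>\<^bsub>M\<^esub> m) (n * k))"
    using * by (intro SUP_cong refl) auto
  also have "\<dots> = fraction M g (h ^ k \<odot>\<^bsub>M\<^esub> m) (n * k)"
    using fraction_self[OF m] n by auto
  finally show "restriction (sheaf_of M) f g (fraction M f m k) = fraction M g (h ^ k \<odot>\<^bsub>M\<^esub> m) (n * k)" .
qed

text \<open>The relation \<open>g ^ n = f * h\<close> restricts to the line. If \<open>g\<close> is
  nonzero there, so are \<open>f\<close> and \<open>h\<close>, and the fraction keeps its value in
  \<open>K\<close>.\<close>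

lemma restriction_val:
  assumes f: "f \<in> base" and g: "g \<in> base" and n: "f dvd g ^ n" and x: "x \<in> carrier (Loc f)"
  shows "restriction (sheaf_of M) f g x \<in> carrier (Loc g)"
    "val g (restriction (sheaf_of M) f g x) = (if r g = 0 then 0 else val f x)"
proof -
  obtain m k where m: "m \<in> level f k" "x = fraction M f m k" using x by (auto simp: Loc_carrier)
  obtain h where h: "g ^ n = f * h" using n by (auto simp: dvd_def)
  note rf = restriction_fraction[OF f g h m(1)]
  show "restriction (sheaf_of M) f g x \<in> carrier (Loc g)"
    unfolding m(2) rf(1) by (rule Loc_carrierI[OF rf(2)])
  have rgn: "r g ^ n = r f * r h" using arg_cong[OF h, of r] by simp
  show "val g (restriction (sheaf_of M) f g x) = (if r g = 0 then 0 else val f x)"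
  proof (cases "r g = 0")
    case True
    then show ?thesis unfolding m(2) rf(1) val_fraction[OF rf(2)] by (simp add: zero_prod_def)
  next
    case False
    then have nz: "r f \<noteq> 0" "r h \<noteq> 0" using rgn by auto
    have "to_fract (r g) ^ (n * k) = to_fract (r f) ^ k * to_fract (r h) ^ k"
      by (simp add: power_mult power_mult_distrib to_fract_power[symmetric] rgn del: to_fract_mult)
        (simp add: to_fract_power power_mult_distrib)
    then show ?thesis
      unfolding m(2) rf(1) val_fraction[OF rf(2)] val_fraction[OF m(1)]
      using False nz level_carrier[OF m(1)] by (simp add: ev_smult to_fract_power)
  qed
qed

lemma Res_restriction:
  assumes f: "f \<in> base" and g: "g \<in> base" and n: "f dvd g ^ n" and v: "v \<in> value_set f"
  shows "restriction Res f g (fiber f v) = fiber g (if r g = 0 then 0 else v)"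
    "(if r g = 0 then 0 else v) \<in> value_set g"
proof -
  obtain x where x: "x \<in> carrier (Loc f)" "val f x = v" using fiber_nonempty[OF v] by blast
  show "(if r g = 0 then 0 else v) \<in> value_set g"
    unfolding value_set_def using imageI[OF restriction_val(1)[OF f g n x(1)], of "val g"]
    by (simp only: restriction_val(2)[OF f g n x(1)] x(2))
  have "line_kernel g +>\<^bsub>Loc g\<^esub> restriction (sheaf_of M) f g y = fiber g (if r g = 0 then 0 else v)" if "y \<in> fiber f v" for y
  proof -
    have y: "y \<in> carrier (Loc f)" "val f y = v" using that by (simp_all add: fiber_def)
    show ?thesis unfolding kernel_coset[OF g restriction_val(1)[OF f g n y(1)]] restriction_val(2)[OF f g n y(1)] y(2) ..
  qed
  moreover have "x \<in> fiber f v" using x by (simp add: fiber_def)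
  ultimately have "(\<Union>y\<in>fiber f v. line_kernel g +>\<^bsub>Loc g\<^esub> restriction (sheaf_of M) f g y) = fiber g (if r g = 0 then 0 else v)"
    by blast
  moreover have "sections (sheaf_of M) g = Loc g" by (simp add: sheaf_of_def)
  ultimately show "restriction Res f g (fiber f v) = fiber g (if r g = 0 then 0 else v)"
    by (simp add: restrict_to_def)
qed

theorem realizes_Res: "realizes r Res class_val value_set"
  unfolding realizes_def
proof (rule ballI, intro conjI ballI impI, goal_cases)
  case (1 f)
  have "inj_on (class_val f) (fiber f ` value_set f)" by (auto simp: inj_on_def class_val_fiber)
  moreover have "class_val f ` fiber f ` value_set f = value_set f"
    unfolding image_image by (simp add: class_val_fiber)
  ultimately show ?case unfolding Res_carrier[OF 1] bij_betw_def by blast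
next
  case (2 f x y)
  then obtain v w where v: "v \<in> value_set f" "x = fiber f v" and w: "w \<in> value_set f" "y = fiber f w"
    unfolding Res_carrier[OF 2(1)] by blast
  show ?case unfolding v(2) w(2) Res_add(1)[OF 2(1) v(1) w(1)] Res_carrier[OF 2(1)]
    by (rule imageI[OF Res_add(2)[OF 2(1) v(1) w(1)]])
next
  case (3 f x y)
  then obtain v w where v: "v \<in> value_set f" "x = fiber f v" and w: "w \<in> value_set f" "y = fiber f w"
    unfolding Res_carrier[OF 3(1)] by blast
  show ?case
    unfolding v(2) w(2) Res_add(1)[OF 3(1) v(1) w(1)] class_val_fiber[OF v(1)] class_val_fiber[OF w(1)]
    by (rule class_val_fiber[OF Res_add(2)[OF 3(1) v(1) w(1)]])
next
  case (4 f R x)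
  then obtain v where v: "v \<in> value_set f" "x = fiber f v" unfolding Res_carrier[OF 4(1)] by blast
  show ?case unfolding v(2) Res_smult(1)[OF 4(1,2) v(1)] Res_carrier[OF 4(1)]
    by (rule imageI[OF Res_smult(2)[OF 4(1,2) v(1)]])
next
  case (5 f R x)
  then obtain v where v: "v \<in> value_set f" "x = fiber f v" unfolding Res_carrier[OF 5(1)] by blast
  show ?case
    unfolding v(2) Res_smult(1)[OF 5(1,2) v(1)] class_val_fiber[OF v(1)]
    by (rule class_val_fiber[OF Res_smult(2)[OF 5(1,2) v(1)]])
next
  case (6 f g x)
  then obtain n v where n: "f dvd g ^ n" and v: "v \<in> value_set f" "x = fiber f v"
    unfolding Res_carrier[OF 6(1)] by blast
  show ?case unfolding v(2) Res_restriction(1)[OF 6(1,2) n v(1)] Res_carrier[OF 6(2)]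
    by (rule imageI[OF Res_restriction(2)[OF 6(1,2) n v(1)]])
next
  case (7 f g x)
  then obtain n v where n: "f dvd g ^ n" and v: "v \<in> value_set f" "x = fiber f v"
    unfolding Res_carrier[OF 7(1)] by blast
  show ?case unfolding v(2) Res_restriction(1)[OF 7(1,2) n v(1)] class_val_fiber[OF v(1)]
    by (rule class_val_fiber[OF Res_restriction(2)[OF 7(1,2) n v(1)]])
qed

end

section \<open>Points, lines and vanishing ideals\<close>

text \<open>The coefficients of \<open>Y - u X - v W\<close> in the variables, that is, the point
  whose dual line is \<open>Y = u X + v W\<close>.\<close>

definition dual_vec :: "complex \<Rightarrow> complex \<Rightarrow> complex \<Rightarrow> complex ^ 3"
  where "dual_vec s u v = vector [1 + s * u + s\<^sup>2 * v, - u, - v]"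

text \<open>The linear form with coefficients \<open>c\<close> at the centre
  \<open>(1 : s : s^2)\<close>. It is nonzero iff the line with these coefficients avoids the centre
  and can be written as \<open>Y = u X + v W\<close>.\<close>

definition height :: "complex \<Rightarrow> complex ^ 3 \<Rightarrow> complex"
  where "height s c = c $ 1 + s * c $ 2 + s\<^sup>2 * c $ 3"

lemma dual_vec_components [simp]:
  "dual_vec s u v $ 1 = 1 + s * u + s\<^sup>2 * v" "dual_vec s u v $ 2 = - u" "dual_vec s u v $ 3 = - v"
  by (simp_all add: dual_vec_def vector_3)

lemma height_dual_vec [simp]: "height s (dual_vec s u v) = 1"
  by (simp add: height_def)

lemma dual_vec_nonzero: "dual_vec s u v \<noteq> 0"
proof
  assume "dual_vec s u v = 0"
  then have "height s (dual_vec s u v) = height s 0" by (simp only:)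
  also have "\<dots> = 0" by (simp add: height_def)
  finally show False unfolding height_dual_vec by simp
qed

lemma eval_line_form: "eval_at (line_form s u v) y = (\<Sum>i\<in>UNIV. dual_vec s u v $ i * y $ i)"
  by (simp add: line_form_def form_x_def form_w_def sum_3 algebra_simps)

lemma proj_plane_iff: "p \<in> proj_plane \<longleftrightarrow> (\<exists>c. c \<noteq> 0 \<and> p = vec.span {c})"
proof
  assume "p \<in> proj_plane"
  then have p: "vec.subspace p" "vec.dim p = 1" by (simp_all add: proj_plane_def)
  obtain B where B: "B \<subseteq> p" "vec.independent B" "p \<subseteq> vec.span B" "card B = vec.dim p"
    using vec.basis_exists[of p] by blast
  then obtain c where c: "B = {c}" using p(2) by (metis card_1_singletonE)
  have "c \<noteq> 0" using B(2) vec.dependent_zero[of B] by (auto simp: c)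
  moreover have "p = vec.span {c}"
    using B(1,3) p(1) vec.span_minimal[of B p] by (auto simp: c)
  ultimately show "\<exists>c. c \<noteq> 0 \<and> p = vec.span {c}" by blast
next
  assume "\<exists>c. c \<noteq> 0 \<and> p = vec.span {c}"
  then obtain c where c: "c \<noteq> 0" "p = vec.span {c}" by blast
  then show "p \<in> proj_plane" by (simp add: proj_plane_def)
qed

lemma span_scale: "k \<noteq> 0 \<Longrightarrow> vec.span {k *s c} = vec.span {c :: complex ^ 3}"
proof -
  assume k: "k \<noteq> 0"
  have "vec.span {k *s c} \<subseteq> vec.span {c}" "vec.span {c} \<subseteq> vec.span {k *s c}"
  proof -
    show "vec.span {k *s c} \<subseteq> vec.span {c}"
      by (rule vec.span_minimal) (auto intro: vec.span_scale vec.span_base)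
    have "c = (1 / k) *s (k *s c)" using k by simp
    also have "\<dots> \<in> vec.span {k *s c}" by (intro vec.span_scale vec.span_base) simp
    finally show "vec.span {c} \<subseteq> vec.span {k *s c}" by (intro vec.span_minimal) auto
  qed
  then show ?thesis by blast
qed

lemma span_eq_dual_vec:
  assumes "height s c \<noteq> 0"
  shows "vec.span {c} = vec.span {dual_vec s (- c $ 2 / height s c) (- c $ 3 / height s c)}"
proof -
  have "dual_vec s (- c $ 2 / height s c) (- c $ 3 / height s c) = (1 / height s c) *s c"
  proof (rule vec_eq_iff[THEN iffD2], rule allI)
    fix i :: 3
    have "(1 + s * (- c $ 2 / height s c) + s\<^sup>2 * (- c $ 3 / height s c)) * height s c = c $ 1"
      using assms by (simp add: algebra_simps) (simp add: height_def algebra_simps)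
    then have "1 + s * (- c $ 2 / height s c) + s\<^sup>2 * (- c $ 3 / height s c) = c $ 1 / height s c"
      using assms by (simp add: eq_divide_eq)
    then show "dual_vec s (- c $ 2 / height s c) (- c $ 3 / height s c) $ i = ((1 / height s c) *s c) $ i"
      using exhaust_3[of i] by auto
  qed
  then show ?thesis using span_scale[of "1 / height s c" c] assms by simp
qed

definition affine_line :: "complex \<Rightarrow> complex \<Rightarrow> complex \<Rightarrow> (complex ^ 3) set set"
  where "affine_line s u v = dual_line (vec.span {dual_vec s u v})"

lemma affine_line_iff: "q \<in> affine_line s u v \<longleftrightarrow> q \<in> proj_plane \<and> (\<forall>y\<in>q. eval_at (line_form s u v) y = 0)"
proof -
  have "(\<forall>c\<in>vec.span {dual_vec s u v}. \<forall>y\<in>q. (\<Sum>i\<in>UNIV. c $ i * y $ i) = 0)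
    \<longleftrightarrow> (\<forall>y\<in>q. eval_at (line_form s u v) y = 0)"
    unfolding vec.span_singleton eval_line_form
    by (auto simp: sum_distrib_left[symmetric] mult.assoc intro!: vec.span_base)
  then show ?thesis by (simp add: affine_line_def dual_line_def)
qed

text \<open>A point is a subspace and contains \<open>0\<close>, so membership in the ideal also
  tests \<open>f\<close> at \<open>0\<close>, provided that the line has a point. Hence the separate
  clause.\<close>

lemma vanishing_iff:
  "f \<in> vanishing_ideal (affine_line s u v) \<longleftrightarrow> (\<forall>y. y \<noteq> 0 \<longrightarrow> eval_at (line_form s u v) y = 0 \<longrightarrow> eval_at f y = 0)
    \<and> (affine_line s u v \<noteq> {} \<longrightarrow> eval_at f 0 = 0)"
proof (intro iffI conjI allI impI)
  assume f: "f \<in> vanishing_ideal (affine_line s u v)"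
  fix y assume y: "y \<noteq> 0" "eval_at (line_form s u v) y = 0"
  have "eval_at (line_form s u v) (t *s y) = 0" for t
    using eval_at_scale[of "line_form s u v" 1 t y] forms_homog(3) y(2) by simp
  then have "vec.span {y} \<in> affine_line s u v"
    using y(1) by (auto simp: affine_line_iff proj_plane_iff vec.span_singleton)
  then show "eval_at f y = 0" using f vec.span_base[of y "{y}"] by (auto simp: vanishing_ideal_def)
next
  assume f: "f \<in> vanishing_ideal (affine_line s u v)" and "affine_line s u v \<noteq> {}"
  then obtain q where q: "q \<in> affine_line s u v" by blast
  then have "0 \<in> q" by (auto simp: affine_line_iff proj_plane_iff vec.span_zero)
  then show "eval_at f 0 = 0" using f q by (auto simp: vanishing_ideal_def)
next
  assume *: "(\<forall>y. y \<noteq> 0 \<longrightarrow> eval_at (line_form s u v) y = 0 \<longrightarrow> eval_at f y = 0)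
    \<and> (affine_line s u v \<noteq> {} \<longrightarrow> eval_at f 0 = 0)"
  have "eval_at f y = 0" if q: "q \<in> affine_line s u v" "y \<in> q" for q y
  proof (cases "y = 0")
    case True
    then show ?thesis using * q(1) by blast
  next
    case False
    have "eval_at (line_form s u v) y = 0" using q unfolding affine_line_iff by blast
    then show ?thesis using * False by blast
  qed
  then show "f \<in> vanishing_ideal (affine_line s u v)" by (auto simp: vanishing_ideal_def)
qed

lemma vanishing_multiple: "line_form s u v * g \<in> vanishing_ideal (affine_line s u v)"
  by (auto simp: vanishing_ideal_def affine_line_iff)

lemma restr_zero_if_vanishing:
  assumes "\<And>y. y \<noteq> 0 \<Longrightarrow> eval_at (line_form s u v) y = 0 \<Longrightarrow> eval_at f y = 0"
  shows "restr s u v f = 0"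
proof -
  have "poly (restr s u v f) x = 0" for x
    unfolding poly_rho
  proof (rule assms)
    have "eval_at (form_w s) (x *s pencil_dir s u + pencil_base s v) = 1"
      by (simp add: form_w_def algebra_simps)
    moreover have "eval_at (form_w s) 0 = 0" by (simp add: form_w_def)
    ultimately show "x *s pencil_dir s u + pencil_base s v \<noteq> 0" by auto
    have "poly (restr s u v (line_form s u v)) x = 0" by simp
    then show "eval_at (line_form s u v) (x *s pencil_dir s u + pencil_base s v) = 0" unfolding poly_rho .
  qed
  then show ?thesis using poly_all_0_iff_0 by blast
qed

text \<open>\<open>f\<close> need not be homogeneous. Its values at \<open>t y\<close>,
  \<open>t \<noteq> 0\<close>, are those of a polynomial in \<open>t\<close> whose coefficients are
  the homogeneous components of \<open>f\<close> at \<open>y\<close>. So every component vanishes on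
  the line and is a multiple of its equation.\<close>

lemma vanishing_imp_multiple:
  assumes "f \<in> vanishing_ideal (affine_line s u v)"
  shows "\<exists>g. f = line_form s u v * g"
proof -
  have comp: "eval_at (hcomponent d f) y = 0" if y: "y \<noteq> 0" "eval_at (line_form s u v) y = 0" for d y
  proof -
    obtain N where N: "f = (\<Sum>d\<le>N. hcomponent d f)" using sum_hcomponent by blast
    define p where "p = (\<Sum>d\<le>N. monom (eval_at (hcomponent d f) y) d)"
    have "poly p t = 0" if "t \<noteq> 0" for t
    proof -
      have "eval_at (line_form s u v) (t *s y) = 0"
        using eval_at_scale[of "line_form s u v" 1 t y] forms_homog(3) y(2) by simp
      then have "eval_at f (t *s y) = 0" using assms y(1) that by (simp add: vanishing_iff)
      then have "(\<Sum>d\<le>N. eval_at (hcomponent d f) (t *s y)) = 0" by (subst (asm) N) (simp add: eval_at_sum)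
      then show ?thesis
        unfolding p_def poly_sum_monom by (simp add: eval_at_scale[OF homog_hcomponent] mult.commute)
    qed
    then have "p = 0" by (intro poly_zero_if_cofinite[of "{0}"]) auto
    then have *: "eval_at (hcomponent d f) y = 0" if "d \<le> N" for d
      using coeff_sum_monom[of "\<lambda>d. eval_at (hcomponent d f) y" N d] that by (simp add: p_def)
    show ?thesis
    proof (cases "d \<le> N")
      case False
      have sum0: "hcomponent d (\<Sum>d\<in>A. hcomponent d f) = 0" if "finite A" "d \<notin> A" for A
        using that by (induction A rule: finite_induct) (auto simp: hcomponent_add hcomponent_homog[OF homog_hcomponent])
      have "hcomponent d f = 0" using sum0[of "{..N}"] False by (subst N) auto
      then show ?thesis by simp
    qed (rule *)
  qed
  have "\<exists>g. hcomponent d f = line_form s u v * g" for d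
    using line_frame.rho_eq_0_imp_multiple[OF line_frame_pencil homog_hcomponent restr_zero_if_vanishing[OF comp]]
    by blast
  then obtain g where g: "\<And>d. hcomponent d f = line_form s u v * g d" by metis
  obtain N where "f = (\<Sum>d\<le>N. hcomponent d f)" using sum_hcomponent by blast
  then have "f = line_form s u v * (\<Sum>d\<le>N. g d)" by (simp add: g sum_distrib_left)
  then show ?thesis by blast
qed

lemma affine_line_ideal: "vanishing_ideal (affine_line s u v) \<inter> homog d = {g \<in> homog d. restr s u v g = 0}"
proof (intro equalityI subsetI)
  fix g assume "g \<in> vanishing_ideal (affine_line s u v) \<inter> homog d"
  then have g: "g \<in> vanishing_ideal (affine_line s u v)" "g \<in> homog d" by auto
  have "restr s u v g = 0"
    by (rule restr_zero_if_vanishing) (use g(1)[unfolded vanishing_iff] in blast)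
  then show "g \<in> {g \<in> homog d. restr s u v g = 0}" using g(2) by blast
next
  fix g assume "g \<in> {g \<in> homog d. restr s u v g = 0}"
  then have g: "g \<in> homog d" "restr s u v g = 0" by auto
  obtain h where "g = line_form s u v * h"
    by (rule line_frame.rho_eq_0_imp_multiple[OF line_frame_pencil g])
  then show "g \<in> vanishing_ideal (affine_line s u v) \<inter> homog d"
    using vanishing_multiple g(1) by blast
qed

section \<open>The module of logarithmic derivations modulo the Euler derivation\<close>

lemma derivation_simps:
  assumes "derivation \<theta>"
  shows "\<theta> (f + g) = \<theta> f + \<theta> g" "\<theta> (f - g) = \<theta> f - \<theta> g" "\<theta> (Const c * f) = Const c * \<theta> f"
    "\<theta> (f * g) = f * \<theta> g + g * \<theta> f" "\<theta> 0 = 0"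
proof -
  show add: "\<theta> (f + g) = \<theta> f + \<theta> g" for f g using assms by (auto simp: derivation_def)
  show "\<theta> (Const c * f) = Const c * \<theta> f" "\<theta> (f * g) = f * \<theta> g + g * \<theta> f" using assms by (auto simp: derivation_def)
  show "\<theta> (f - g) = \<theta> f - \<theta> g" using add[of "f - g" g] by (simp add: algebra_simps)
  show "\<theta> 0 = 0" using add[of 0 0] by simp
qed

lemma derivation_lincomb:
  assumes "derivation \<theta>" "derivation \<theta>'"
  shows "derivation (\<lambda>f. g * \<theta> f + h * \<theta>' f)"
  unfolding derivation_def
proof (intro conjI allI)
  fix f k c
  show "g * \<theta> (f + k) + h * \<theta>' (f + k) = g * \<theta> f + h * \<theta>' f + (g * \<theta> k + h * \<theta>' k)"
    unfolding derivation_simps(1)[OF assms(1)] derivation_simps(1)[OF assms(2)] by (simp add: algebra_simps)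
  show "g * \<theta> (Const c * f) + h * \<theta>' (Const c * f) = Const c * (g * \<theta> f + h * \<theta>' f)"
    unfolding derivation_simps(3)[OF assms(1)] derivation_simps(3)[OF assms(2)] by (simp add: algebra_simps)
  show "g * \<theta> (f * k) + h * \<theta>' (f * k) = f * (g * \<theta> k + h * \<theta>' k) + k * (g * \<theta> f + h * \<theta>' f)"
    unfolding derivation_simps(4)[OF assms(1)] derivation_simps(4)[OF assms(2)] by (simp add: algebra_simps)
qed

lemma derivation_mult: "derivation \<theta> \<Longrightarrow> derivation (\<lambda>f. g * \<theta> f)"
  using derivation_lincomb[of \<theta> \<theta> g 0] by simp

lemma derivation_sum: "derivation \<theta> \<Longrightarrow> derivation \<theta>' \<Longrightarrow> derivation (\<lambda>f. \<theta> f + \<theta>' f)"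
  using derivation_lincomb[of \<theta> \<theta>' 1 1] by simp

definition components :: "complex \<Rightarrow> (poly3 \<Rightarrow> poly3) \<Rightarrow> poly3 \<times> poly3 \<times> poly3"
  where "components s \<theta> = (\<theta> (form_x s), \<theta> (form_w s), \<theta> (Var 1))"

lemma derivation_eqI:
  assumes d: "derivation \<theta>" "derivation \<theta>'" and c: "components s \<theta> = components s \<theta>'"
  shows "\<theta> = \<theta>'"
proof
  fix f
  have "\<theta> (Var i) = \<theta>' (Var i)" for i
    using exhaust_3[of i] c Var_eq_forms(1)[of s] Var_eq_forms(2)[of s] derivation_simps(1,3)[OF d(1)] derivation_simps(1,3)[OF d(2)]
    unfolding components_def by (metis prod.inject)
  then show "\<theta> f = \<theta>' f" unfolding derivation_eq[OF d(1), of f] derivation_eq[OF d(2), of f] by simp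
qed

text \<open>\<open>X\<close>, \<open>W\<close> and \<open>Var 1\<close> are linear coordinates, so a
  derivation may take any values on them. \<open>G\<close> translates these values back to the
  variables.\<close>

lemma derivation_with_components:
  obtains \<theta> where "derivation \<theta>" "components s \<theta> = F"
proof -
  obtain FX FW FY where F: "F = (FX, FW, FY)" by (cases F)
  define G :: "3 \<Rightarrow> poly3" where
    "G i = (if i = 1 then FY else if i = 2 then FX + Const s * FY else FW + Const (s\<^sup>2) * FY)" for i
  define \<theta> where "\<theta> f = (\<Sum>i\<in>UNIV. G i * pderivative i f)" for f
  have d: "derivation \<theta>" unfolding \<theta>_def[abs_def] by (rule derivation_combination)
  have v: "\<theta> (Var i) = G i" for i by (simp add: \<theta>_def pderivative_Var if_distrib cong: if_cong)
  have "components s \<theta> = F"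
    unfolding components_def form_x_def form_w_def
    by (simp add: derivation_simps(2,3)[OF d] v G_def F)
  with d show thesis by (rule that)
qed

lemma components_euler: "components s (\<lambda>f. g * euler f) = (form_x s * g, form_w s * g, Var 1 * g)"
  using euler_homog[of "form_x s" 1] euler_homog[of "form_w s" 1] forms_homog
  by (simp add: components_def mult.commute)

definition euler_class :: "(poly3 \<Rightarrow> poly3) \<Rightarrow> (poly3 \<Rightarrow> poly3) set"
  where "euler_class \<theta> = {\<lambda>f. g * euler f + \<theta> f | g. True}"

lemma euler_class_eq_iff: "euler_class \<theta> = euler_class \<theta>' \<longleftrightarrow> (\<exists>g. \<theta> = (\<lambda>f. g * euler f + \<theta>' f))"
proof
  assume "euler_class \<theta> = euler_class \<theta>'"
  moreover have "\<theta> \<in> euler_class \<theta>" unfolding euler_class_def by (auto intro: exI[of _ 0])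
  ultimately show "\<exists>g. \<theta> = (\<lambda>f. g * euler f + \<theta>' f)" by (auto simp: euler_class_def)
next
  assume "\<exists>g. \<theta> = (\<lambda>f. g * euler f + \<theta>' f)"
  then obtain g where g: "\<theta> = (\<lambda>f. g * euler f + \<theta>' f)" by blast
  have "(\<lambda>f. h * euler f + \<theta> f) = (\<lambda>f. (h + g) * euler f + \<theta>' f)"
    "(\<lambda>f. h * euler f + \<theta>' f) = (\<lambda>f. (h - g) * euler f + \<theta> f)" for h
    unfolding g by (simp_all add: algebra_simps)
  then show "euler_class \<theta> = euler_class \<theta>'" unfolding euler_class_def by blast
qed

lemma euler_class_self: "\<theta> \<in> euler_class \<theta>"
  unfolding euler_class_def by (auto intro: exI[of _ 0])

lemma D_coset: "{(\<lambda>f. g * euler f) | g. True} +>\<^bsub>D_module A\<^esub> \<theta> = euler_class \<theta>"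
  by (auto simp: a_r_coset_def' D_module_def euler_class_def)

lemma D_coset_fun: "(+>\<^bsub>D_module A\<^esub>) {(\<lambda>f. g * euler f) | g. True} = euler_class"
  by (rule ext) (rule D_coset)

lemma D_carrier: "carrier (D_module A) = log_derivations A"
  by (simp add: D_module_def)

lemma D0_carrier: "carrier (D0_module A) = euler_class ` log_derivations A"
  unfolding D0_module_def graded_quotient_def module.extend_def quotient_module_def graded_module.fields_def
    A_RCOSETS_def' D_coset D_coset_fun D_carrier
  by auto

lemma D0_hcomp: "hcomp (D0_module A) d = euler_class ` hcomp (D_module A) d"
  unfolding D0_module_def graded_quotient_def module.extend_def quotient_module_def graded_module.fields_def
    D_coset D_coset_fun
  by simp

lemma D0_zero: "\<zero>\<^bsub>D0_module A\<^esub> = euler_class (\<lambda>f. 0)"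
  by (simp add: D0_module_def graded_quotient_def module.extend_def quotient_module_def graded_module.fields_def euler_class_def)

lemma D0_add: "euler_class \<theta> \<oplus>\<^bsub>D0_module A\<^esub> euler_class \<theta>' = euler_class (\<lambda>f. \<theta> f + \<theta>' f)"
proof -
  have "euler_class \<theta> \<oplus>\<^bsub>D0_module A\<^esub> euler_class \<theta>' = euler_class \<theta> <+>\<^bsub>D_module A\<^esub> euler_class \<theta>'"
    by (simp add: D0_module_def graded_quotient_def module.extend_def quotient_module_def graded_module.fields_def)
  also have "\<dots> = {\<lambda>f. (g * euler f + \<theta> f) + (h * euler f + \<theta>' f) | g h. True}"
    by (auto simp: set_add_def' D_module_def euler_class_def)
  also have "\<dots> = euler_class (\<lambda>f. \<theta> f + \<theta>' f)"
  proof (intro equalityI subsetI)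
    fix \<zeta> assume "\<zeta> \<in> {\<lambda>f. (g * euler f + \<theta> f) + (h * euler f + \<theta>' f) | g h. True}"
    then obtain g h where "\<zeta> = (\<lambda>f. (g * euler f + \<theta> f) + (h * euler f + \<theta>' f))" by blast
    then have "\<zeta> = (\<lambda>f. (g + h) * euler f + (\<theta> f + \<theta>' f))" by (simp add: algebra_simps)
    then show "\<zeta> \<in> euler_class (\<lambda>f. \<theta> f + \<theta>' f)" unfolding euler_class_def by blast
  next
    fix \<zeta> assume "\<zeta> \<in> euler_class (\<lambda>f. \<theta> f + \<theta>' f)"
    then obtain g where "\<zeta> = (\<lambda>f. g * euler f + (\<theta> f + \<theta>' f))" unfolding euler_class_def by blast
    then have "\<zeta> = (\<lambda>f. (g * euler f + \<theta> f) + (0 * euler f + \<theta>' f))" by (simp add: algebra_simps)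
    then show "\<zeta> \<in> {\<lambda>f. (g * euler f + \<theta> f) + (h * euler f + \<theta>' f) | g h. True}" by blast
  qed
  finally show ?thesis .
qed

lemma D0_smult: "h \<odot>\<^bsub>D0_module A\<^esub> euler_class \<theta> = euler_class (\<lambda>f. h * \<theta> f)"
proof -
  have "h \<odot>\<^bsub>D0_module A\<^esub> euler_class \<theta> = (\<Union>\<zeta>\<in>euler_class \<theta>. euler_class (\<lambda>f. h * \<zeta> f))"
    unfolding D0_module_def graded_quotient_def module.extend_def quotient_module_def graded_module.fields_def
      D_coset D_coset_fun
    by simp (simp add: D_module_def)
  moreover have "euler_class (\<lambda>f. h * \<zeta> f) = euler_class (\<lambda>f. h * \<theta> f)" if mem: "\<zeta> \<in> euler_class \<theta>" for \<zeta>
  proof -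
    obtain g where "\<zeta> = (\<lambda>f. g * euler f + \<theta> f)" using mem unfolding euler_class_def by blast
    then have "(\<lambda>f. h * \<zeta> f) = (\<lambda>f. (h * g) * euler f + h * \<theta> f)" by (simp add: algebra_simps)
    then show ?thesis unfolding euler_class_eq_iff by (rule exI)
  qed
  then have "(\<Union>\<zeta>\<in>euler_class \<theta>. euler_class (\<lambda>f. h * \<zeta> f)) = (\<Union>\<zeta>\<in>euler_class \<theta>. euler_class (\<lambda>f. h * \<theta> f))"
    by (rule SUP_cong[OF refl])
  moreover have "\<dots> = euler_class (\<lambda>f. h * \<theta> f)" using euler_class_self[of \<theta>] by blast
  ultimately show ?thesis by (simp only:)
qed

lemma log_derivations_mult: "\<theta> \<in> log_derivations A \<Longrightarrow> (\<lambda>f. g * \<theta> f) \<in> log_derivations A"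
  by (auto simp: log_derivations_def derivation_mult vanishing_ideal_def image_subset_iff)

lemma log_derivations_add: "\<theta> \<in> log_derivations A \<Longrightarrow> \<theta>' \<in> log_derivations A \<Longrightarrow> (\<lambda>f. \<theta> f + \<theta>' f) \<in> log_derivations A"
  by (auto simp: log_derivations_def derivation_sum vanishing_ideal_def image_subset_iff)

lemma log_derivations_zero: "(\<lambda>f. 0) \<in> log_derivations A"
  by (auto simp: log_derivations_def derivation_def vanishing_ideal_def)

lemma D_hcomp: "hcomp (D_module A) d = {\<theta> \<in> log_derivations A. \<forall>l\<in>homog 1. \<theta> l \<in> homog d}"
  by (simp add: D_module_def)

text \<open>\<open>Z\<close> is its own index set: \<open>(\<xi> p, \<eta> p)\<close> are the
  coefficients of the line dual to \<open>p\<close>, which in this form avoids the centre.\<close>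

locale arrangement_lines = lines s Z \<xi> \<eta>
  for s :: complex and Z :: "(complex ^ 3) set set" and \<xi> \<eta> +
  assumes point_eq: "p \<in> Z \<Longrightarrow> p = vec.span {dual_vec s (\<xi> p) (\<eta> p)}"
begin

abbreviation "D \<equiv> D_module (arrangement Z)"

abbreviation "D0 \<equiv> D0_module (arrangement Z)"

abbreviation "form_of p \<equiv> line_form s (\<xi> p) (\<eta> p)"

abbreviation "ideal_of p \<equiv> vanishing_ideal (affine_line s (\<xi> p) (\<eta> p))"

lemma dual_line_eq: "p \<in> Z \<Longrightarrow> dual_line p = affine_line s (\<xi> p) (\<eta> p)"
  unfolding affine_line_def using point_eq by metis

text \<open>The ideal of a line is generated by its equation, so by the Leibniz rule the generator
  is all that has to be tested.\<close>

lemma log_derivations_iff: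
  "\<theta> \<in> log_derivations (arrangement Z) \<longleftrightarrow> derivation \<theta> \<and> (\<forall>p\<in>Z. \<theta> (form_of p) \<in> ideal_of p)"
proof
  assume \<theta>: "\<theta> \<in> log_derivations (arrangement Z)"
  have "\<theta> (form_of p) \<in> ideal_of p" if p: "p \<in> Z" for p
  proof -
    have "dual_line p \<in> arrangement Z" using p by (simp add: arrangement_def)
    then have "\<theta> ` ideal_of p \<subseteq> ideal_of p"
      using \<theta> unfolding log_derivations_def dual_line_eq[OF p, symmetric] by blast
    moreover have "form_of p \<in> ideal_of p" using vanishing_multiple[of s "\<xi> p" "\<eta> p" 1] by simp
    ultimately show ?thesis by blast
  qed
  then show "derivation \<theta> \<and> (\<forall>p\<in>Z. \<theta> (form_of p) \<in> ideal_of p)" using \<theta> by (simp add: log_derivations_def)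
next
  assume \<theta>: "derivation \<theta> \<and> (\<forall>p\<in>Z. \<theta> (form_of p) \<in> ideal_of p)"
  have "\<theta> f \<in> ideal_of p" if p: "p \<in> Z" and f: "f \<in> ideal_of p" for p f
  proof -
    obtain g where "f = form_of p * g" using vanishing_imp_multiple[OF f] by blast
    then have "\<theta> f = form_of p * \<theta> g + g * \<theta> (form_of p)" using derivation_simps(4) \<theta> by blast
    moreover have "form_of p * \<theta> g \<in> ideal_of p" by (rule vanishing_multiple)
    ultimately show ?thesis using \<theta> p by (auto simp: vanishing_ideal_def)
  qed
  then have "\<theta> ` vanishing_ideal H \<subseteq> vanishing_ideal H" if "H \<in> arrangement Z" for H
    using that dual_line_eq by (auto simp: arrangement_def)
  then show "\<theta> \<in> log_derivations (arrangement Z)" using \<theta> by (simp add: log_derivations_def)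
qed

lemma derivation_form_of:
  "derivation \<theta> \<Longrightarrow> \<theta> (form_of p) = \<theta> (Var 1) - Const (\<xi> p) * \<theta> X - Const (\<eta> p) * \<theta> W"
  by (simp add: line_form_def derivation_simps(2,3))

lemma D_hcomp_iff: "\<theta> \<in> hcomp D k \<longleftrightarrow> derivation \<theta> \<and> components s \<theta> \<in> log_fields k"
proof
  assume "\<theta> \<in> hcomp D k"
  then have \<theta>: "derivation \<theta>" "\<And>p. p \<in> Z \<Longrightarrow> \<theta> (form_of p) \<in> ideal_of p" "\<And>l. l \<in> homog 1 \<Longrightarrow> \<theta> l \<in> homog k"
    by (auto simp: D_hcomp log_derivations_iff)
  have "on p (\<theta> (form_of p)) = 0" if p: "p \<in> Z" for p
    using affine_line_ideal[of s "\<xi> p" "\<eta> p" k] \<theta>(2)[OF p] \<theta>(3)[OF forms_homog(3)] by blast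
  then show "derivation \<theta> \<and> components s \<theta> \<in> log_fields k"
    using \<theta>(1,3) forms_homog by (simp add: components_def log_fields_def derivation_form_of[OF \<theta>(1)])
next
  assume "derivation \<theta> \<and> components s \<theta> \<in> log_fields k"
  then have \<theta>: "derivation \<theta>" and h: "\<theta> X \<in> homog k" "\<theta> W \<in> homog k" "\<theta> (Var 1) \<in> homog k"
    and t: "\<And>p. p \<in> Z \<Longrightarrow> on p (\<theta> (form_of p)) = 0"
    by (auto simp: components_def log_fields_def derivation_form_of)
  have "\<theta> (form_of p) \<in> ideal_of p" if p: "p \<in> Z" for p
  proof -
    have "\<theta> (form_of p) \<in> homog k"
      unfolding derivation_form_of[OF \<theta>] by (intro homog_diff homog_Const_mult h)
    then show ?thesis using affine_line_ideal[of s "\<xi> p" "\<eta> p" k] t[OF p] by blast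
  qed
  moreover have "\<theta> l \<in> homog k" if l: "l \<in> homog 1" for l
  proof -
    have "\<theta> (Var 2) = \<theta> X + Const s * \<theta> (Var 1)" "\<theta> (Var 3) = \<theta> W + Const (s\<^sup>2) * \<theta> (Var 1)"
      unfolding Var_eq_forms(1)[of s] Var_eq_forms(2)[of s] by (simp_all only: derivation_simps(1,3)[OF \<theta>])
    then have v: "\<theta> (Var i) \<in> homog k" for i
      using exhaust_3[of i] h by (auto intro!: homog_add homog_Const_mult)
    have "pderivative i l \<in> homog 0" for i using pderivative_homog[of l 1 i] l by simp
    then show ?thesis
      unfolding derivation_eq[OF \<theta>, of l] using v by (intro homog_sum homog_mult') auto
  qed
  ultimately show "\<theta> \<in> hcomp D k" using \<theta> by (simp add: D_hcomp log_derivations_iff)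
qed

text \<open>Independent of the representative, because both components of a multiple of the Euler
  field are zero along the line.\<close>

definition class_along :: "complex \<Rightarrow> complex \<Rightarrow> (poly3 \<Rightarrow> poly3) set \<Rightarrow> complex poly \<times> complex poly"
  where "class_along u v C = along u v (components s (SOME \<theta>. \<theta> \<in> C))"

lemma along_components_add:
  "along u v (components s (\<lambda>f. \<theta> f + \<theta>' f)) = along u v (components s \<theta>) + along u v (components s \<theta>')"
  by (simp add: along_def components_def algebra_simps smult_add_right)

lemma along_components_mult:
  "along u v (components s (\<lambda>f. g * \<theta> f))
    = (restr s u v g * fst (along u v (components s \<theta>)), restr s u v g * snd (along u v (components s \<theta>)))"
  by (simp add: along_def components_def algebra_simps smult_diff_right)

lemma along_euler: "along u v (X * g, W * g, Var 1 * g) = (0, 0)"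
  by (simp add: along_def algebra_simps)

lemma class_along_euler_class: "class_along u v (euler_class \<theta>) = along u v (components s \<theta>)"
proof -
  have "(SOME \<theta>'. \<theta>' \<in> euler_class \<theta>) \<in> euler_class \<theta>" by (rule someI[of _ \<theta>]) (rule euler_class_self)
  then obtain g where g: "(SOME \<theta>'. \<theta>' \<in> euler_class \<theta>) = (\<lambda>f. g * euler f + \<theta> f)"
    unfolding euler_class_def by blast
  have "along u v (components s (\<lambda>f. g * euler f + \<theta> f)) = (0, 0) + along u v (components s \<theta>)"
    unfolding along_components_add components_euler along_euler ..
  then show ?thesis unfolding class_along_def g by (simp add: zero_prod_def[symmetric])
qed

text \<open>The module axioms are inherited from derivations. The substance is the kernel condition:
  by \<open>along_kernel\<close> a derivation with zero components along the line is a multiple of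
  the Euler field plus \<open>line_form s u v\<close> times a logarithmic derivation.\<close>

lemma restricted_D0:
  assumes uv: "general u v"
  shows "restricted_module (pencil_dir s u) (pencil_base s v) (line_form s u v) X W D0 (class_along u v) (affine_line s u v)"
proof (intro restricted_module.intro line_frame_pencil restricted_module_axioms.intro)
  fix m n p :: "(poly3 \<Rightarrow> poly3) set" and g h :: poly3 and d e :: int
  show "m \<in> carrier D0" if "m \<in> hcomp D0 d"
    using that by (auto simp: D0_carrier D0_hcomp D_hcomp)
  show "\<zero>\<^bsub>D0\<^esub> \<in> hcomp D0 d"
    unfolding D0_zero D0_hcomp by (rule imageI) (simp add: D_hcomp log_derivations_zero)
  show "m \<oplus>\<^bsub>D0\<^esub> n \<in> hcomp D0 d" if "m \<in> hcomp D0 d" "n \<in> hcomp D0 d"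
    using that by (auto simp: D0_hcomp D0_add D_hcomp intro!: imageI log_derivations_add homog_add)
  show "g \<odot>\<^bsub>D0\<^esub> m \<in> hcomp D0 (e + d)" if "g \<in> homog e" "m \<in> hcomp D0 d"
    using that by (auto simp: D0_hcomp D0_smult D_hcomp intro!: imageI log_derivations_mult homog_mult)
  show "(m \<oplus>\<^bsub>D0\<^esub> n) \<oplus>\<^bsub>D0\<^esub> p = m \<oplus>\<^bsub>D0\<^esub> (n \<oplus>\<^bsub>D0\<^esub> p)"
    if "m \<in> carrier D0" "n \<in> carrier D0" "p \<in> carrier D0"
    using that by (auto simp: D0_carrier D0_add add.assoc)
  show "m \<oplus>\<^bsub>D0\<^esub> n = n \<oplus>\<^bsub>D0\<^esub> m" if mn: "m \<in> carrier D0" "n \<in> carrier D0"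
  proof -
    obtain \<theta> \<theta>' where "m = euler_class \<theta>" "n = euler_class \<theta>'" using mn by (auto simp: D0_carrier)
    moreover have "(\<lambda>f. \<theta> f + \<theta>' f) = (\<lambda>f. \<theta>' f + \<theta> f)" by (simp add: add.commute)
    ultimately show ?thesis by (simp only: D0_add)
  qed
  show "m \<oplus>\<^bsub>D0\<^esub> \<zero>\<^bsub>D0\<^esub> = m" if "m \<in> carrier D0"
    using that by (auto simp: D0_carrier D0_add D0_zero)
  show "m \<oplus>\<^bsub>D0\<^esub> ((- 1) \<odot>\<^bsub>D0\<^esub> m) = \<zero>\<^bsub>D0\<^esub>" if "m \<in> carrier D0"
    using that by (auto simp: D0_carrier D0_add D0_zero D0_smult)
  show "1 \<odot>\<^bsub>D0\<^esub> m = m" if "m \<in> carrier D0"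
    using that by (auto simp: D0_carrier D0_smult)
  show "g \<odot>\<^bsub>D0\<^esub> (h \<odot>\<^bsub>D0\<^esub> m) = (g * h) \<odot>\<^bsub>D0\<^esub> m" if "m \<in> carrier D0"
    using that by (auto simp: D0_carrier D0_smult mult.assoc)
  show "g \<odot>\<^bsub>D0\<^esub> (m \<oplus>\<^bsub>D0\<^esub> n) = g \<odot>\<^bsub>D0\<^esub> m \<oplus>\<^bsub>D0\<^esub> g \<odot>\<^bsub>D0\<^esub> n"
    if "m \<in> carrier D0" "n \<in> carrier D0"
    using that by (auto simp: D0_carrier D0_smult D0_add distrib_left)
  show "(g + h) \<odot>\<^bsub>D0\<^esub> m = g \<odot>\<^bsub>D0\<^esub> m \<oplus>\<^bsub>D0\<^esub> h \<odot>\<^bsub>D0\<^esub> m" if "m \<in> carrier D0"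
    using that by (auto simp: D0_carrier D0_smult D0_add distrib_right)
  show "g \<odot>\<^bsub>D0\<^esub> m \<in> carrier D0" if "m \<in> carrier D0"
    using that by (auto simp: D0_carrier D0_smult intro!: imageI log_derivations_mult)
  show "class_along u v (m \<oplus>\<^bsub>D0\<^esub> n) = class_along u v m + class_along u v n"
    if "m \<in> carrier D0" "n \<in> carrier D0"
    using that by (auto simp: D0_carrier D0_add class_along_euler_class along_components_add)
  show "class_along u v (g \<odot>\<^bsub>D0\<^esub> m) = (restr s u v g * fst (class_along u v m), restr s u v g * snd (class_along u v m))"
    if "m \<in> carrier D0"
    using that by (auto simp: D0_carrier D0_smult class_along_euler_class along_components_mult)
  show "vanishing_ideal (affine_line s u v) \<inter> homog d = {g \<in> homog d. restr s u v g = 0}"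
    by (rule affine_line_ideal)
  show "\<exists>n\<in>hcomp D0 (d - 1). m = line_form s u v \<odot>\<^bsub>D0\<^esub> n"
    if "m \<in> hcomp D0 d" "class_along u v m = (0, 0)"
  proof -
    obtain \<theta> where \<theta>: "m = euler_class \<theta>" "\<theta> \<in> hcomp D d" using \<open>m \<in> hcomp D0 d\<close> unfolding D0_hcomp by blast
    have d: "derivation \<theta>" "(\<theta> X, \<theta> W, \<theta> (Var 1)) \<in> log_fields d"
      using \<theta>(2) unfolding D_hcomp_iff components_def by blast+
    have z: "along u v (\<theta> X, \<theta> W, \<theta> (Var 1)) = (0, 0)"
      using \<open>class_along u v m = (0, 0)\<close> unfolding \<theta>(1) class_along_euler_class components_def .
    obtain k GX GW GY where G: "(GX, GW, GY) \<in> log_fields (d - 1)"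
      "\<theta> X = X * k + line_form s u v * GX" "\<theta> W = W * k + line_form s u v * GW"
      "\<theta> (Var 1) = Var 1 * k + line_form s u v * GY"
      by (rule along_kernel[OF uv d(2) z])
    obtain \<theta>' where \<theta>': "derivation \<theta>'" "components s \<theta>' = (GX, GW, GY)" by (rule derivation_with_components)
    have "\<theta> = (\<lambda>f. k * euler f + line_form s u v * \<theta>' f)"
    proof (rule derivation_eqI[OF d(1) derivation_lincomb[OF derivation_euler \<theta>'(1)]])
      show "components s \<theta> = components s (\<lambda>f. k * euler f + line_form s u v * \<theta>' f)"
      proof -
        have "euler X = X" "euler W = W" using components_euler[of s 1] by (simp_all add: components_def)
        then show ?thesis using \<theta>'(2) G(2-4) by (simp add: components_def mult.commute)
      qed
    qed
    then have "m = euler_class (\<lambda>f. line_form s u v * \<theta>' f)" unfolding \<theta>(1) euler_class_eq_iff by blast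
    moreover have "euler_class \<theta>' \<in> hcomp D0 (d - 1)"
      unfolding D0_hcomp using \<theta>' G(1) by (intro imageI) (simp add: D_hcomp_iff)
    ultimately show ?thesis by (intro bexI[of _ "euler_class \<theta>'"]) (simp_all add: D0_smult)
  qed
qed

end

lemma restricted_S_twist:
  "restricted_module (pencil_dir s u) (pencil_base s v) (line_form s u v) (form_x s) (form_w s)
    (S_twist n) (\<lambda>g. (restr s u v g, 0)) (affine_line s u v)"
proof (intro restricted_module.intro line_frame_pencil restricted_module_axioms.intro)
  fix m :: poly3 and d :: int
  show "\<exists>k\<in>hcomp (S_twist n) (d - 1). m = line_form s u v \<odot>\<^bsub>S_twist n\<^esub> k"
    if "m \<in> hcomp (S_twist n) d" "(restr s u v m, 0) = (0, 0)"
  proof -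
    have "m \<in> homog (n + d)" "restr s u v m = 0" using that by (simp_all add: S_twist_def)
    then obtain g where "g \<in> homog (n + d - 1)" "m = line_form s u v * g"
      by (rule line_frame.rho_eq_0_imp_multiple[OF line_frame_pencil])
    then show ?thesis by (auto simp: S_twist_def algebra_simps)
  qed
qed (auto simp: S_twist_def affine_line_ideal algebra_simps intro: homog_add homog_mult')

section \<open>The splitting type\<close>

text \<open>These are the sections of \<open>O(- a)\<close> on the line inside \<open>K\<close>. The
  bound uses \<open>tdeg f\<close> instead of the degree of the restriction of \<open>f\<close>: the
  difference counts zeros of \<open>f\<close> at the infinite point of the line.\<close>

lemma value_set_S_twist:
  fixes s u v :: complex
  assumes f: "f \<in> base"
  defines "r \<equiv> restr s u v"
  shows "restricted_module.value_set (pencil_dir s u) (pencil_base s v) (S_twist (- int a)) (\<lambda>g. (r g, 0)) f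
    = (if r f = 0 then {(0, 0)} else
        {(to_fract p / to_fract (r f) ^ k, 0) | p k. p = 0 \<or> degree p + a \<le> k * tdeg f})"
proof -
  interpret restricted_module "pencil_dir s u" "pencil_base s v" "line_form s u v" "form_x s" "form_w s"
    "S_twist (- int a)" "\<lambda>g. (r g, 0)" "affine_line s u v"
    unfolding r_def by (rule restricted_S_twist)
  have level: "level f k = homog (- int a + int (k * tdeg f))" for k
    unfolding level_def by (simp add: S_twist_def)
  have image: "(\<exists>m\<in>level f k. r m = p) \<longleftrightarrow> p = 0 \<or> degree p + a \<le> k * tdeg f" for k p
  proof
    assume "\<exists>m\<in>level f k. r m = p"
    then obtain m where m: "m \<in> homog (- int a + int (k * tdeg f))" "r m = p" unfolding level by blast
    show "p = 0 \<or> degree p + a \<le> k * tdeg f"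
    proof (cases "m = 0")
      case False
      then have nn: "- int a + int (k * tdeg f) \<ge> 0" using m(1) homog_neg by force
      then have "int (k * tdeg f - a) = - int a + int (k * tdeg f)" by linarith
      then have "m \<in> homog (int (k * tdeg f - a))" using m(1) by (simp only:)
      then have "degree (r m) \<le> k * tdeg f - a" unfolding r_def by (rule degree_rho)
      moreover have "a \<le> k * tdeg f" using nn by linarith
      ultimately show ?thesis unfolding m(2)[symmetric] by linarith
    qed (use m(2) in \<open>simp add: r_def\<close>)
  next
    assume p: "p = 0 \<or> degree p + a \<le> k * tdeg f"
    show "\<exists>m\<in>level f k. r m = p"
    proof (cases "p = 0")
      case True
      then show ?thesis unfolding level by (intro bexI[of _ 0]) (simp_all add: r_def)
    next
      case False
      then have p': "degree p \<le> k * tdeg f - a" "int (k * tdeg f - a) = - int a + int (k * tdeg f)" using p by auto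
      show ?thesis
        unfolding level p'(2)[symmetric] r_def
        using rho_lift[OF p'(1)] lift_homog[of "k * tdeg f - a" p] by blast
    qed
  qed
  show ?thesis
  proof (cases "r f = 0")
    case True
    have "val f x = (0, 0)" if "x \<in> carrier (Loc f)" for x
      using val_zero_if[OF that] True by (simp add: r_def)
    then have "value_set f = {(0, 0)}"
      unfolding value_set_def using Loc_zero_carrier[OF f] by (intro equalityI subsetI) (auto intro!: image_eqI)
    then show ?thesis using True by simp
  next
    case False
    have "value_set f = {(to_fract (r m) / to_fract (r f) ^ k, 0) | m k. m \<in> level f k}"
    proof -
      have "val f (fraction (S_twist (- int a)) f m k) = (to_fract (r m) / to_fract (r f) ^ k, 0)" if "m \<in> level f k" for m k
        unfolding val_fraction[OF that] using False by (simp add: r_def)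
      then show ?thesis unfolding value_set_def Loc_carrier by (intro equalityI subsetI) (auto intro!: image_eqI, metis)
    qed
    also have "\<dots> = {(to_fract p / to_fract (r f) ^ k, 0) | p k. \<exists>m\<in>level f k. r m = p}" by blast
    finally show ?thesis unfolding image using False by simp
  qed
qed

lemma O_twist_realized:
  "realizes (restr s u v) (O_twist (affine_line s u v) n)
    (restricted_module.class_val (pencil_dir s u) (pencil_base s v) (\<lambda>g. (restr s u v g, 0)))
    (restricted_module.value_set (pencil_dir s u) (pencil_base s v) (S_twist n) (\<lambda>g. (restr s u v g, 0)))"
  unfolding O_twist_def by (rule restricted_module.realizes_Res[OF restricted_S_twist])

context arrangement_lines
begin

text \<open>A pair need not be the restriction of a class of its own degree, but its multiple by a
  high power of \<open>r f\<close> lifts. Over \<open>D_+(f)\<close> that power is absorbed by the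
  denominator, so every pair occurs as a numerator.\<close>

lemma value_set_D0:
  fixes u v :: complex
  assumes uv: "general u v" and f: "f \<in> base"
  defines "r \<equiv> restr s u v"
  shows "restricted_module.value_set (pencil_dir s u) (pencil_base s v) D0 (class_along u v) f
    = (if r f = 0 then {(0, 0)} else
        {(to_fract A / to_fract (r f) ^ k, to_fract n / to_fract (r f) ^ k) | A n k.
          (A, n) \<in> tangency.fields Z (meet u v) (\<lambda>p. \<xi> p - u) (k * tdeg f)})"
proof -
  interpret restricted_module "pencil_dir s u" "pencil_base s v" "line_form s u v" X W D0 "class_along u v" "affine_line s u v"
    by (rule restricted_D0[OF uv])
  interpret tangency Z "meet u v" "\<lambda>p. \<xi> p - u" by (rule tangency_general[OF uv])
  have level_along: "class_along u v m \<in> fields (k * tdeg f)" if m: "m \<in> level f k" for m k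
  proof -
    obtain \<theta> where \<theta>: "m = euler_class \<theta>" "\<theta> \<in> hcomp D (int (k * tdeg f))" using m unfolding level_def D0_hcomp by blast
    have "components s \<theta> \<in> log_fields (int (k * tdeg f))" using \<theta>(2) unfolding D_hcomp_iff by blast
    from along_fields[OF uv this] show ?thesis unfolding \<theta>(1) class_along_euler_class .
  qed
  show ?thesis
  proof (cases "r f = 0")
    case True
    have "val f x = (0, 0)" if "x \<in> carrier (Loc f)" for x
      using val_zero_if[OF that] True by (simp add: r_def)
    then have "value_set f = {(0, 0)}"
      unfolding value_set_def using Loc_zero_carrier[OF f] by (intro equalityI subsetI) (auto intro!: image_eqI)
    then show ?thesis using True by simp
  next
    case False
    have v: "val f (fraction D0 f m k) = (to_fract (fst (class_along u v m)) / to_fract (r f) ^ k,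
        to_fract (snd (class_along u v m)) / to_fract (r f) ^ k)" if "m \<in> level f k" for m k
      unfolding val_fraction[OF that] using False by (simp add: r_def)
    have "value_set f = {(to_fract A / to_fract (r f) ^ k, to_fract n / to_fract (r f) ^ k) | A n k. (A, n) \<in> fields (k * tdeg f)}"
    proof (intro equalityI subsetI)
      fix w assume "w \<in> value_set f"
      then obtain m k where m: "m \<in> level f k" "w = val f (fraction D0 f m k)" unfolding value_set_def Loc_carrier by blast
      obtain A n where An: "class_along u v m = (A, n)" by fastforce
      have "(A, n) \<in> fields (k * tdeg f)" using level_along[OF m(1)] An by simp
      moreover have "w = (to_fract A / to_fract (r f) ^ k, to_fract n / to_fract (r f) ^ k)"
        unfolding m(2) v[OF m(1)] An by simp
      ultimately show "w \<in> {(to_fract A / to_fract (r f) ^ k, to_fract n / to_fract (r f) ^ k) | A n k. (A, n) \<in> fields (k * tdeg f)}"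
        by blast
    next
      fix w assume "w \<in> {(to_fract A / to_fract (r f) ^ k, to_fract n / to_fract (r f) ^ k) | A n k. (A, n) \<in> fields (k * tdeg f)}"
      then obtain A n k where An: "(A, n) \<in> fields (k * tdeg f)"
        "w = (to_fract A / to_fract (r f) ^ k, to_fract n / to_fract (r f) ^ k)" by blast
      \<comment> \<open>Large enough for lifting, which asks for
        \<open>card Z \<le> j * tdeg f + 1\<close>, because \<open>tdeg f\<close> is
        positive.\<close>
      define j where "j = card Z"
      have "degree (r f ^ j) \<le> j * tdeg f"
        using degree_power_le[of "r f" j] mult_right_mono[OF degree_rho[OF base_degree(1)[OF f]], of j] unfolding r_def
        by (metis (no_types, lifting) le_trans mult.commute zero_le)
      moreover have "card Z \<le> j * tdeg f + 1" using base_degree(2)[OF f] by (simp add: j_def) (metis One_nat_def Suc_leI le_SucI mult.right_neutral mult_le_mono2)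
      ultimately obtain F where F: "F \<in> log_fields (int (k * tdeg f + j * tdeg f))" "along u v F = (r f ^ j * A, r f ^ j * n)"
        using multiple_in_image[OF uv An(1)] by blast
      obtain \<theta> where \<theta>: "derivation \<theta>" "components s \<theta> = F" by (rule derivation_with_components)
      have "\<theta> \<in> hcomp D (int ((k + j) * tdeg f))" using F(1) \<theta> by (simp add: D_hcomp_iff distrib_right)
      then have m: "euler_class \<theta> \<in> level f (k + j)" unfolding level_def D0_hcomp by (rule imageI)
      have "w = val f (fraction D0 f (euler_class \<theta>) (k + j))"
        unfolding v[OF m] class_along_euler_class \<theta>(2) F(2) An(2) using False by (simp add: power_add to_fract_power)
      then show "w \<in> value_set f" unfolding value_set_def using Loc_carrierI[OF m] by blast
    qed
    then show ?thesis using False by simp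
  qed
qed

text \<open>The matrix \<open>S\<close> with columns \<open>(A\<^sub>1, n\<^sub>1)\<close> and
  \<open>(A\<^sub>2, n\<^sub>2)\<close> is invertible over \<open>K\<close>. Generation without
  cancellation in top degree says that its inverse \<open>T\<close> takes values of
  \<open>D_0\<close> to pairs that obey the degree bounds of \<open>O(- a\<^sub>1)\<close> and
  \<open>O(- a\<^sub>2)\<close>.\<close>

theorem restriction_splits:
  assumes uv: "general u v"
    and An: "(A\<^sub>1, n\<^sub>1) \<in> tangency.fields Z (meet u v) (\<lambda>p. \<xi> p - u) a\<^sub>1"
      "(A\<^sub>2, n\<^sub>2) \<in> tangency.fields Z (meet u v) (\<lambda>p. \<xi> p - u) a\<^sub>2"
    and det: "A\<^sub>1 * n\<^sub>2 - A\<^sub>2 * n\<^sub>1 \<noteq> 0"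
    and gen: "\<And>k A n. (A, n) \<in> tangency.fields Z (meet u v) (\<lambda>p. \<xi> p - u) k \<Longrightarrow>
      \<exists>p q. A = p * A\<^sub>1 + q * A\<^sub>2 \<and> n = p * n\<^sub>1 + q * n\<^sub>2 \<and>
        (p = 0 \<or> degree p + a\<^sub>1 \<le> k) \<and> (q = 0 \<or> degree q + a\<^sub>2 \<le> k)"
  shows "sheaf_iso (restrict_to (affine_line s u v) (sheaf_of D0))
    (direct_sum (O_twist (affine_line s u v) (- int a\<^sub>1)) (O_twist (affine_line s u v) (- int a\<^sub>2)))"
proof -
  interpret M: restricted_module "pencil_dir s u" "pencil_base s v" "line_form s u v" X W D0 "class_along u v" "affine_line s u v"
    by (rule restricted_D0[OF uv])
  interpret tangency Z "meet u v" "\<lambda>p. \<xi> p - u" by (rule tangency_general[OF uv])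
  let ?r = "restr s u v"
  let ?V = "restricted_module.value_set (pencil_dir s u) (pencil_base s v) D0 (class_along u v)"
  define V where "V a = restricted_module.value_set (pencil_dir s u) (pencil_base s v) (S_twist (- int a)) (\<lambda>g. (?r g, 0))" for a
  define \<Delta> where "\<Delta> = to_fract (A\<^sub>1 * n\<^sub>2 - A\<^sub>2 * n\<^sub>1)"
  have \<Delta>: "\<Delta> \<noteq> 0" using det by (simp add: \<Delta>_def del: to_fract_diff to_fract_mult)
  have \<Delta>_eq: "\<Delta> = to_fract A\<^sub>1 * to_fract n\<^sub>2 - to_fract A\<^sub>2 * to_fract n\<^sub>1" by (simp add: \<Delta>_def)
  define S where "S w = (fst w * to_fract A\<^sub>1 + snd w * to_fract A\<^sub>2, fst w * to_fract n\<^sub>1 + snd w * to_fract n\<^sub>2)" for w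
  define T where "T w = ((fst w * to_fract n\<^sub>2 - snd w * to_fract A\<^sub>2) / \<Delta>, (to_fract A\<^sub>1 * snd w - to_fract n\<^sub>1 * fst w) / \<Delta>)" for w
  have ST: "S (T w) = w" for w
  proof -
    have "(fst w * to_fract n\<^sub>2 - snd w * to_fract A\<^sub>2) * to_fract A\<^sub>1 + (to_fract A\<^sub>1 * snd w - to_fract n\<^sub>1 * fst w) * to_fract A\<^sub>2 = fst w * \<Delta>"
      "(fst w * to_fract n\<^sub>2 - snd w * to_fract A\<^sub>2) * to_fract n\<^sub>1 + (to_fract A\<^sub>1 * snd w - to_fract n\<^sub>1 * fst w) * to_fract n\<^sub>2 = snd w * \<Delta>"
      unfolding \<Delta>_eq by (simp_all add: algebra_simps)
    then show ?thesis using \<Delta> by (simp add: S_def T_def add_divide_distrib[symmetric])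
  qed
  have TS: "T (S w) = w" for w
  proof -
    have "(fst w * to_fract A\<^sub>1 + snd w * to_fract A\<^sub>2) * to_fract n\<^sub>2 - (fst w * to_fract n\<^sub>1 + snd w * to_fract n\<^sub>2) * to_fract A\<^sub>2 = fst w * \<Delta>"
      "to_fract A\<^sub>1 * (fst w * to_fract n\<^sub>1 + snd w * to_fract n\<^sub>2) - to_fract n\<^sub>1 * (fst w * to_fract A\<^sub>1 + snd w * to_fract A\<^sub>2) = snd w * \<Delta>"
      unfolding \<Delta>_eq by (simp_all add: algebra_simps)
    then show ?thesis using \<Delta> by (simp add: S_def T_def)
  qed
  have Vs: "snd w = 0" if "f \<in> base" "w \<in> V a f" for f w a
    using that(2) unfolding V_def value_set_S_twist[OF that(1)] by (auto split: if_splits)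
  have fstV: "fst ` V a f = (if ?r f = 0 then {0} else {to_fract p / to_fract (?r f) ^ k | p k. p = 0 \<or> degree p + a \<le> k * tdeg f})"
    if "f \<in> base" for f a
    unfolding V_def value_set_S_twist[OF that] by (auto simp: image_def)
  have "realizes ?r (direct_sum (O_twist (affine_line s u v) (- int a\<^sub>1)) (O_twist (affine_line s u v) (- int a\<^sub>2)))
    (\<lambda>f (x, y). (fst (restricted_module.class_val (pencil_dir s u) (pencil_base s v) (\<lambda>g. (?r g, 0)) f x),
      fst (restricted_module.class_val (pencil_dir s u) (pencil_base s v) (\<lambda>g. (?r g, 0)) f y)))
    (\<lambda>f. fst ` V a\<^sub>1 f \<times> fst ` V a\<^sub>2 f)"
    unfolding V_def by (rule realizes_direct_sum[OF O_twist_realized O_twist_realized]) (use Vs in \<open>auto simp: V_def\<close>)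
  from M.realizes_Res this show ?thesis
  proof (rule sheaf_iso_realized[where T = T])
    show "T (w + z) = T w + T z" for w z
      by (simp add: T_def algebra_simps add_divide_distrib diff_divide_distrib)
    show "T (scale c w) = scale c (T w)" for c w
      by (simp add: T_def scale_def algebra_simps diff_divide_distrib)
    fix f assume f: "f \<in> base"
    show "bij_betw T (?V f) (fst ` V a\<^sub>1 f \<times> fst ` V a\<^sub>2 f)"
    proof (rule bij_betw_byWitness[where f' = S])
      show "\<forall>w\<in>?V f. S (T w) = w" "\<forall>w\<in>fst ` V a\<^sub>1 f \<times> fst ` V a\<^sub>2 f. T (S w) = w" by (simp_all add: ST TS)
      show "T ` ?V f \<subseteq> fst ` V a\<^sub>1 f \<times> fst ` V a\<^sub>2 f"
      proof (cases "?r f = 0")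
        case True
        then show ?thesis unfolding value_set_D0[OF uv f] fstV[OF f] by (simp add: T_def)
      next
        case False
        have "T w \<in> fst ` V a\<^sub>1 f \<times> fst ` V a\<^sub>2 f" if w: "w \<in> ?V f" for w
        proof -
          obtain A n k where An: "(A, n) \<in> fields (k * tdeg f)"
            "w = (to_fract A / to_fract (?r f) ^ k, to_fract n / to_fract (?r f) ^ k)"
            using w False unfolding value_set_D0[OF uv f] by auto
          obtain p q where pq: "A = p * A\<^sub>1 + q * A\<^sub>2" "n = p * n\<^sub>1 + q * n\<^sub>2"
            "p = 0 \<or> degree p + a\<^sub>1 \<le> k * tdeg f" "q = 0 \<or> degree q + a\<^sub>2 \<le> k * tdeg f"
            using gen[OF An(1)] by (elim exE conjE)
          have "w = S (to_fract p / to_fract (?r f) ^ k, to_fract q / to_fract (?r f) ^ k)"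
            unfolding An(2) pq(1,2) S_def by (simp add: add_divide_distrib)
          then have "T w = (to_fract p / to_fract (?r f) ^ k, to_fract q / to_fract (?r f) ^ k)" by (simp only: TS)
          then show ?thesis unfolding fstV[OF f] using False pq(3,4) by auto
        qed
        then show ?thesis by blast
      qed
      show "S ` (fst ` V a\<^sub>1 f \<times> fst ` V a\<^sub>2 f) \<subseteq> ?V f"
      proof (cases "?r f = 0")
        case True
        then show ?thesis unfolding value_set_D0[OF uv f] fstV[OF f] by (simp add: S_def)
      next
        case False
        have "S w \<in> ?V f" if w: "w \<in> fst ` V a\<^sub>1 f \<times> fst ` V a\<^sub>2 f" for w
        proof -
          obtain p i q j where w: "w = (to_fract p / to_fract (?r f) ^ i, to_fract q / to_fract (?r f) ^ j)"
            and p: "p = 0 \<or> degree p + a\<^sub>1 \<le> i * tdeg f" and q: "q = 0 \<or> degree q + a\<^sub>2 \<le> j * tdeg f"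
            using w False unfolding fstV[OF f] by auto
          \<comment> \<open>Passage to the common denominator \<open>r f ^ (i + j)\<close>. The
            bounds survive because \<open>r f ^ j\<close> has degree at most
            \<open>j * tdeg f\<close>.\<close>
          define p' where "p' = p * ?r f ^ j"
          define q' where "q' = q * ?r f ^ i"
          have dr: "degree (?r f ^ j) \<le> j * tdeg f" for j
          proof -
            have "degree (?r f ^ j) \<le> degree (?r f) * j" by (rule degree_power_le)
            also have "\<dots> \<le> tdeg f * j" by (rule mult_le_mono1[OF degree_rho[OF M.base_degree(1)[OF f]]])
            finally show ?thesis by (simp only: mult.commute)
          qed
          have P: "p' = 0 \<or> degree p' + a\<^sub>1 \<le> (i + j) * tdeg f"
            using p dr[of j] degree_mult_le[of p "?r f ^ j"] by (auto simp: p'_def distrib_right)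
          have Q: "q' = 0 \<or> degree q' + a\<^sub>2 \<le> (i + j) * tdeg f"
            using q dr[of i] degree_mult_le[of q "?r f ^ i"] by (auto simp: q'_def distrib_right)
          have "(p' * A\<^sub>1 + q' * A\<^sub>2, p' * n\<^sub>1 + q' * n\<^sub>2) \<in> fields ((i + j) * tdeg f)"
            by (rule fields_add[OF fields_mult_bound[OF An(1) P] fields_mult_bound[OF An(2) Q]])
          moreover have "S w = (to_fract (p' * A\<^sub>1 + q' * A\<^sub>2) / to_fract (?r f) ^ (i + j),
              to_fract (p' * n\<^sub>1 + q' * n\<^sub>2) / to_fract (?r f) ^ (i + j))"
            unfolding w S_def p'_def q'_def using False by (simp add: to_fract_power power_add add_divide_distrib mult.commute)
          ultimately show ?thesis unfolding value_set_D0[OF uv f] if_not_P[OF False] by blast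
        qed
        then show ?thesis by blast
      qed
    qed
  qed
qed

end

lemma eval2_nonzero: "q \<noteq> 0 \<Longrightarrow> \<exists>u v. eval2 q u v \<noteq> 0"
proof (rule ccontr)
  assume "q \<noteq> 0" "\<nexists>u v. eval2 q u v \<noteq> 0"
  moreover from this(2) have "q = 0" by (intro eval2_eq_0) simp
  ultimately show False by simp
qed

section \<open>The initial degree and the generic splitting type\<close>

context arrangement_lines
begin

lemma hcomp_neg:
  assumes "d < 0"
  shows "hcomp D0 d = {\<zero>\<^bsub>D0\<^esub>}"
proof -
  have "\<theta> = (\<lambda>f. 0)" if \<theta>: "\<theta> \<in> hcomp D d" for \<theta>
  proof (rule derivation_eqI[where s = s])
    show "derivation \<theta>" using \<theta> by (simp add: D_hcomp_iff)
    show "derivation (\<lambda>f. 0)" by (simp add: derivation_def)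
    show "components s \<theta> = components s (\<lambda>f. 0)"
      using \<theta> homog_neg[OF _ assms] by (auto simp: D_hcomp_iff components_def log_fields_def)
  qed
  moreover have "(\<lambda>f. 0) \<in> hcomp D d" by (simp add: D_hcomp log_derivations_zero)
  ultimately have "hcomp D d = {\<lambda>f. 0}" by blast
  then show ?thesis unfolding D0_hcomp D0_zero by simp
qed

definition degrees :: "int set"
  where "degrees = {d. hcomp D0 d \<noteq> {\<zero>\<^bsub>D0\<^esub>}}"

lemma degrees_nonneg: "d \<in> degrees \<Longrightarrow> 0 \<le> d"
  using hcomp_neg by (force simp: degrees_def)

lemma degreesI:
  assumes F: "(FX, FW, FY) \<in> log_fields d" and ne: "\<nexists>g. FX = X * g \<and> FW = W * g \<and> FY = Var 1 * g"
  shows "d \<in> degrees"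
proof -
  obtain \<theta> where \<theta>: "derivation \<theta>" "components s \<theta> = (FX, FW, FY)" by (rule derivation_with_components)
  have "\<theta> \<in> hcomp D d" using \<theta> F by (simp add: D_hcomp_iff)
  then have in_d: "euler_class \<theta> \<in> hcomp D0 d" unfolding D0_hcomp by (rule imageI)
  have "euler_class \<theta> \<noteq> \<zero>\<^bsub>D0\<^esub>"
  proof
    assume "euler_class \<theta> = \<zero>\<^bsub>D0\<^esub>"
    then obtain g where "\<theta> = (\<lambda>f. g * euler f)" unfolding D0_zero euler_class_eq_iff by auto
    then have "(FX, FW, FY) = (X * g, W * g, Var 1 * g)" using \<theta>(2) components_euler[of s g] by metis
    then show False using ne by blast
  qed
  then show ?thesis using in_d unfolding degrees_def by blast
qed

text \<open>A nonzero pair on one general line, raised in degree by \<open>card Z\<close>, lifts to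
  a logarithmic field. Its restriction is nonzero, so it is no multiple of the Euler field.\<close>

lemma degrees_nonempty:
  assumes uv: "general u v"
  shows "degrees \<noteq> {}"
proof -
  interpret tangency Z "meet u v" "\<lambda>p. \<xi> p - u" by (rule tangency_general[OF uv])
  obtain A n a where An: "(A, n) \<in> fields a" "(A, n) \<noteq> (0, 0)" by (rule reduced_basis) blast
  obtain F where F: "F \<in> log_fields (int (a + card Z))" "along u v F = (1 * A, 1 * n)"
    using multiple_in_image[OF uv An(1), of 1 "card Z"] by auto
  obtain FX FW FY where F': "F = (FX, FW, FY)" by (cases F)
  have "\<nexists>g. FX = X * g \<and> FW = W * g \<and> FY = Var 1 * g"
  proof
    assume "\<exists>g. FX = X * g \<and> FW = W * g \<and> FY = Var 1 * g"
    then obtain g where "F = (X * g, W * g, Var 1 * g)" unfolding F' by blast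
    then show False using F(2) along_euler[of u v g] An(2) by simp
  qed
  then show ?thesis using degreesI F(1) unfolding F' by blast
qed

text \<open>\<open>Inf\<close> on integers is specified only for nonempty sets that are bounded
  below. As the degrees are nonnegative, it is an attained minimum here.\<close>

lemma initial_degree_least:
  assumes "degrees \<noteq> {}"
  shows "initial_degree D0 \<in> degrees" "\<And>d. d \<in> degrees \<Longrightarrow> initial_degree D0 \<le> d"
proof -
  obtain d where "d \<in> degrees" using assms by blast
  then have "int (nat d) \<in> degrees" using degrees_nonneg by simp
  then have *: "int (LEAST n. int n \<in> degrees) \<in> degrees" by (rule LeastI)
  have least: "int (LEAST n. int n \<in> degrees) \<le> d" if "d \<in> degrees" for d
  proof -
    have "int (nat d) \<in> degrees" using that degrees_nonneg by simp
    then have "(LEAST n. int n \<in> degrees) \<le> nat d" by (rule Least_le)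
    then show ?thesis using degrees_nonneg[OF that] by linarith
  qed
  have "initial_degree D0 = int (LEAST n. int n \<in> degrees)"
    unfolding initial_degree_def degrees_def[symmetric] by (rule cInf_eq_minimum[OF * least])
  then show "initial_degree D0 \<in> degrees" "\<And>d. d \<in> degrees \<Longrightarrow> initial_degree D0 \<le> d"
    using * least by simp_all
qed

text \<open>A nonzero class of minimal degree does not vanish along \<open>Y = u X + v W\<close>: it would be divisible by the
  equation of this line.\<close>

lemma fields_initial_degree:
  assumes uv: "general u v"
  shows "\<exists>A n. (A, n) \<in> tangency.fields Z (meet u v) (\<lambda>p. \<xi> p - u) (nat (initial_degree D0)) \<and> (A, n) \<noteq> (0, 0)"
proof -
  interpret M: restricted_module "pencil_dir s u" "pencil_base s v" "line_form s u v" X W D0 "class_along u v" "affine_line s u v"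
    by (rule restricted_D0[OF uv])
  let ?d = "initial_degree D0"
  have d: "?d \<in> degrees" "\<And>d. d \<in> degrees \<Longrightarrow> ?d \<le> d" using initial_degree_least degrees_nonempty[OF uv] by blast+
  have nd: "int (nat ?d) = ?d" using degrees_nonneg[OF d(1)] by simp
  obtain m where m: "m \<in> hcomp D0 ?d" "m \<noteq> \<zero>\<^bsub>D0\<^esub>"
    using d(1) M.hcomp_zero[of ?d] unfolding degrees_def by blast
  obtain \<theta> where \<theta>: "m = euler_class \<theta>" "\<theta> \<in> hcomp D ?d" using m(1) unfolding D0_hcomp by blast
  have "components s \<theta> \<in> log_fields (int (nat ?d))" using \<theta>(2) unfolding D_hcomp_iff nd by blast
  from along_fields[OF uv this]
  have "class_along u v m \<in> tangency.fields Z (meet u v) (\<lambda>p. \<xi> p - u) (nat ?d)"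
    unfolding \<theta>(1) class_along_euler_class .
  moreover have "class_along u v m \<noteq> (0, 0)"
  proof
    assume "class_along u v m = (0, 0)"
    from M.ev_kernel[OF m(1) this] obtain n where n: "n \<in> hcomp D0 (?d - 1)" "m = line_form s u v \<odot>\<^bsub>D0\<^esub> n" by blast
    have "?d - 1 \<notin> degrees" using d(2)[of "?d - 1"] by auto
    then have "n = \<zero>\<^bsub>D0\<^esub>" using n(1) unfolding degrees_def by blast
    then have "m = \<zero>\<^bsub>D0\<^esub>" unfolding n(2) D0_zero by (simp add: D0_smult)
    then show False using m(2) by simp
  qed
  ultimately show ?thesis by (metis surj_pair)
qed

text \<open>On a general line the smaller generator degree \<open>a\<^sub>1\<close> is at most the
  initial degree, and at most the floor because \<open>a\<^sub>1 + a\<^sub>2 = card Z - 1\<close>.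
  It is not below \<open>a\<close>, since nonzero pairs of degree \<open>a - 1\<close> on general
  lines would come with a global field of degree \<open>a - 1\<close>, below the initial
  degree.\<close>

theorem generic_splitting:
  assumes a: "a = min (initial_degree D0) \<lfloor>(real (card Z) - 1) / 2\<rfloor>"
  shows "0 \<le> a \<and> a \<le> int (card Z) - a - 1 \<and> (\<exists>q. q \<noteq> 0 \<and> (\<forall>u v. eval2 q u v \<noteq> 0 \<longrightarrow>
    sheaf_iso (restrict_to (affine_line s u v) (sheaf_of D0))
      (direct_sum (O_twist (affine_line s u v) (- a)) (O_twist (affine_line s u v) (- (int (card Z) - a - 1))))))"
proof -
  let ?\<alpha> = "initial_degree D0"
  obtain q\<^sub>0 where q0: "q\<^sub>0 \<noteq> 0" "\<And>u v. eval2 q\<^sub>0 u v \<noteq> 0 \<Longrightarrow> general u v" using generic_general by blast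
  obtain u\<^sub>0 v\<^sub>0 where "eval2 q\<^sub>0 u\<^sub>0 v\<^sub>0 \<noteq> 0" using eval2_nonzero[OF q0(1)] by blast
  then have ne: "degrees \<noteq> {}" using degrees_nonempty q0(2) by blast
  have \<alpha>: "0 \<le> ?\<alpha>" "\<And>d. d \<in> degrees \<Longrightarrow> ?\<alpha> \<le> d"
    using degrees_nonneg initial_degree_least[OF ne] by blast+
  have card: "card Z \<ge> 1" using finite_lines lines_nonempty by (simp add: Suc_le_eq card_gt_0_iff)
  have "0 \<le> \<lfloor>(real (card Z) - 1) / 2\<rfloor>" using card by simp
  then have a0: "0 \<le> a" using a \<alpha>(1) by simp
  have "a \<le> \<lfloor>(real (card Z) - 1) / 2\<rfloor>" using a by simp
  then have "real_of_int a \<le> (real (card Z) - 1) / 2" by (simp only: le_floor_iff)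
  then have "real_of_int (2 * a + 1) \<le> real_of_int (int (card Z))" by simp
  then have a1: "2 * a + 1 \<le> int (card Z)" by (simp only: of_int_le_iff)
  \<comment> \<open>The case \<open>a = 0\<close> is kept apart because \<open>nat (a - 1)\<close>
    would truncate to degree \<open>0\<close>; there the lower bound on \<open>a\<^sub>1\<close> is
    trivial.\<close>
  have "\<exists>q. q \<noteq> 0 \<and> (\<forall>u v. eval2 q u v \<noteq> 0 \<longrightarrow> general u v \<longrightarrow>
      (a = 0 \<or> tangency.fields Z (meet u v) (\<lambda>p. \<xi> p - u) (nat (a - 1)) = {(0, 0)}))"
  proof (cases "a = 0")
    case True
    then show ?thesis by (intro exI[of _ 1]) simp
  next
    case False
    have na: "int (nat (a - 1)) = a - 1" using a0 False by simp
    \<comment> \<open>\<open>2 (a - 1) + 3 = 2 a + 1\<close>: the floor in \<open>a\<close> is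
      exactly what the Wronskian argument requires.\<close>
    have "2 * nat (a - 1) + 3 \<le> card Z" using a1 na by linarith
    from global_field_or_generic_zero[OF this] show ?thesis
    proof
      assume "\<exists>FX FW FY. (FX, FW, FY) \<in> log_fields (int (nat (a - 1))) \<and>
        (\<nexists>g. FX = X * g \<and> FW = W * g \<and> FY = Var 1 * g)"
      then have "a - 1 \<in> degrees" unfolding na using degreesI by blast
      then have "?\<alpha> \<le> a - 1" by (rule \<alpha>(2))
      then show ?thesis using a by linarith
    qed blast
  qed
  then obtain q\<^sub>1 where q1: "q\<^sub>1 \<noteq> 0" "\<And>u v. eval2 q\<^sub>1 u v \<noteq> 0 \<Longrightarrow> general u v \<Longrightarrow>
      a = 0 \<or> tangency.fields Z (meet u v) (\<lambda>p. \<xi> p - u) (nat (a - 1)) = {(0, 0)}" by blast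
  have "sheaf_iso (restrict_to (affine_line s u v) (sheaf_of D0))
      (direct_sum (O_twist (affine_line s u v) (- a)) (O_twist (affine_line s u v) (- (int (card Z) - a - 1))))"
    if q: "eval2 (q\<^sub>0 * q\<^sub>1) u v \<noteq> 0" for u v
  proof -
    have uv: "general u v" and z: "a = 0 \<or> tangency.fields Z (meet u v) (\<lambda>p. \<xi> p - u) (nat (a - 1)) = {(0, 0)}"
      using q q0(2) q1(2) by auto
    interpret tangency Z "meet u v" "\<lambda>p. \<xi> p - u" by (rule tangency_general[OF uv])
    show ?thesis
    proof (rule reduced_basis)
      fix a\<^sub>1 a\<^sub>2 A\<^sub>1 n\<^sub>1 A\<^sub>2 n\<^sub>2
      assume le: "a\<^sub>1 \<le> a\<^sub>2" and sum: "a\<^sub>1 + a\<^sub>2 + 1 = card Z" and det: "A\<^sub>1 * n\<^sub>2 - A\<^sub>2 * n\<^sub>1 \<noteq> 0"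
        and in1: "(A\<^sub>1, n\<^sub>1) \<in> fields a\<^sub>1" and in2: "(A\<^sub>2, n\<^sub>2) \<in> fields a\<^sub>2"
        and gen: "\<And>k A n. (A, n) \<in> fields k \<Longrightarrow> \<exists>p q. A = p * A\<^sub>1 + q * A\<^sub>2 \<and> n = p * n\<^sub>1 + q * n\<^sub>2 \<and>
          (p = 0 \<or> degree p + a\<^sub>1 \<le> k) \<and> (q = 0 \<or> degree q + a\<^sub>2 \<le> k)"
        and nz: "(A\<^sub>1, n\<^sub>1) \<noteq> (0, 0)" and least: "\<And>k A n. (A, n) \<in> fields k \<Longrightarrow> (A, n) \<noteq> (0, 0) \<Longrightarrow> a\<^sub>1 \<le> k"
      obtain A n where "(A, n) \<in> fields (nat ?\<alpha>)" "(A, n) \<noteq> (0, 0)" using fields_initial_degree[OF uv] by blast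
      then have "a\<^sub>1 \<le> nat ?\<alpha>" by (rule least)
      then have "int a\<^sub>1 \<le> ?\<alpha>" using \<alpha>(1) by linarith
      moreover have "int a\<^sub>1 \<le> \<lfloor>(real (card Z) - 1) / 2\<rfloor>"
      proof -
        have "2 * a\<^sub>1 + 1 \<le> card Z" using le sum by linarith
        then have "real_of_int (int a\<^sub>1) \<le> (real (card Z) - 1) / 2" by simp
        then show ?thesis by (simp only: le_floor_iff)
      qed
      ultimately have up: "int a\<^sub>1 \<le> a" using a by simp
      have "a \<le> int a\<^sub>1"
      proof (rule ccontr)
        assume c: "\<not> a \<le> int a\<^sub>1"
        then have "a\<^sub>1 \<le> nat (a - 1)" by linarith
        \<comment> \<open>\<open>fields\<close> only bounds degrees from above, so the generator of
          degree \<open>a\<^sub>1\<close> also counts as a pair of degree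
          \<open>a - 1\<close>.\<close>
        moreover have "(1 * A\<^sub>1, 1 * n\<^sub>1) \<in> fields (nat (a - 1))"
          by (rule fields_mult_bound[OF in1]) (use calculation in simp)
        moreover have "a \<noteq> 0" using c by auto
        ultimately show False using z nz by auto
      qed
      then have "int a\<^sub>1 = a" "int a\<^sub>2 = int (card Z) - a - 1" using up sum by linarith+
      then show ?thesis using restriction_splits[OF uv in1 in2 det gen] by simp
    qed
  qed
  then show ?thesis using a0 a1 q0(1) q1(1) by (intro conjI exI[of _ "q\<^sub>0 * q\<^sub>1"]) auto
qed

end

section \<open>Open conditions on the coefficients of a line\<close>

lemma homogenization_dual:
  "\<exists>N\<^sub>0. \<forall>N\<ge>N\<^sub>0. \<exists>G\<in>homog (int N). \<forall>c. height s c \<noteq> 0 \<longrightarrow>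
    eval_at G c = height s c ^ N * eval2 q (- c $ 2 / height s c) (- c $ 3 / height s c)"
proof (induction q)
  case 0
  show ?case by (intro exI[of _ 0] allI impI bexI[of _ 0]) auto
next
  case (pCons a q)
  define K where "K = Var 1 + Const s * Var 2 + Const (s\<^sup>2) * Var 3"
  have K: "K \<in> homog 1" unfolding K_def by (intro homog_add homog_Const_mult homog_Var)
  have eK: "eval_at K c = height s c" for c by (simp add: K_def height_def)
  have "\<exists>N\<^sub>0. \<forall>N\<ge>N\<^sub>0. \<exists>G\<in>homog (int N). \<forall>c. height s c \<noteq> 0 \<longrightarrow>
      eval_at G c = height s c ^ N * poly a (- c $ 2 / height s c)"
  proof (induction a)
    case 0
    show ?case by (intro exI[of _ 0] allI impI bexI[of _ 0]) auto
  next
    case (pCons e a)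
    then obtain N\<^sub>0 where N\<^sub>0: "\<And>N. N \<ge> N\<^sub>0 \<Longrightarrow> \<exists>G\<in>homog (int N). \<forall>c. height s c \<noteq> 0 \<longrightarrow>
      eval_at G c = height s c ^ N * poly a (- c $ 2 / height s c)" by blast
    show ?case
    proof (intro exI[of _ "Suc N\<^sub>0"] allI impI)
      fix N assume N: "Suc N\<^sub>0 \<le> N"
      then obtain M where M: "N = Suc M" by (cases N) auto
      obtain G where G: "G \<in> homog (int M)" "\<And>c. height s c \<noteq> 0 \<Longrightarrow>
        eval_at G c = height s c ^ M * poly a (- c $ 2 / height s c)" using N\<^sub>0[of M] N M by auto
      have "Const e * K ^ N + Const (- 1) * (Var 2 * G) \<in> homog (int N)"
        using homog_power[OF K, of N] homog_mult[OF homog_Var G(1), of 2] M by (intro homog_add homog_Const_mult) simp_all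
      moreover have "eval_at (Const e * K ^ N + Const (- 1) * (Var 2 * G)) c = height s c ^ N * poly (pCons e a) (- c $ 2 / height s c)"
        if "height s c \<noteq> 0" for c using that by (simp add: eK G(2) M field_simps)
      ultimately show "\<exists>G\<in>homog (int N). \<forall>c. height s c \<noteq> 0 \<longrightarrow>
        eval_at G c = height s c ^ N * poly (pCons e a) (- c $ 2 / height s c)" by blast
    qed
  qed
  then obtain N\<^sub>1 where N\<^sub>1: "\<And>N. N \<ge> N\<^sub>1 \<Longrightarrow> \<exists>G\<in>homog (int N). \<forall>c. height s c \<noteq> 0 \<longrightarrow>
      eval_at G c = height s c ^ N * poly a (- c $ 2 / height s c)" by blast
  obtain N\<^sub>0 where N\<^sub>0: "\<And>N. N \<ge> N\<^sub>0 \<Longrightarrow> \<exists>G\<in>homog (int N). \<forall>c. height s c \<noteq> 0 \<longrightarrow>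
    eval_at G c = height s c ^ N * eval2 q (- c $ 2 / height s c) (- c $ 3 / height s c)" using pCons.IH by blast
  show ?case
  proof (intro exI[of _ "Suc N\<^sub>0 + N\<^sub>1"] allI impI)
    fix N assume N: "Suc N\<^sub>0 + N\<^sub>1 \<le> N"
    then obtain M where M: "N = Suc M" by (cases N) auto
    obtain H where H: "H \<in> homog (int N)" "\<And>c. height s c \<noteq> 0 \<Longrightarrow>
      eval_at H c = height s c ^ N * poly a (- c $ 2 / height s c)" using N\<^sub>1[of N] N by auto
    obtain G where G: "G \<in> homog (int M)" "\<And>c. height s c \<noteq> 0 \<Longrightarrow>
      eval_at G c = height s c ^ M * eval2 q (- c $ 2 / height s c) (- c $ 3 / height s c)" using N\<^sub>0[of M] N M by auto
    have "H + Const (- 1) * (Var 3 * G) \<in> homog (int N)"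
      using H(1) homog_mult[OF homog_Var G(1), of 3] M by (intro homog_add homog_Const_mult) simp_all
    moreover have "eval_at (H + Const (- 1) * (Var 3 * G)) c
        = height s c ^ N * eval2 (pCons a q) (- c $ 2 / height s c) (- c $ 3 / height s c)"
      if "height s c \<noteq> 0" for c using that by (simp add: H(2) G(2) M field_simps)
    ultimately show "\<exists>G\<in>homog (int N). \<forall>c. height s c \<noteq> 0 \<longrightarrow>
      eval_at G c = height s c ^ N * eval2 (pCons a q) (- c $ 2 / height s c) (- c $ 3 / height s c)" by blast
  qed
qed

text \<open>\<open>q\<close> is a condition on the affine coordinates \<open>(u, v)\<close> of a
  line. Homogenised to \<open>G\<close> it becomes a condition on the coefficient vector. The factor
  \<open>K\<close> in \<open>K * G\<close> excludes the lines through the centre, which have no such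
  coordinates.\<close>

lemma generic_open_set:
  assumes "q \<noteq> 0"
  obtains U where "zariski_open U" "U \<noteq> {}"
    "\<And>p. p \<in> U \<Longrightarrow> \<exists>u v. eval2 q u v \<noteq> 0 \<and> p = vec.span {dual_vec s u v}"
proof -
  obtain N G where G: "G \<in> homog (int N)" "\<And>c. height s c \<noteq> 0 \<Longrightarrow>
    eval_at G c = height s c ^ N * eval2 q (- c $ 2 / height s c) (- c $ 3 / height s c)"
    using homogenization_dual[of s q] by blast
  define K where "K = Var 1 + Const s * Var 2 + Const (s\<^sup>2) * Var 3"
  have K: "K \<in> homog 1" unfolding K_def by (intro homog_add homog_Const_mult homog_Var)
  have eK: "eval_at K c = height s c" for c by (simp add: K_def height_def)
  define U where "U = {p \<in> proj_plane. \<exists>f\<in>{K * G}. \<exists>y\<in>p. eval_at f y \<noteq> 0}"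
  show thesis
  proof (rule that[of U])
    show "zariski_open U"
      unfolding zariski_open_def U_def using homog_mult[OF K G(1)] by (intro exI[of _ "{K * G}"]) auto
    obtain u v where uv: "eval2 q u v \<noteq> 0" using eval2_nonzero[OF assms] by blast
    have "eval_at (K * G) (dual_vec s u v) \<noteq> 0" using uv by (simp add: eK G(2))
    then have "vec.span {dual_vec s u v} \<in> U"
      unfolding U_def proj_plane_iff using dual_vec_nonzero[of s u v] vec.span_base[of "dual_vec s u v" "{dual_vec s u v}"] by blast
    then show "U \<noteq> {}" by blast
    fix p assume "p \<in> U"
    then obtain y where p: "p \<in> proj_plane" and y: "y \<in> p" "eval_at (K * G) y \<noteq> 0" by (auto simp: U_def)
    then have h: "height s y \<noteq> 0" by (simp add: eK)
    then have "y \<noteq> 0" by (auto simp: height_def)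
    obtain c where c: "p = vec.span {c}" using p proj_plane_iff by blast
    then obtain k where "y = k *s c" using y(1) by (auto simp: vec.span_singleton)
    then have "p = vec.span {y}" using c span_scale[of k c] \<open>y \<noteq> 0\<close> by (cases "k = 0") auto
    also have "\<dots> = vec.span {dual_vec s (- y $ 2 / height s y) (- y $ 3 / height s y)}" by (rule span_eq_dual_vec[OF h])
    finally show "\<exists>u v. eval2 q u v \<noteq> 0 \<and> p = vec.span {dual_vec s u v}" using y(2) h by (auto simp: G(2))
  qed
qed

text \<open>For \<open>c \<noteq> 0\<close> the height is a nonzero polynomial in \<open>s\<close>,
  with the entries of \<open>c\<close> as coefficients. This is the reason for putting the centre on
  the conic.\<close>

lemma exists_height_nonzero:
  assumes "finite C" "\<And>c. c \<in> C \<Longrightarrow> c \<noteq> 0"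
  shows "\<exists>s. \<forall>c\<in>C. height s c \<noteq> 0"
proof -
  define P where "P c = [:c $ 1, c $ 2, c $ 3:]" for c :: "complex ^ 3"
  have "P c \<noteq> 0" if "c \<in> C" for c
  proof
    assume "P c = 0"
    then have "c $ 1 = 0" "c $ 2 = 0" "c $ 3 = 0" by (simp_all add: P_def)
    then have "c $ i = 0 $ i" for i using exhaust_3[of i] by auto
    then have "c = 0" by (simp add: vec_eq_iff)
    then show False using assms(2)[OF that] by simp
  qed
  then have "finite (\<Union>c\<in>C. {s. poly (P c) s = 0})" using assms(1) poly_roots_finite by blast
  then obtain s where "s \<notin> (\<Union>c\<in>C. {s. poly (P c) s = 0})" using ex_new_if_finite infinite_UNIV_char_0 by blast
  moreover have "poly (P c) s = height s c" for c by (simp add: P_def height_def power2_eq_square algebra_simps)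
  ultimately show ?thesis by auto
qed

theorem theorem6p9:
  fixes Z :: "(complex ^ 3) set set" and a :: int
  assumes "Z \<subseteq> proj_plane" and "finite Z" and "Z \<noteq> {}"
    and "a = min (initial_degree (D0_module (arrangement Z))) \<lfloor>(real (card Z) - 1) / 2\<rfloor>"
  shows "has_splitting_type (D0_module (arrangement Z)) a (int (card Z) - a - 1)"
proof -
  have "\<forall>p\<in>Z. \<exists>c. c \<noteq> 0 \<and> p = vec.span {c}" using assms(1) proj_plane_iff by blast
  then obtain c where c: "\<And>p. p \<in> Z \<Longrightarrow> c p \<noteq> 0" "\<And>p. p \<in> Z \<Longrightarrow> p = vec.span {c p}" by metis
  \<comment> \<open>Choice of a centre that lies on none of the lines dual to the points of
    \<open>Z\<close>.\<close>
  have "\<exists>s. \<forall>d\<in>c ` Z. height s d \<noteq> 0"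
    by (rule exists_height_nonzero) (use assms(2) c(1) in auto)
  then obtain s where s: "\<And>p. p \<in> Z \<Longrightarrow> height s (c p) \<noteq> 0" by blast
  define \<xi> where "\<xi> p = - c p $ 2 / height s (c p)" for p
  define \<eta> where "\<eta> p = - c p $ 3 / height s (c p)" for p
  have point: "p = vec.span {dual_vec s (\<xi> p) (\<eta> p)}" if "p \<in> Z" for p
    using c(2)[OF that] span_eq_dual_vec[OF s[OF that]] by (simp only: \<xi>_def \<eta>_def)
  have inj: "inj_on (\<lambda>p. (\<xi> p, \<eta> p)) Z"
  proof (rule inj_onI)
    fix p p' assume p: "p \<in> Z" "p' \<in> Z" "(\<xi> p, \<eta> p) = (\<xi> p', \<eta> p')"
    have "p = vec.span {dual_vec s (\<xi> p) (\<eta> p)}" by (rule point[OF p(1)])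
    also have "\<dots> = vec.span {dual_vec s (\<xi> p') (\<eta> p')}" using p(3) by simp
    also have "\<dots> = p'" by (rule point[OF p(2), symmetric])
    finally show "p = p'" .
  qed
  interpret arrangement_lines s Z \<xi> \<eta>
    by (unfold_locales) (rule assms(2,3) inj point, assumption?)+
  obtain q where q: "0 \<le> a" "a \<le> int (card Z) - a - 1" "q \<noteq> 0" "\<And>u v. eval2 q u v \<noteq> 0 \<Longrightarrow>
    sheaf_iso (restrict_to (affine_line s u v) (sheaf_of D0))
      (direct_sum (O_twist (affine_line s u v) (- a)) (O_twist (affine_line s u v) (- (int (card Z) - a - 1))))"
    using generic_splitting[OF assms(4)] by blast
  obtain U where U: "zariski_open U" "U \<noteq> {}"
    "\<And>p. p \<in> U \<Longrightarrow> \<exists>u v. eval2 q u v \<noteq> 0 \<and> p = vec.span {dual_vec s u v}"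
    by (rule generic_open_set[OF q(3), where s = s]) (rule that)
  have "sheaf_iso (restrict_to (dual_line p) (sheaf_of D0))
      (direct_sum (O_twist (dual_line p) (- a)) (O_twist (dual_line p) (- (int (card Z) - a - 1))))" if pU: "p \<in> U" for p
  proof -
    obtain u v where uv: "eval2 q u v \<noteq> 0" "p = vec.span {dual_vec s u v}" using U(3)[OF pU] by blast
    show ?thesis unfolding uv(2) affine_line_def[symmetric] by (rule q(4)[OF uv(1)])
  qed
  then show ?thesis unfolding has_splitting_type_def using q(1,2) U(1,2) by blast
qed

end
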